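(* Let $(r_n)_{n\in\mathbb{N}}$ be a regular sequence enumerating an infinite set $R(\mathbb{Z})\subset\mathbb{N}$, and let $\mathcal{L}$ and $T_R$ be the associated language and $\mathcal{L}$-theory described in the context. Then the theory $T_R$ is superstable.
   Context: Regular sequences. $\mathbb{N}$ contains $0$ and $[n]=\{1,\dots,n\}$. A strictly increasing sequence $(r_n)_{n\in\mathbb{N}}$ of natural numbers is regular if $r_{n+1}/r_n\to\theta$ for some $\theta\in\mathbb{R}^{>1}\cup\{\infty\}$ and, if $\theta$ is (a real number) algebraic over $\mathbb{Q}$, then $(r_n)$ satisfies a linear recurrence relation whose characteristic polynomial is the minimal polynomial of $\theta$ over $\mathbb{Q}$. Here, $(r_n)$ satisfies a linear recurrence relation if there are $a_0,\dots,a_{k-1}\in\mathbb{Q}$, with $k\ge 1$ minimal, such that $r_{n+k}=\sum_{i<k}a_ir_{n+i}$ for all $n$; its characteristic polynomial is $X^k-\sum_{i<k}a_iX^i$. Language. $\mathcal{L}=\{+,-,0,1,R,S,S^{-1},c\}\cup\{D_n\mid n>1\}\cup\{\mathrm{Im}_{[Q],D}\}$, with $R$ and $D_n$ unary predicates, $S,S^{-1}$ unary functions, $c$ a constant. For $Q=\sum_{i=0}^d n_iX^i\in\mathbb{Z}[X]$ let $\mathsf{f}_Q(x)$ be the term $\sum_{i=0}^d n_iS^i(x)$, where $S^0(x)=x$. There is one $n$-ary predicate $\mathrm{Im}_{[Q],D}$ for every matrix $[Q]=(Q_{ij})\in\mathbb{Z}[X]^{n\times m}$ and every set of divisibility conditions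 $D$, i.e. $D$ is either empty or $D=\{(P_i,\ell_i,k_i)\mid i\in[m]\}\subset\mathbb{Z}[X]\times\mathbb{N}\times\mathbb{N}$ with $k_i<\ell_i$. Put $\phi_{[Q]}(\bar x,\bar y):=\bigwedge_{i\in[n]}\sum_{j\in[m]}\mathsf{f}_{Q_{ij}}(x_j)=y_i$ and $\phi_D(\bar x):=\bigwedge_{i\in[m]}D_{\ell_i}(\mathsf{f}_{P_i}(x_i)+k_i)$ (the empty conjunction if $D=\emptyset$; $D_1$ is always true). $\exists x\in R$, $\forall x\in R$ denote quantifiers relativized to $R$; for $e\in\mathbb{N}$, $x>e$ abbreviates $\bigwedge_{i=0}^{e}x\ne i$. Standard structure $\mathscr{Z}_{R,\mathcal{L}}$: domain $\mathbb{Z}$ with the usual $+,-,0,1$; $D_n=n\mathbb{Z}$; $R=\{r_n\mid n\in\mathbb{N}\}$; $c=r_0$; $S(r_n)=r_{n+1}$, $S^{-1}(r_{n+1})=r_n$, $S^{-1}(r_0)=r_0$, and $S(z)=z=S^{-1}(z)$ for $z\notin R$; $\mathrm{Im}_{[Q],D}(\bar y)$ is interpreted by $\exists\bar x\in R\,(\phi_{[Q]}(\bar x,\bar y)\wedge\phi_D(\bar x))$. Constants. $\mathrm{Triv}$ is the set of $Q\in\mathbb{Z}[X]$ with $\mathsf{f}_Q(r_n)=0$ for all $n$. For $Q\notin\mathrm{Triv}$ fix $e(Q)\in\mathbb{N}$ such that for all $n,m$ with $r_n,r_m>e(Q)$, $\mathsf{f}_Q(r_n)=\mathsf{f}_Q(r_m)$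 implies $n=m$. For $\bar Q\in\mathbb{Z}[X]^s$ let $N^{\mathrm{nd}}_{\bar Q}(\bar x,y)$ be the formula $\sum_{i\in[s]}\mathsf{f}_{Q_i}(x_i)=y\wedge\bigwedge_{\emptyset\ne I\subsetneq[s]}\sum_{i\in I}\mathsf{f}_{Q_i}(x_i)\neq0$ and fix a finite set $E_{\bar Q}\subset\mathbb{Z}^s$ such that whenever $\bar\ell\in\mathbb{N}^s$ and $N^{\mathrm{nd}}_{\bar Q}(r_{\ell_1},\dots,r_{\ell_s},0)$ holds in $\mathscr{Z}_{R,\mathcal{L}}$, there is $\bar m\in E_{\bar Q}$ with $\ell_i=\ell_1+m_i$ for all $i\in[s]$. (Such $e(Q)$, $E_{\bar Q}$ exist.) Axioms of $T_R$: (Ax.1) an axiomatization of $\mathrm{Th}(\mathbb{Z},+,-,0,1,D_n\mid n>1)$. (Ax.2) $R(c)$, $R$ is closed under $S$ and $S^{-1}$, and $\forall x\in R(x\ne c\to S(S^{-1}(x))=x)$, $\forall x\in R\,(S^{-1}(S(x))=x)$, $\forall x\in R\,(S(x)\ne c)$, $S^{-1}(c)=c$. (Ax.3) $c=r_0$, i.e. $c=1+\dots+1$ ($r_0$ times). (Ax.4) $\forall x(\neg R(x)\to S(x)=x=S^{-1}(x))$. (Ax.5) for all $\ell_1,\dots,\ell_n$, all $0\le k_i\le\ell_i$ and $\bar Q\in\mathbb{Z}[X]^n$, if $\{\bar z\in R(\mathbb{Z})^n\mid\mathscr{Z}_{R,\mathcal{L}}\models\bigwedge_{i\in[n]}D_{\ell_i}(\mathsf{f}_{Q_i}(z_i)+k_i)\}$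 is a finite set $\{\bar w_1,\dots,\bar w_m\}$, the axiom $\forall\bar x\in R\,(\bigwedge_{i\in[n]}D_{\ell_i}(\mathsf{f}_{Q_i}(x_i)+k_i)\to\bigvee_{i\in[m]}\bigwedge_{j\in[n]}x_j=w_{ij})$. (Ax.6) for all $[Q],D$: $\forall\bar y\,(\mathrm{Im}_{[Q],D}(\bar y)\leftrightarrow\exists\bar x\in R\,(\phi_D(\bar x)\wedge\phi_{[Q]}(\bar x,\bar y)))$. (Ax.7) for $Q\in\mathrm{Triv}$: $\forall x\in R\ \mathsf{f}_Q(x)=0$; for $Q\notin\mathrm{Triv}$, with $e=e(Q)$: $\forall x,y\in R\,(x>e\wedge y>e\wedge x\ne y\to\mathsf{f}_Q(x)\ne\mathsf{f}_Q(y))$. (Ax.8) for all $Q_1,\dots,Q_s\in\mathbb{Z}[X]$: $\forall\bar x\in R\,(N^{\mathrm{nd}}_{\bar Q}(\bar x,0)\to\bigvee_{\bar m\in E_{\bar Q}}\bigwedge_{i\in[s]}x_i=S^{m_i}(x_1))$, where $S^{-k}=(S^{-1})^k$ for $k>0$. *)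

theory Defs
  imports
    Complex_Main
    "HOL-Computational_Algebra.Polynomial"
    "Jordan_Normal_Form.Matrix"
begin

unbundle cardinal_syntax

section \<open>First-order logic\<close>

datatype 'f tm = Var nat | Fn 'f "'f tm list"

datatype ('f, 'p) fm =
    FF
  | Eq "'f tm" "'f tm"
  | Rel 'p "'f tm list"
  | Imp "('f, 'p) fm" "('f, 'p) fm"
  | All nat "('f, 'p) fm"

abbreviation Neg :: "('f, 'p) fm \<Rightarrow> ('f, 'p) fm" where "Neg \<phi> \<equiv> Imp \<phi> FF"
abbreviation TT :: "('f, 'p) fm" where "TT \<equiv> Neg FF"
abbreviation Or :: "('f, 'p) fm \<Rightarrow> ('f, 'p) fm \<Rightarrow> ('f, 'p) fm" where "Or \<phi> \<psi> \<equiv> Imp (Neg \<phi>) \<psi>"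
abbreviation And :: "('f, 'p) fm \<Rightarrow> ('f, 'p) fm \<Rightarrow> ('f, 'p) fm" where "And \<phi> \<psi> \<equiv> Neg (Imp \<phi> (Neg \<psi>))"
abbreviation Iff :: "('f, 'p) fm \<Rightarrow> ('f, 'p) fm \<Rightarrow> ('f, 'p) fm" where "Iff \<phi> \<psi> \<equiv> And (Imp \<phi> \<psi>) (Imp \<psi> \<phi>)"
abbreviation Ex :: "nat \<Rightarrow> ('f, 'p) fm \<Rightarrow> ('f, 'p) fm" where "Ex v \<phi> \<equiv> Neg (All v (Neg \<phi>))"

definition conjs :: "('f, 'p) fm list \<Rightarrow> ('f, 'p) fm" where "conjs \<phi>s = foldr And \<phi>s TT"
definition disjs :: "('f, 'p) fm list \<Rightarrow> ('f, 'p) fm" where "disjs \<phi>s = foldr Or \<phi>s FF"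

primrec tvars :: "'f tm \<Rightarrow> nat set" where
  "tvars (Var v) = {v}"
| "tvars (Fn f ts) = \<Union> (set (map tvars ts))"

primrec fv :: "('f, 'p) fm \<Rightarrow> nat set" where
  "fv FF = {}"
| "fv (Eq s t) = tvars s \<union> tvars t"
| "fv (Rel p ts) = (\<Union>t\<in>set ts. tvars t)"
| "fv (Imp \<phi> \<psi>) = fv \<phi> \<union> fv \<psi>"
| "fv (All v \<phi>) = fv \<phi> - {v}"

text \<open>A language assigns an arity to each of its symbols; \<open>None\<close> means that the symbol does
  not belong to the language.\<close>

record ('f, 'p) lang =
  far :: "'f \<Rightarrow> nat option"
  par :: "'p \<Rightarrow> nat option"

primrec wf_tm :: "('f, 'p) lang \<Rightarrow> 'f tm \<Rightarrow> bool" where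
  "wf_tm L (Var v) = True"
| "wf_tm L (Fn f ts) = (far L f = Some (length ts) \<and> list_all (\<lambda>b. b) (map (wf_tm L) ts))"

primrec wf_fm :: "('f, 'p) lang \<Rightarrow> ('f, 'p) fm \<Rightarrow> bool" where
  "wf_fm L FF = True"
| "wf_fm L (Eq s t) = (wf_tm L s \<and> wf_tm L t)"
| "wf_fm L (Rel p ts) = (par L p = Some (length ts) \<and> (\<forall>t\<in>set ts. wf_tm L t))"
| "wf_fm L (Imp \<phi> \<psi>) = (wf_fm L \<phi> \<and> wf_fm L \<psi>)"
| "wf_fm L (All v \<phi>) = wf_fm L \<phi>"

record ('f, 'p, 'a) struct =
  univ :: "'a set"
  fint :: "'f \<Rightarrow> 'a list \<Rightarrow> 'a"
  pint :: "'p \<Rightarrow> 'a list \<Rightarrow> bool"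

definition is_struct :: "('f, 'p) lang \<Rightarrow> ('f, 'p, 'a) struct \<Rightarrow> bool" where
  "is_struct L M \<longleftrightarrow> univ M \<noteq> {} \<and>
     (\<forall>f as. far L f = Some (length as) \<and> set as \<subseteq> univ M \<longrightarrow> fint M f as \<in> univ M)"

primrec teval :: "('f, 'p, 'a) struct \<Rightarrow> (nat \<Rightarrow> 'a) \<Rightarrow> 'f tm \<Rightarrow> 'a" where
  "teval M e (Var v) = e v"
| "teval M e (Fn f ts) = fint M f (map (teval M e) ts)"

primrec sat :: "('f, 'p, 'a) struct \<Rightarrow> (nat \<Rightarrow> 'a) \<Rightarrow> ('f, 'p) fm \<Rightarrow> bool" where
  "sat M e FF = False"
| "sat M e (Eq s t) = (teval M e s = teval M e t)"
| "sat M e (Rel p ts) = pint M p (map (teval M e) ts)"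
| "sat M e (Imp \<phi> \<psi>) = (sat M e \<phi> \<longrightarrow> sat M e \<psi>)"
| "sat M e (All v \<phi>) = (\<forall>a\<in>univ M. sat M (e(v := a)) \<phi>)"

definition is_model :: "('f, 'p) lang \<Rightarrow> ('f, 'p) fm set \<Rightarrow> ('f, 'p, 'a) struct \<Rightarrow> bool" where
  "is_model L T M \<longleftrightarrow> is_struct L M \<and> (\<forall>\<phi>\<in>T. \<forall>e. range e \<subseteq> univ M \<longrightarrow> sat M e \<phi>)"


section \<open>Types, stability and superstability\<close>

text \<open>The language \<open>L(A)\<close>: each parameter \<open>a \<in> A\<close> becomes a new constant \<open>Inr a\<close>.\<close>

definition lang_params :: "('f, 'p) lang \<Rightarrow> 'a set \<Rightarrow> ('f + 'a, 'p) lang" where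
  "lang_params L A = \<lparr>far = case_sum (far L) (\<lambda>a. if a \<in> A then Some 0 else None), par = par L\<rparr>"

definition struct_params :: "('f, 'p, 'a) struct \<Rightarrow> ('f + 'a, 'p, 'a) struct" where
  "struct_params M = \<lparr>univ = univ M, fint = case_sum (fint M) (\<lambda>a _. a), pint = pint M\<rparr>"

definition fms_over :: "('f, 'p) lang \<Rightarrow> 'a set \<Rightarrow> nat \<Rightarrow> ('f + 'a, 'p) fm set" where
  "fms_over L A n = {\<phi>. wf_fm (lang_params L A) \<phi> \<and> fv \<phi> \<subseteq> {..<n}}"

definition fin_sat :: "('f, 'p, 'a) struct \<Rightarrow> ('f + 'a, 'p) fm set \<Rightarrow> bool" where
  "fin_sat M p \<longleftrightarrow> (\<forall>q. finite q \<and> q \<subseteq> p \<longrightarrow>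
     (\<exists>e. range e \<subseteq> univ M \<and> (\<forall>\<phi>\<in>q. sat (struct_params M) e \<phi>)))"

text \<open>\<open>S\<^sub>n(A)\<close>: the complete \<open>n\<close>-types over \<open>A\<close> in \<open>M\<close>, in the variables \<open>0, \<dots>, n - 1\<close>.\<close>

definition types_over :: "('f, 'p) lang \<Rightarrow> ('f, 'p, 'a) struct \<Rightarrow> 'a set \<Rightarrow> nat \<Rightarrow> ('f + 'a, 'p) fm set set" where
  "types_over L M A n = {p. p \<subseteq> fms_over L A n \<and> fin_sat M p \<and>
     (\<forall>\<phi>\<in>fms_over L A n. \<phi> \<in> p \<or> Neg \<phi> \<in> p)}"

text \<open>Stability in the cardinal \<open>|K|\<close>, for models whose universe is a set of elements of \<open>'a\<close>.\<close>

definition stable_in ::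
  "('f, 'p) lang \<Rightarrow> ('f, 'p) fm set \<Rightarrow> 'a itself \<Rightarrow> 'k set \<Rightarrow> bool" where
  "stable_in L T (_ :: 'a itself) K \<longleftrightarrow>
     (\<forall>M :: ('f, 'p, 'a) struct. is_model L T M \<longrightarrow>
       (\<forall>A \<subseteq> univ M. |A| \<le>o |K| \<longrightarrow> (\<forall>n. |types_over L M A n| \<le>o |K| )))"

text \<open>Superstability: stability in all cardinals \<open>\<lambda> \<ge> 2\<^bsup>|T|\<^esup>\<close>, where \<open>|T|\<close> is the
  number of \<open>L\<close>-formulas. HOL cannot quantify over types inside a definition, so the type
  \<open>'a\<close> of elements of models and the type \<open>'k\<close> in which the cardinals are represented are
  parameters; the property is to be asserted for arbitrary type variables \<open>'a\<close> and \<open>'k\<close>.\<close>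

definition superstable ::
  "('f, 'p) lang \<Rightarrow> ('f, 'p) fm set \<Rightarrow> 'a itself \<Rightarrow> 'k itself \<Rightarrow> bool" where
  "superstable L T (ta :: 'a itself) (_ :: 'k itself) \<longleftrightarrow>
     (\<forall>K :: 'k set. |Pow {\<phi>. wf_fm L \<phi>}| \<le>o |K| \<longrightarrow> stable_in L T ta K)"


section \<open>Regular sequences\<close>

definition satisfies_rec :: "(nat \<Rightarrow> nat) \<Rightarrow> nat \<Rightarrow> (nat \<Rightarrow> rat) \<Rightarrow> bool" where
  "satisfies_rec r k a \<longleftrightarrow> k \<ge> 1 \<and> (\<forall>n. of_nat (r (n + k)) = (\<Sum>i<k. a i * of_nat (r (n + i))))"

definition is_lin_rec :: "(nat \<Rightarrow> nat) \<Rightarrow> nat \<Rightarrow> (nat \<Rightarrow> rat) \<Rightarrow> bool" where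
  "is_lin_rec r k a \<longleftrightarrow> satisfies_rec r k a \<and> (\<forall>k'<k. \<nexists>b. satisfies_rec r k' b)"

definition char_poly_rec :: "nat \<Rightarrow> (nat \<Rightarrow> rat) \<Rightarrow> rat poly" where
  "char_poly_rec k a = monom 1 k - (\<Sum>i<k. monom (a i) i)"

definition is_min_poly :: "rat poly \<Rightarrow> real \<Rightarrow> bool" where
  "is_min_poly p \<theta> \<longleftrightarrow> lead_coeff p = 1 \<and> poly (map_poly of_rat p) \<theta> = 0 \<and>
     (\<forall>q. q \<noteq> 0 \<and> poly (map_poly of_rat q) \<theta> = 0 \<longrightarrow> degree p \<le> degree q)"

definition regular_seq :: "(nat \<Rightarrow> nat) \<Rightarrow> bool" where
  "regular_seq r \<longleftrightarrow> strict_mono r \<and>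
     (filterlim (\<lambda>n. real (r (Suc n)) / real (r n)) at_top sequentially \<or>
      (\<exists>\<theta>>1. (\<lambda>n. real (r (Suc n)) / real (r n)) \<longlonglongrightarrow> \<theta> \<and>
         (algebraic \<theta> \<longrightarrow> (\<exists>k a. is_lin_rec r k a \<and> is_min_poly (char_poly_rec k a) \<theta>))))"


section \<open>The language and its standard structure\<close>

text \<open>A set of divisibility conditions is a list of triples \<open>(P\<^sub>i, l\<^sub>i, k\<^sub>i)\<close>; the \<open>i\<close>-th triple
  is the condition on the \<open>i\<close>-th variable.\<close>

type_synonym conds = "(int poly \<times> nat \<times> nat) list"

datatype fsym = Plus | Minus | Zero | One | Succ | SuccInv | Cst
datatype psym = InR | Dvs nat | Im "int poly mat" conds

type_synonym rtm = "fsym tm"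
type_synonym rfm = "(fsym, psym) fm"

fun fsym_arity :: "fsym \<Rightarrow> nat" where
  "fsym_arity Plus = 2"
| "fsym_arity Minus = 1"
| "fsym_arity Zero = 0"
| "fsym_arity One = 0"
| "fsym_arity Succ = 1"
| "fsym_arity SuccInv = 1"
| "fsym_arity Cst = 0"

definition valid_conds :: "nat \<Rightarrow> conds \<Rightarrow> bool" where
  "valid_conds m D \<longleftrightarrow> (D = [] \<or> length D = m) \<and> (\<forall>(P, l, k)\<in>set D. k < l)"

definition valid_Im :: "int poly mat \<Rightarrow> conds \<Rightarrow> bool" where
  "valid_Im Q D \<longleftrightarrow> dim_row Q \<ge> 1 \<and> dim_col Q \<ge> 1 \<and> valid_conds (dim_col Q) D"

fun psym_arity :: "psym \<Rightarrow> nat option" where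
  "psym_arity InR = Some 1"
| "psym_arity (Dvs n) = (if n > 1 then Some 1 else None)"
| "psym_arity (Im Q D) = (if valid_Im Q D then Some (dim_row Q) else None)"

definition LR :: "(fsym, psym) lang" where
  "LR = \<lparr>far = (\<lambda>f. Some (fsym_arity f)), par = psym_arity\<rparr>"

text \<open>The sublanguage \<open>{+, -, 0, 1} \<union> {D\<^sub>n | n > 1}\<close>.\<close>

definition L0 :: "(fsym, psym) lang" where
  "L0 = \<lparr>far = (\<lambda>f. if f \<in> {Plus, Minus, Zero, One} then Some (fsym_arity f) else None),
         par = (\<lambda>p. case p of Dvs n \<Rightarrow> psym_arity p | _ \<Rightarrow> None)\<rparr>"

abbreviation zero_tm :: rtm where "zero_tm \<equiv> Fn Zero []"
abbreviation one_tm :: rtm where "one_tm \<equiv> Fn One []"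
abbreviation c_tm :: rtm where "c_tm \<equiv> Fn Cst []"
abbreviation plus_tm :: "rtm \<Rightarrow> rtm \<Rightarrow> rtm" where "plus_tm s t \<equiv> Fn Plus [s, t]"
abbreviation minus_tm :: "rtm \<Rightarrow> rtm" where "minus_tm t \<equiv> Fn Minus [t]"
abbreviation S_tm :: "rtm \<Rightarrow> rtm" where "S_tm t \<equiv> Fn Succ [t]"
abbreviation Sinv_tm :: "rtm \<Rightarrow> rtm" where "Sinv_tm t \<equiv> Fn SuccInv [t]"

definition sum_tm :: "rtm list \<Rightarrow> rtm" where
  "sum_tm ts = foldr plus_tm ts zero_tm"

definition mult_tm :: "int \<Rightarrow> rtm \<Rightarrow> rtm" where
  "mult_tm n t = (if n \<ge> 0 then sum_tm (replicate (nat n) t)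
                  else minus_tm (sum_tm (replicate (nat (- n)) t)))"

definition num_tm :: "int \<Rightarrow> rtm" where
  "num_tm n = mult_tm n one_tm"

definition Spow_tm :: "int \<Rightarrow> rtm \<Rightarrow> rtm" where
  "Spow_tm m t = (if m \<ge> 0 then (S_tm ^^ nat m) t else (Sinv_tm ^^ nat (- m)) t)"

text \<open>The term \<open>f\<^sub>Q(t) = \<Sum>\<^sub>i n\<^sub>i S\<^sup>i(t)\<close> for \<open>Q = \<Sum>\<^sub>i n\<^sub>i X\<^sup>i\<close>.\<close>

definition f_tm :: "int poly \<Rightarrow> rtm \<Rightarrow> rtm" where
  "f_tm Q t = sum_tm (map (\<lambda>i. mult_tm (poly.coeff Q i) (Spow_tm (int i) t)) [0..<Suc (degree Q)])"

abbreviation InR_fm :: "rtm \<Rightarrow> rfm" where "InR_fm t \<equiv> Rel InR [t]"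
abbreviation AllR :: "nat \<Rightarrow> rfm \<Rightarrow> rfm" where "AllR v \<phi> \<equiv> All v (Imp (InR_fm (Var v)) \<phi>)"
abbreviation ExR :: "nat \<Rightarrow> rfm \<Rightarrow> rfm" where "ExR v \<phi> \<equiv> Ex v (And (InR_fm (Var v)) \<phi>)"

definition D_fm :: "nat \<Rightarrow> rtm \<Rightarrow> rfm" where
  "D_fm l t = (if l = 1 then TT else Rel (Dvs l) [t])"

definition phi_Q :: "int poly mat \<Rightarrow> rtm list \<Rightarrow> rtm list \<Rightarrow> rfm" where
  "phi_Q Q xs ys = conjs (map (\<lambda>i. Eq (sum_tm (map (\<lambda>j. f_tm (Q $$ (i, j)) (xs ! j)) [0..<dim_col Q]))
                                     (ys ! i)) [0..<dim_row Q])"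

definition phi_D :: "conds \<Rightarrow> rtm list \<Rightarrow> rfm" where
  "phi_D D xs = conjs (map (\<lambda>((P, l, k), x). D_fm l (plus_tm (f_tm P x) (num_tm (int k)))) (zip D xs))"

text \<open>The formula \<open>\<exists>x \<in> R (\<phi>\<^sub>D(x) \<and> \<phi>\<^sub>Q(x, y))\<close>; \<open>y\<close> is the tuple of variables
  \<open>0, \<dots>, n - 1\<close> and \<open>x\<close> the tuple of variables \<open>n, \<dots>, n + m - 1\<close>.\<close>

definition Im_fm :: "int poly mat \<Rightarrow> conds \<Rightarrow> rfm" where
  "Im_fm Q D = (let n = dim_row Q; m = dim_col Q; xs = map Var [n..<n + m]; ys = map Var [0..<n]
     in foldr ExR [n..<n + m] (And (phi_D D xs) (phi_Q Q xs ys)))"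

definition Rset :: "(nat \<Rightarrow> nat) \<Rightarrow> int set" where
  "Rset r = range (\<lambda>n. int (r n))"

definition idx :: "(nat \<Rightarrow> nat) \<Rightarrow> int \<Rightarrow> nat" where
  "idx r z = (THE n. int (r n) = z)"

fun Z_fun :: "(nat \<Rightarrow> nat) \<Rightarrow> fsym \<Rightarrow> int list \<Rightarrow> int" where
  "Z_fun r Plus [x, y] = x + y"
| "Z_fun r Minus [x] = - x"
| "Z_fun r Zero [] = 0"
| "Z_fun r One [] = 1"
| "Z_fun r Succ [z] = (if z \<in> Rset r then int (r (Suc (idx r z))) else z)"
| "Z_fun r SuccInv [z] = (if z \<in> Rset r then int (r (idx r z - 1)) else z)"
| "Z_fun r Cst [] = int (r 0)"
| "Z_fun r _ _ = 0"

text \<open>The predicates \<open>Im\<close> are not yet interpreted in \<open>Z_base\<close>. They do not occur in \<open>Im_fm\<close>,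
  which is what \<open>Z_str\<close> uses to interpret them.\<close>

fun base_pred :: "(nat \<Rightarrow> nat) \<Rightarrow> psym \<Rightarrow> int list \<Rightarrow> bool" where
  "base_pred r InR [z] = (z \<in> Rset r)"
| "base_pred r (Dvs n) [z] = (int n dvd z)"
| "base_pred r _ _ = False"

definition Z_base :: "(nat \<Rightarrow> nat) \<Rightarrow> (fsym, psym, int) struct" where
  "Z_base r = \<lparr>univ = UNIV, fint = Z_fun r, pint = base_pred r\<rparr>"

fun Z_pred :: "(nat \<Rightarrow> nat) \<Rightarrow> psym \<Rightarrow> int list \<Rightarrow> bool" where
  "Z_pred r (Im Q D) ys = sat (Z_base r) (\<lambda>i. ys ! i) (Im_fm Q D)"
| "Z_pred r p zs = base_pred r p zs"

definition Z_str :: "(nat \<Rightarrow> nat) \<Rightarrow> (fsym, psym, int) struct" where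
  "Z_str r = \<lparr>univ = UNIV, fint = Z_fun r, pint = Z_pred r\<rparr>"


section \<open>The constants and the axioms\<close>

text \<open>The value of \<open>f\<^sub>Q\<close> at \<open>z\<close> in the standard structure.\<close>

definition f_val :: "(nat \<Rightarrow> nat) \<Rightarrow> int poly \<Rightarrow> int \<Rightarrow> int" where
  "f_val r Q z = teval (Z_str r) (\<lambda>_. z) (f_tm Q (Var 0))"

definition Triv :: "(nat \<Rightarrow> nat) \<Rightarrow> int poly set" where
  "Triv r = {Q. \<forall>n. f_val r Q (int (r n)) = 0}"

definition is_e :: "(nat \<Rightarrow> nat) \<Rightarrow> (int poly \<Rightarrow> nat) \<Rightarrow> bool" where
  "is_e r e \<longleftrightarrow> (\<forall>Q. Q \<notin> Triv r \<longrightarrow>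
     (\<forall>n m. r n > e Q \<and> r m > e Q \<and> f_val r Q (int (r n)) = f_val r Q (int (r m)) \<longrightarrow> n = m))"

definition N_nd :: "int poly list \<Rightarrow> rtm list \<Rightarrow> rtm \<Rightarrow> rfm" where
  "N_nd Qs xs y = (let s = length Qs; \<Sigma> = (\<lambda>I. sum_tm (map (\<lambda>i. f_tm (Qs ! i) (xs ! i)) I)) in
     And (Eq (\<Sigma> [0..<s]) y)
         (conjs (map (\<lambda>I. Neg (Eq (\<Sigma> I) zero_tm))
            (filter (\<lambda>I. I \<noteq> [] \<and> I \<noteq> [0..<s]) (subseqs [0..<s])))))"

definition is_E :: "(nat \<Rightarrow> nat) \<Rightarrow> (int poly list \<Rightarrow> int list set) \<Rightarrow> bool" where
  "is_E r E \<longleftrightarrow> (\<forall>Qs. Qs \<noteq> [] \<longrightarrow>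
     finite (E Qs) \<and> (\<forall>m\<in>E Qs. length m = length Qs) \<and>
     (\<forall>l :: nat list. length l = length Qs \<and>
        sat (Z_str r) (\<lambda>i. int (r (l ! i))) (N_nd Qs (map Var [0..<length Qs]) zero_tm) \<longrightarrow>
        (\<exists>m\<in>E Qs. \<forall>i<length Qs. int (l ! i) = int (l ! 0) + m ! i)))"

definition Ax1 :: "(nat \<Rightarrow> nat) \<Rightarrow> rfm set" where
  "Ax1 r = {\<phi>. wf_fm L0 \<phi> \<and> fv \<phi> = {} \<and> (\<forall>v. sat (Z_str r) v \<phi>)}"

definition Ax2 :: "rfm set" where
  "Ax2 = (let x = Var 0 in
    {InR_fm c_tm,
     AllR 0 (InR_fm (S_tm x)),
     AllR 0 (InR_fm (Sinv_tm x)),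
     AllR 0 (Imp (Neg (Eq x c_tm)) (Eq (S_tm (Sinv_tm x)) x)),
     AllR 0 (Eq (Sinv_tm (S_tm x)) x),
     AllR 0 (Neg (Eq (S_tm x) c_tm)),
     Eq (Sinv_tm c_tm) c_tm})"

definition Ax3 :: "(nat \<Rightarrow> nat) \<Rightarrow> rfm set" where
  "Ax3 r = {Eq c_tm (num_tm (int (r 0)))}"

definition Ax4 :: "rfm set" where
  "Ax4 = (let x = Var 0 in
    {All 0 (Imp (Neg (InR_fm x)) (And (Eq (S_tm x) x) (Eq x (Sinv_tm x))))})"

definition div_sols :: "(nat \<Rightarrow> nat) \<Rightarrow> conds \<Rightarrow> int list set" where
  "div_sols r D = {z. length z = length D \<and> set z \<subseteq> Rset r \<and>
     sat (Z_str r) (\<lambda>i. z ! i) (phi_D D (map Var [0..<length D]))}"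

text \<open>A finite set of tuples is turned into a disjunction along an enumeration \<open>ws\<close> of it; all
  enumerations are admitted, which yields logically equivalent axioms. Likewise for \<open>Ax8\<close>.\<close>

definition Ax5 :: "(nat \<Rightarrow> nat) \<Rightarrow> rfm set" where
  "Ax5 r = {foldr AllR [0..<n]
       (Imp (phi_D D (map Var [0..<n]))
            (disjs (map (\<lambda>w. conjs (map (\<lambda>j. Eq (Var j) (num_tm (w ! j))) [0..<n])) ws)))
     | D n ws. n = length D \<and> (\<forall>(P, l, k)\<in>set D. l \<ge> 1 \<and> k \<le> l) \<and>
               finite (div_sols r D) \<and> distinct ws \<and> set ws = div_sols r D}"

definition Ax6 :: "rfm set" where
  "Ax6 = {foldr All [0..<n] (Iff (Rel (Im Q D) (map Var [0..<n])) (Im_fm Q D))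
     | Q D n. n = dim_row Q \<and> valid_Im Q D}"

definition gt_fm :: "rtm \<Rightarrow> nat \<Rightarrow> rfm" where
  "gt_fm t e = conjs (map (\<lambda>i. Neg (Eq t (num_tm (int i)))) [0..<Suc e])"

definition Ax7 :: "(nat \<Rightarrow> nat) \<Rightarrow> (int poly \<Rightarrow> nat) \<Rightarrow> rfm set" where
  "Ax7 r e = (let x = Var 0; y = Var 1 in
     {AllR 0 (Eq (f_tm Q x) zero_tm) | Q. Q \<in> Triv r} \<union>
     {AllR 0 (AllR 1 (Imp (conjs [gt_fm x (e Q), gt_fm y (e Q), Neg (Eq x y)])
                          (Neg (Eq (f_tm Q x) (f_tm Q y))))) | Q. Q \<notin> Triv r})"

definition Ax8 :: "(int poly list \<Rightarrow> int list set) \<Rightarrow> rfm set" where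
  "Ax8 E = {foldr AllR [0..<s]
       (Imp (N_nd Qs (map Var [0..<s]) zero_tm)
            (disjs (map (\<lambda>m. conjs (map (\<lambda>i. Eq (Var i) (Spow_tm (m ! i) (Var 0))) [0..<s])) ms)))
     | Qs s ms. Qs \<noteq> [] \<and> s = length Qs \<and> distinct ms \<and> set ms = E Qs}"

definition T_R ::
  "(nat \<Rightarrow> nat) \<Rightarrow> (int poly \<Rightarrow> nat) \<Rightarrow> (int poly list \<Rightarrow> int list set) \<Rightarrow> rfm set" where
  "T_R r e E = Ax1 r \<union> Ax2 \<union> Ax3 r \<union> Ax4 \<union> Ax5 r \<union> Ax6 \<union> Ax7 r e \<union> Ax8 E"

end

theory Submission
  imports Defs "HOL-Algebra.Generated_Groups" "HOL-Library.Countable_Set"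
begin

text \<open>Superstability is proved by counting: over a set \<open>A\<close> of at most \<open>|K|\<close> parameters, where
  \<open>K\<close> has at least the cardinality of the continuum, there are at most \<open>|K|\<close> complete types.
  It is enough to attach to each type a code, out of a collection of at most \<open>|K|\<close> codes, and to
  show that types with equal codes are equal.

  The structure of a model is simple. Its additive group is torsion free with the residues of the
  integers, and \<open>S\<close> divides the distinguished set \<open>R\<close> into orbits. The axiom on nondegenerate
  solutions, for the polynomials 1 and -1, says that different orbits are independent: a vanishing
  signed sum of elements of \<open>R\<close> splits into vanishing sums inside single orbits
  (\<open>orbits_independent\<close>). Consider an element over a subgroup \<open>B\<close> that is closed under division and
  under \<open>S\<close>, and that is independent from \<open>R\<close> over \<open>B \<inter> R\<close>. Three cases are basic. Some
  multiple of the element may lie in \<open>B\<close>. It may be a new element of \<open>R\<close>; then its orbit satisfies no equations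
  over \<open>B\<close>, and all that matters are the equations and congruences that its own shifts satisfy
  (\<open>good_ext_R\<close>). Or it is independent of \<open>B\<close> and \<open>R\<close> together; then only its residues matter
  (\<open>good_ext_free\<close>). Otherwise a multiple of it lies in the sum of \<open>B\<close> and
  the subgroup generated by finitely many elements of \<open>R\<close>, and one adds these first. So the type of a tuple is determined by a finite list of data,
  each consisting of one parameter together with finite information, or of a set of formulas in one
  variable without parameters. There are at most \<open>|K|\<close> such lists.

  That this information does determine the type is shown by back and forth in an ultrapower over the
  natural numbers. It is countably saturated by a diagonal argument (\<open>upow_saturated\<close>), and
  countable partial isomorphisms of the kind described extend to further elements (\<open>forth\<close>). For a new
  element of \<open>R\<close>, saturation provides an image outside the range unless the element is
  algebraic, and algebraic elements are put into all domains from the start. For a free element one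
  has to see that no finite set of equations modulo sums of a bounded number of elements of \<open>R\<close> is
  exhaustive; a sum of many elements from different orbits escapes them (\<open>sparse\<close>). The predicates
  \<open>Im\<close> need no treatment of their own, because they are defined by formulas of the remaining language
  (\<open>bf_pint\<close>).

  Types over \<open>A\<close> are given by ultrafilters on assignments (\<open>type_ultrafilter\<close>), and codes are read
  off from coordinate functions modulo such an ultrafilter (\<open>ex_pres\<close>). If two types have the same
  codes and a formula is given, then only countably many parameters and conditions are involved.
  Sequences of assignments that meet these conditions turn the two types into two tuples of the
  ultrapower with the same codes, and these tuples satisfy the same formulas
  (\<open>same_code_same_type\<close>).\<close>

section \<open>Ultrafilters, ultrapowers and countable saturation\<close>

definition ultra :: "'x filter \<Rightarrow> bool" where
  "ultra F \<longleftrightarrow> F \<noteq> bot \<and> (\<forall>P. eventually P F \<or> eventually (\<lambda>x. \<not> P x) F)"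

lemma ultra_not: "ultra F \<Longrightarrow> eventually (\<lambda>x. \<not> P x) F \<longleftrightarrow> \<not> eventually P F"
proof
  assume u: "ultra F" and n: "eventually (\<lambda>x. \<not> P x) F"
  show "\<not> eventually P F"
  proof
    assume "eventually P F"
    with n have "eventually (\<lambda>_. False) F" by eventually_elim simp
    then show False using u by (simp add: ultra_def)
  qed
qed (auto simp: ultra_def)

lemma ultra_imp: "ultra F \<Longrightarrow> eventually (\<lambda>x. P x \<longrightarrow> Q x) F \<longleftrightarrow> (eventually P F \<longrightarrow> eventually Q F)"
proof
  assume u: "ultra F" and i: "eventually P F \<longrightarrow> eventually Q F"
  show "eventually (\<lambda>x. P x \<longrightarrow> Q x) F"
  proof (cases "eventually P F")
    case True
    then show ?thesis using i by (auto elim: eventually_mono)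
  next
    case False
    then have "eventually (\<lambda>x. \<not> P x) F" using u ultra_not by blast
    then show ?thesis by (auto elim: eventually_mono)
  qed
next
  assume "eventually (\<lambda>x. P x \<longrightarrow> Q x) F"
  then show "eventually P F \<longrightarrow> eventually Q F" by (auto dest: eventually_mp)
qed

lemma eventually_iff_cong: "eventually (\<lambda>x. P x \<longleftrightarrow> Q x) F \<Longrightarrow> eventually P F \<longleftrightarrow> eventually Q F"
proof
  assume e: "eventually (\<lambda>x. P x \<longleftrightarrow> Q x) F"
  show "eventually Q F" if "eventually P F" using e that by eventually_elim simp
  show "eventually P F" if "eventually Q F" using e that by eventually_elim simp
qed

text \<open>An ultrafilter is a minimal proper filter, so Zorn's lemma applies: the infimum of a chain
  of proper filters is proper. If neither \<open>P\<close> nor its negation held eventually, then adding \<open>P\<close>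
  to the filter would give a smaller proper one.\<close>

lemma ex_ultra:
  assumes "F \<noteq> bot"
  obtains U where "U \<le> F" "ultra U"
proof -
  let ?A = "{G. G \<noteq> bot \<and> G \<le> F}"
  let ?P = "\<lambda>a b :: 'a filter. b \<le> a"
  have "\<exists>m\<in>?A. \<forall>a\<in>?A. ?P m a \<longrightarrow> a = m"
  proof (rule predicate_Zorn)
    show "partial_order_on ?A (relation_of ?P ?A)"
      by (auto simp: partial_order_on_def preorder_on_def relation_of_def refl_on_def trans_def antisym_def)
    fix C assume C: "C \<in> Chains (relation_of ?P ?A)"
    show "\<exists>u\<in>?A. \<forall>a\<in>C. ?P a u"
    proof (cases "C = {}")
      case True
      then show ?thesis using assms by auto
    next
      case False
      have CA: "C \<subseteq> ?A" using C by (auto simp: Chains_def relation_of_def)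
      have "eventually P (Inf C) \<longleftrightarrow> (\<exists>b\<in>C. eventually P b)" for P
      proof (rule eventually_Inf_base[OF False])
        fix G H assume "G \<in> C" "H \<in> C"
        then have "G \<le> H \<or> H \<le> G" using C by (auto simp: Chains_def relation_of_def)
        then show "\<exists>x\<in>C. x \<le> inf G H" using \<open>G \<in> C\<close> \<open>H \<in> C\<close>
          by (metis inf.absorb1 inf.absorb2 order_refl)
      qed
      then have "eventually (\<lambda>_. False) (Inf C) \<longleftrightarrow> (\<exists>b\<in>C. eventually (\<lambda>_. False) b)" .
      then have "Inf C \<noteq> bot"
        unfolding trivial_limit_def[symmetric] using CA by blast
      moreover obtain b where "b \<in> C" using False by blast
      then have "Inf C \<le> F" using CA Inf_lower2[of b C F] by blast
      ultimately show ?thesis by (intro bexI[of _ "Inf C"]) (simp_all add: Inf_lower)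
    qed
  qed
  then obtain m where m: "m \<noteq> bot" "m \<le> F" and mx: "\<And>a. a \<noteq> bot \<Longrightarrow> a \<le> F \<Longrightarrow> a \<le> m \<Longrightarrow> a = m"
    by blast
  have "ultra m"
    unfolding ultra_def
  proof (intro conjI allI m(1))
    fix P
    show "eventually P m \<or> eventually (\<lambda>x. \<not> P x) m"
    proof (rule disjCI)
      assume n: "\<not> eventually (\<lambda>x. \<not> P x) m"
      let ?a = "inf m (principal {x. P x})"
      have "?a \<noteq> bot"
        using n unfolding trivial_limit_def eventually_inf_principal by simp
      then have "?a = m" using m by (intro mx le_infI1 inf_le1)
      then show "eventually P m"
        using eventually_inf_principal[of P m "{x. P x}"] by simp
    qed
  qed
  then show ?thesis using that m by blast
qed

text \<open>Elements of the ultrapower are chosen representatives of sequences modulo almost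
  everywhere equality, instead of equivalence classes: an element is then itself a sequence, and
  its value at place \<open>k\<close> can be spoken of.\<close>

definition repr :: "'a set \<Rightarrow> nat filter \<Rightarrow> (nat \<Rightarrow> 'a) \<Rightarrow> (nat \<Rightarrow> 'a)" where
  "repr U W \<xi> = (SOME \<eta>. range \<eta> \<subseteq> U \<and> (\<forall>\<^sub>F k in W. \<eta> k = \<xi> k))"

definition upow :: "nat filter \<Rightarrow> ('f, 'p, 'a) struct \<Rightarrow> ('f, 'p, nat \<Rightarrow> 'a) struct" where
  "upow W M = \<lparr>univ = repr (univ M) W ` {\<xi>. range \<xi> \<subseteq> univ M},
     fint = (\<lambda>f as. repr (univ M) W (\<lambda>k. fint M f (map (\<lambda>a. a k) as))),
     pint = (\<lambda>p as. \<forall>\<^sub>F k in W. pint M p (map (\<lambda>a. a k) as))\<rparr>"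

lemma repr:
  assumes "range \<xi> \<subseteq> U"
  shows "range (repr U W \<xi>) \<subseteq> U" and "\<forall>\<^sub>F k in W. repr U W \<xi> k = \<xi> k"
proof -
  have "\<exists>\<eta>. range \<eta> \<subseteq> U \<and> (\<forall>\<^sub>F k in W. \<eta> k = \<xi> k)"
    using assms by (intro exI[of _ \<xi>]) auto
  from someI_ex[OF this]
  show "range (repr U W \<xi>) \<subseteq> U" and "\<forall>\<^sub>F k in W. repr U W \<xi> k = \<xi> k"
    unfolding repr_def by auto
qed

lemma repr_cong:
  assumes "\<forall>\<^sub>F k in W. \<xi> k = \<xi>' k"
  shows "repr U W \<xi> = repr U W \<xi>'"
proof -
  have "(\<forall>\<^sub>F k in W. \<eta> k = \<xi> k) \<longleftrightarrow> (\<forall>\<^sub>F k in W. \<eta> k = \<xi>' k)" for \<eta>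
    by (rule eventually_iff_cong) (use assms in eventually_elim, simp)
  then show ?thesis unfolding repr_def by simp
qed

lemma univ_upow_range: "a \<in> univ (upow W M) \<Longrightarrow> a k \<in> univ M"
  unfolding upow_def by (auto dest: repr(1)[THEN subsetD, OF _ rangeI])

lemma repr_in_upow: "range \<xi> \<subseteq> univ M \<Longrightarrow> repr (univ M) W \<xi> \<in> univ (upow W M)"
  by (auto simp: upow_def)

lemma upow_eqI:
  assumes "a \<in> univ (upow W M)" "b \<in> univ (upow W M)" "\<forall>\<^sub>F k in W. a k = b k"
  shows "a = b"
proof -
  obtain \<xi> \<eta> where x: "range \<xi> \<subseteq> univ M" "a = repr (univ M) W \<xi>" "range \<eta> \<subseteq> univ M" "b = repr (univ M) W \<eta>"
    using assms by (auto simp: upow_def)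
  have "\<forall>\<^sub>F k in W. \<xi> k = \<eta> k"
    using repr(2)[OF x(1), of W] repr(2)[OF x(3), of W] assms(3)[unfolded x(2,4)]
    by eventually_elim simp
  then show ?thesis using repr_cong x by metis
qed

lemma upow_eq_iff:
  assumes "a \<in> univ (upow W M)" "b \<in> univ (upow W M)"
  shows "a = b \<longleftrightarrow> (\<forall>\<^sub>F k in W. a k = b k)"
  using upow_eqI[OF assms] by auto

lemma teval_in:
  assumes "is_struct L M" "wf_tm L t" "\<And>v. v \<in> tvars t \<Longrightarrow> e v \<in> univ M"
  shows "teval M e t \<in> univ M"
  using assms(2,3)
proof (induction t)
  case (Fn f ts)
  have "set (map (teval M e) ts) \<subseteq> univ M"
    using Fn by (auto simp: list_all_iff)
  then show ?case using assms(1) Fn.prems unfolding is_struct_def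
    by (metis length_map teval.simps(2) wf_tm.simps(2))
qed auto

lemma upow_is_struct:
  assumes "is_struct L M"
  shows "is_struct L (upow W M)"
  unfolding is_struct_def
proof (intro conjI allI impI)
  obtain a where "a \<in> univ M" using assms by (auto simp: is_struct_def)
  then show "univ (upow W M) \<noteq> {}" by (auto simp: upow_def intro!: exI[of _ "\<lambda>_. a"])
  fix f as assume as: "far L f = Some (length as) \<and> set as \<subseteq> univ (upow W M)"
  have "fint M f (map (\<lambda>a. a k) as) \<in> univ M" for k
  proof -
    have "set (map (\<lambda>a. a k) as) \<subseteq> univ M" using as univ_upow_range by fastforce
    moreover have "far L f = Some (length (map (\<lambda>a. a k) as))" using as by simp
    ultimately show ?thesis using assms unfolding is_struct_def by blast
  qed
  then show "fint (upow W M) f as \<in> univ (upow W M)"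
    by (auto simp: upow_def)
qed

lemma los_tm:
  assumes "is_struct L M" "wf_tm L t" "\<And>v. v \<in> tvars t \<Longrightarrow> e v \<in> univ (upow W M)"
  shows "\<forall>\<^sub>F k in W. teval (upow W M) e t k = teval M (\<lambda>v. e v k) t"
  using assms(2,3)
proof (induction t)
  case (Fn f ts)
  have wf: "\<And>t. t \<in> set ts \<Longrightarrow> wf_tm L t" using Fn.prems by (auto simp: list_all_iff)
  have ev: "\<forall>\<^sub>F k in W. \<forall>t\<in>set ts. teval (upow W M) e t k = teval M (\<lambda>v. e v k) t"
    using Fn wf by (auto simp: eventually_ball_finite_distrib)
  have "teval (upow W M) e t \<in> univ (upow W M)" if "t \<in> set ts" for t
    using teval_in[OF upow_is_struct[OF assms(1)] wf[OF that]] Fn.prems that by auto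
  then have "set (map ((\<lambda>a. a k) \<circ> teval (upow W M) e) ts) \<subseteq> univ M" for k
    using univ_upow_range[of _ W M] by auto
  moreover have "far L f = Some (length (map ((\<lambda>a. a k) \<circ> teval (upow W M) e) ts))" for k
    using Fn.prems by simp
  ultimately have "fint M f (map ((\<lambda>a. a k) \<circ> teval (upow W M) e) ts) \<in> univ M" for k
    using assms(1) unfolding is_struct_def by blast
  then have "\<forall>\<^sub>F k in W. teval (upow W M) e (Fn f ts) k = fint M f (map ((\<lambda>a. a k) \<circ> teval (upow W M) e) ts)"
    using repr(2)[of "\<lambda>k. fint M f (map ((\<lambda>a. a k) \<circ> teval (upow W M) e) ts)" "univ M" W]
    by (auto simp: upow_def)
  with ev show ?case
    by eventually_elim (auto simp: o_def cong: map_cong)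
qed auto

lemma sat_cong: "(\<And>v. v \<in> fv \<phi> \<Longrightarrow> e v = e' v) \<Longrightarrow> sat M e \<phi> = sat M e' \<phi>"
proof -
  have tv: "(\<And>v. v \<in> tvars t \<Longrightarrow> e v = e' v) \<Longrightarrow> teval M e t = teval M e' t" for t e e'
  proof (induction t)
    case (Fn f ts)
    have "map (teval M e) ts = map (teval M e') ts"
      by (rule map_cong[OF refl]) (rule Fn.IH, use Fn.prems in auto)
    then show ?case by (simp only: teval.simps)
  qed simp
  show "(\<And>v. v \<in> fv \<phi> \<Longrightarrow> e v = e' v) \<Longrightarrow> sat M e \<phi> = sat M e' \<phi>"
  proof (induction \<phi> arbitrary: e e')
    case (Eq s t)
    have "teval M e s = teval M e' s" "teval M e t = teval M e' t"
      by (rule tv, use Eq in simp)+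
    then show ?case by simp
  next
    case (Rel p ts)
    have "map (teval M e) ts = map (teval M e') ts"
      by (rule map_cong[OF refl]) (rule tv, use Rel in auto)
    then show ?case by (simp only: sat.simps)
  next
    case (Imp \<phi> \<psi>)
    have "sat M e \<phi> = sat M e' \<phi>" "sat M e \<psi> = sat M e' \<psi>"
      by (rule Imp.IH, use Imp.prems in simp)+
    then show ?case by simp
  next
    case (All v \<phi>)
    have "sat M (e(v := a)) \<phi> = sat M (e'(v := a)) \<phi>" for a
      using All.prems by (intro All.IH) auto
    then show ?case by simp
  qed auto
qed

text \<open>Los's theorem. If a universal formula fails almost everywhere, counterexamples are chosen
  at each place that has one; the representative of the sequence they form is then a
  counterexample in the ultrapower.\<close>

theorem los:
  assumes W: "ultra W" and M: "is_struct L M"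
  shows "wf_fm L \<phi> \<Longrightarrow> (\<And>v. v \<in> fv \<phi> \<Longrightarrow> e v \<in> univ (upow W M)) \<Longrightarrow>
    sat (upow W M) e \<phi> \<longleftrightarrow> (\<forall>\<^sub>F k in W. sat M (\<lambda>v. e v k) \<phi>)"
proof (induction \<phi> arbitrary: e)
  case FF
  then show ?case using W by (simp add: ultra_def)
next
  case (Eq s t)
  have st: "\<forall>\<^sub>F k in W. teval (upow W M) e s k = teval M (\<lambda>v. e v k) s"
    "\<forall>\<^sub>F k in W. teval (upow W M) e t k = teval M (\<lambda>v. e v k) t"
    by (rule los_tm[OF M], use Eq in simp, use Eq in simp)+
  have "sat (upow W M) e (Eq s t) \<longleftrightarrow> (\<forall>\<^sub>F k in W. teval (upow W M) e s k = teval (upow W M) e t k)"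
    using teval_in[OF upow_is_struct[OF M]] Eq by (subst sat.simps, subst upow_eq_iff) auto
  also have "\<dots> \<longleftrightarrow> (\<forall>\<^sub>F k in W. teval M (\<lambda>v. e v k) s = teval M (\<lambda>v. e v k) t)"
    by (rule eventually_iff_cong) (use st in eventually_elim, simp)
  finally show ?case by simp
next
  case (Rel p ts)
  have "\<forall>\<^sub>F k in W. \<forall>t\<in>set ts. teval (upow W M) e t k = teval M (\<lambda>v. e v k) t"
  proof (subst eventually_ball_finite_distrib, simp, intro ballI)
    fix t assume "t \<in> set ts"
    then show "\<forall>\<^sub>F k in W. teval (upow W M) e t k = teval M (\<lambda>v. e v k) t"
      by (intro los_tm[OF M]) (use Rel in auto)
  qed
  then have ev: "\<forall>\<^sub>F k in W. map ((\<lambda>a. a k) \<circ> teval (upow W M) e) ts = map (teval M (\<lambda>v. e v k)) ts"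
    by eventually_elim auto
  have "sat (upow W M) e (Rel p ts) \<longleftrightarrow> (\<forall>\<^sub>F k in W. pint M p (map ((\<lambda>a. a k) \<circ> teval (upow W M) e) ts))"
    by (simp add: upow_def)
  also have "\<dots> \<longleftrightarrow> (\<forall>\<^sub>F k in W. sat M (\<lambda>v. e v k) (Rel p ts))"
    by (rule eventually_iff_cong) (use ev in eventually_elim, simp only: sat.simps)
  finally show ?case .
next
  case (Imp \<phi> \<psi>)
  then show ?case by (simp add: ultra_imp[OF W])
next
  case (All v \<phi>)
  have IH: "sat (upow W M) (e(v := a)) \<phi> \<longleftrightarrow> (\<forall>\<^sub>F k in W. sat M (\<lambda>u. (e(v := a)) u k) \<phi>)"
    if "a \<in> univ (upow W M)" for a
    using All that by (intro All.IH) auto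
  have ee: "(\<lambda>u. (e(v := a)) u k) = (\<lambda>u. e u k)(v := a k)" for a k by auto
  show ?case
  proof
    assume L: "sat (upow W M) e (All v \<phi>)"
    show "\<forall>\<^sub>F k in W. sat M (\<lambda>u. e u k) (All v \<phi>)"
    proof (rule ccontr)
      assume "\<not> ?thesis"
      then have ev: "\<forall>\<^sub>F k in W. \<exists>b\<in>univ M. \<not> sat M ((\<lambda>u. e u k)(v := b)) \<phi>"
        unfolding ultra_not[OF W, symmetric] by simp
      obtain u0 where u0: "u0 \<in> univ M" using M by (auto simp: is_struct_def)
      define \<xi> where "\<xi> k = (if \<exists>b\<in>univ M. \<not> sat M ((\<lambda>u. e u k)(v := b)) \<phi>
         then SOME b. b \<in> univ M \<and> \<not> sat M ((\<lambda>u. e u k)(v := b)) \<phi> else u0)" for k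
      have \<xi>: "\<xi> k \<in> univ M \<and> ((\<exists>b\<in>univ M. \<not> sat M ((\<lambda>u. e u k)(v := b)) \<phi>) \<longrightarrow> \<not> sat M ((\<lambda>u. e u k)(v := \<xi> k)) \<phi>)" for k
      proof (cases "\<exists>b\<in>univ M. \<not> sat M ((\<lambda>u. e u k)(v := b)) \<phi>")
        case True
        then have "\<exists>b. b \<in> univ M \<and> \<not> sat M ((\<lambda>u. e u k)(v := b)) \<phi>" by blast
        from someI_ex[OF this] show ?thesis using True by (simp add: \<xi>_def)
      next
        case False
        then show ?thesis using u0 by (simp add: \<xi>_def)
      qed
      then have r: "range \<xi> \<subseteq> univ M" by auto
      let ?a = "repr (univ M) W \<xi>"
      have "\<forall>\<^sub>F k in W. \<not> sat M ((\<lambda>u. e u k)(v := ?a k)) \<phi>"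
        using ev repr(2)[OF r, of W] by eventually_elim (use \<xi> in auto)
      moreover have "sat (upow W M) (e(v := ?a)) \<phi>" using L repr_in_upow[OF r] by auto
      ultimately show False
        using IH[OF repr_in_upow[OF r], unfolded ee] ultra_not[OF W] by blast
    qed
  next
    assume R: "\<forall>\<^sub>F k in W. sat M (\<lambda>u. e u k) (All v \<phi>)"
    show "sat (upow W M) e (All v \<phi>)"
      unfolding sat.simps
    proof
      fix a assume a: "a \<in> univ (upow W M)"
      show "sat (upow W M) (e(v := a)) \<phi>"
        unfolding IH[OF a] ee using R by eventually_elim (use univ_upow_range[OF a] in simp)
    qed
  qed
qed

text \<open>At place \<open>k\<close> the diagonal sequence satisfies the longest initial segment of the first \<open>k\<close>
  conditions that some element of \<open>M\<close> satisfies. A nonprincipal ultrafilter contains the sets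
  \<open>{j..}\<close>, so for almost all \<open>k\<close> this segment contains any given condition. The conditions may
  vary with \<open>k\<close>, which makes the theorem applicable to parameters from the ultrapower.\<close>

theorem upow_saturated:
  fixes P :: "nat \<Rightarrow> nat \<Rightarrow> 'a \<Rightarrow> bool"
  assumes W: "ultra W" "W \<le> sequentially"
    and fs: "\<And>j. \<exists>d\<in>univ (upow W M). \<forall>i\<le>j. \<forall>\<^sub>F k in W. P i k (d k)"
  shows "\<exists>d\<in>univ (upow W M). \<forall>i. \<forall>\<^sub>F k in W. P i k (d k)"
proof -
  define ok where "ok k j \<longleftrightarrow> j \<le> k \<and> (\<exists>b\<in>univ M. \<forall>i<j. P i k b)" for k j
  define J where "J k = (GREATEST j. ok k j)" for k
  obtain u0 where u0: "u0 \<in> univ M" using fs[of 0] univ_upow_range by blast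
  have J: "ok k (J k) \<and> (\<forall>j. ok k j \<longrightarrow> j \<le> J k)" for k
    unfolding J_def using GreatestI_nat[of "ok k" 0 k] Greatest_le_nat[of "ok k" _ k] u0
    by (auto simp: ok_def)
  define \<xi> where "\<xi> k = (SOME b. b \<in> univ M \<and> (\<forall>i<J k. P i k b))" for k
  have \<xi>: "\<xi> k \<in> univ M \<and> (\<forall>i<J k. P i k (\<xi> k))" for k
    unfolding \<xi>_def by (rule someI_ex) (use J[of k, THEN conjunct1] in \<open>unfold ok_def, blast\<close>)
  then have r: "range \<xi> \<subseteq> univ M" by auto
  have "\<forall>\<^sub>F k in W. P i k (repr (univ M) W \<xi> k)" for i
  proof -
    obtain d where d: "d \<in> univ (upow W M)" "\<And>i'. i' \<le> i \<Longrightarrow> \<forall>\<^sub>F k in W. P i' k (d k)"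
      using fs[of i] by blast
    have "\<forall>\<^sub>F k in W. \<forall>i'\<in>{..i}. P i' k (d k)"
      using d(2) by (subst eventually_ball_finite_distrib) auto
    moreover have "\<forall>\<^sub>F k in W. Suc i \<le> k"
      by (rule filter_leD[OF W(2)]) (rule eventually_ge_at_top)
    ultimately show ?thesis using repr(2)[OF r, of W]
    proof eventually_elim
      case (elim k)
      then have "ok k (Suc i)" using univ_upow_range[OF d(1), of k] unfolding ok_def less_Suc_eq_le by blast
      then have "Suc i \<le> J k" using J[of k] by blast
      then have "i < J k" by simp
      then show ?case using \<xi>[of k] elim by auto
    qed
  qed
  then show ?thesis using repr_in_upow[OF r] by blast
qed

section \<open>The algebraic content of the axioms\<close>

text \<open>The additive group of a structure, in multiplicative notation: \<open>x [^] n\<close> is the multiple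
  \<open>n x\<close>, and \<open>\<one>\<close> is zero.\<close>

definition grp :: "(fsym, psym, 'b) struct \<Rightarrow> 'b monoid" where
  "grp N = \<lparr>carrier = univ N, mult = (\<lambda>x y. fint N Plus [x, y]), one = fint N Zero []\<rparr>"

lemma grp_simps [simp]: "carrier (grp N) = univ N" "mult (grp N) x y = fint N Plus [x, y]"
  "one (grp N) = fint N Zero []"
  by (auto simp: grp_def)

definition sh :: "(fsym, psym, 'b) struct \<Rightarrow> int \<Rightarrow> 'b \<Rightarrow> 'b" where
  "sh N i x = (if i \<ge> 0 then ((\<lambda>x. fint N Succ [x]) ^^ nat i) x else ((\<lambda>x. fint N SuccInv [x]) ^^ nat (- i)) x)"

definition Rel_R :: "(fsym, psym, 'b) struct \<Rightarrow> 'b set" where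
  "Rel_R N = {x \<in> univ N. pint N InR [x]}"

lemma teval_Spow: "teval N e (Spow_tm i t) = sh N i (teval N e t)"
proof -
  have "teval N e ((S_tm ^^ n) t) = ((\<lambda>x. fint N Succ [x]) ^^ n) (teval N e t)" for n
    by (induction n) auto
  moreover have "teval N e ((Sinv_tm ^^ n) t) = ((\<lambda>x. fint N SuccInv [x]) ^^ n) (teval N e t)" for n
    by (induction n) auto
  ultimately show ?thesis by (auto simp: Spow_tm_def sh_def)
qed

lemma Z_sum_tm: "teval (Z_str r) e (sum_tm ts) = sum_list (map (teval (Z_str r) e) ts)"
  by (induction ts) (auto simp: sum_tm_def Z_str_def)

lemma Z_mult_tm: "teval (Z_str r) e (mult_tm n t) = n * teval (Z_str r) e t"
proof -
  have "fint (Z_str r) Minus [x] = - x" for x by (simp add: Z_str_def)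
  then show ?thesis by (auto simp: mult_tm_def Z_sum_tm sum_list_replicate)
qed

lemma wf_sum_tm: "(\<And>t. t \<in> set ts \<Longrightarrow> wf_tm L t) \<Longrightarrow> far L Plus = Some 2 \<Longrightarrow> far L Zero = Some 0 \<Longrightarrow> wf_tm L (sum_tm ts)"
  by (induction ts) (auto simp: sum_tm_def)

lemma wf_mult_tm: "wf_tm L t \<Longrightarrow> far L Plus = Some 2 \<Longrightarrow> far L Zero = Some 0 \<Longrightarrow> far L Minus = Some 1 \<Longrightarrow>
  wf_tm L (mult_tm n t)"
  by (auto simp: mult_tm_def intro!: wf_sum_tm)

lemma tvars_sum_tm [simp]: "tvars (sum_tm ts) = (\<Union>t\<in>set ts. tvars t)"
  by (induction ts) (auto simp: sum_tm_def)

lemma tvars_mult_tm: "tvars (mult_tm n t) \<subseteq> tvars t"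
  by (auto simp: mult_tm_def)

lemma sat_conjs: "sat N e (conjs \<phi>s) \<longleftrightarrow> (\<forall>\<phi>\<in>set \<phi>s. sat N e \<phi>)"
  by (induction \<phi>s) (auto simp: conjs_def)

lemma sat_disjs: "sat N e (disjs \<phi>s) \<longleftrightarrow> (\<exists>\<phi>\<in>set \<phi>s. sat N e \<phi>)"
  by (induction \<phi>s) (auto simp: disjs_def)

lemma wf_disjs: "wf_fm L (disjs \<phi>s) \<longleftrightarrow> (\<forall>\<phi>\<in>set \<phi>s. wf_fm L \<phi>)"
  by (induction \<phi>s) (auto simp: disjs_def)

lemma fv_disjs: "fv (disjs \<phi>s) = (\<Union>\<phi>\<in>set \<phi>s. fv \<phi>)"
  by (induction \<phi>s) (auto simp: disjs_def)

text \<open>The quantifier \<open>F\<close> will be \<open>All\<close> or its relativization to \<open>R\<close>; blocks of both kinds occur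
  in the axioms.\<close>

lemma sat_block:
  assumes F: "\<And>v e \<psi>. sat N e (F v \<psi>) \<longleftrightarrow> (\<forall>x\<in>X. sat N (e(v := x)) \<psi>)"
  shows "sat N e (foldr F [a..<a + s] \<phi>) \<longleftrightarrow> (\<forall>zs. length zs = s \<longrightarrow> set zs \<subseteq> X \<longrightarrow>
     sat N (\<lambda>v. if a \<le> v \<and> v < a + s then zs ! (v - a) else e v) \<phi>)"
proof (induction s arbitrary: a e)
  case 0
  show ?case by (auto intro!: sat_cong)
next
  case (Suc s)
  have eq: "(\<lambda>v. if Suc a \<le> v \<and> v < Suc a + s then zs ! (v - Suc a) else (e(a := x)) v)
    = (\<lambda>v. if a \<le> v \<and> v < a + Suc s then (x # zs) ! (v - a) else e v)" for x zs
    by (auto simp: fun_eq_iff nth_Cons' intro: arg_cong[of _ _ "(!) zs"])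
  have "[a..<a + Suc s] = a # [Suc a..<Suc a + s]" by (simp add: upt_conv_Cons)
  then have "sat N e (foldr F [a..<a + Suc s] \<phi>) \<longleftrightarrow>
    (\<forall>x\<in>X. \<forall>zs. length zs = s \<longrightarrow> set zs \<subseteq> X \<longrightarrow>
       sat N (\<lambda>v. if a \<le> v \<and> v < a + Suc s then (x # zs) ! (v - a) else e v) \<phi>)"
    using Suc[of _ "Suc a"] by (simp only: foldr.simps comp_apply F eq)
  also have "\<dots> \<longleftrightarrow> (\<forall>zs. length zs = Suc s \<longrightarrow> set zs \<subseteq> X \<longrightarrow>
     sat N (\<lambda>v. if a \<le> v \<and> v < a + Suc s then zs ! (v - a) else e v) \<phi>)" (is "?L = ?R")
  proof
    assume ?L then show ?R by (force simp: length_Suc_conv)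
  next
    assume R: ?R
    show ?L
    proof (intro ballI allI impI)
      fix x zs assume "x \<in> X" "length zs = s" "set zs \<subseteq> X"
      then show "sat N (\<lambda>v. if a \<le> v \<and> v < a + Suc s then (x # zs) ! (v - a) else e v) \<phi>"
        using R[rule_format, of "x # zs"] by simp
    qed
  qed
  finally show ?case .
qed

lemma sat_AllR: "sat N e (AllR v \<psi>) \<longleftrightarrow> (\<forall>x\<in>Rel_R N. sat N (e(v := x)) \<psi>)"
  by (auto simp: Rel_R_def)

lemmas sat_All_block = sat_block[where F = All, OF sat.simps(5)]
lemmas sat_AllR_block = sat_block[where F = AllR, OF sat_AllR]

text \<open>Everything that the proof uses of the axioms, stated inside a single structure: a torsion
  free abelian group in which 1 generates all residues modulo every \<open>n\<close>, a successor function on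
  \<open>R\<close> with the initial element \<open>c\<close>, the definition of the predicates \<open>Im\<close>, and the property of
  signed sums over \<open>R\<close> in \<open>nondegenerate\<close>. The latter is the axiom on nondegenerate solutions
  for the constant polynomials 1 and -1; it suffices since every term \<open>f\<^sub>Q(x)\<close> with \<open>x\<close> in \<open>R\<close>
  is itself a signed sum of elements of \<open>R\<close>.\<close>

locale R_model = comm_group G for G :: "'b monoid" (structure) +
  fixes N :: "(fsym, psym, 'b) struct"
  assumes G_eq: "G = grp N"
    and struct: "is_struct LR N"
    and minus: "x \<in> carrier G \<Longrightarrow> fint N Minus [x] = inv x"
    and torsion_free: "x \<in> carrier G \<Longrightarrow> n > 0 \<Longrightarrow> x [^] (n::nat) = \<one> \<Longrightarrow> x = \<one>"
    and Dvs: "x \<in> carrier G \<Longrightarrow> n > 1 \<Longrightarrow> pint N (Dvs n) [x] \<longleftrightarrow> (\<exists>y\<in>carrier G. y [^] n = x)"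
    and residue: "x \<in> carrier G \<Longrightarrow> n > 0 \<Longrightarrow> \<exists>k::nat. \<exists>y\<in>carrier G. y [^] (n::nat) = x \<otimes> fint N One [] [^] k"
    and cst_R: "fint N Cst [] \<in> Rel_R N"
    and S_R: "x \<in> Rel_R N \<Longrightarrow> fint N Succ [x] \<in> Rel_R N"
    and S'_R: "x \<in> Rel_R N \<Longrightarrow> fint N SuccInv [x] \<in> Rel_R N"
    and SS': "x \<in> Rel_R N \<Longrightarrow> x \<noteq> fint N Cst [] \<Longrightarrow> fint N Succ [fint N SuccInv [x]] = x"
    and S'S: "x \<in> Rel_R N \<Longrightarrow> fint N SuccInv [fint N Succ [x]] = x"
    and S_cst: "x \<in> Rel_R N \<Longrightarrow> fint N Succ [x] \<noteq> fint N Cst []"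
    and S'_cst: "fint N SuccInv [fint N Cst []] = fint N Cst []"
    and S_off: "x \<in> carrier G \<Longrightarrow> x \<notin> Rel_R N \<Longrightarrow> fint N Succ [x] = x"
    and S'_off: "x \<in> carrier G \<Longrightarrow> x \<notin> Rel_R N \<Longrightarrow> fint N SuccInv [x] = x"
    and Im_iff: "valid_Im Q D \<Longrightarrow> length ys = dim_row Q \<Longrightarrow> set ys \<subseteq> carrier G \<Longrightarrow>
        range e \<subseteq> carrier G \<Longrightarrow> (\<And>i. i < dim_row Q \<Longrightarrow> e i = ys ! i) \<Longrightarrow>
        pint N (Im Q D) ys \<longleftrightarrow> sat N e (Im_fm Q D)"
    and nondegenerate: "(s::nat) > 0 \<Longrightarrow> g \<in> {..<s} \<rightarrow> Rel_R N \<Longrightarrow>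
        finprod G (\<lambda>i. if sg i then g i else inv (g i)) {..<s} = \<one> \<Longrightarrow>
        (\<And>J. J \<noteq> {} \<Longrightarrow> J \<subset> {..<s} \<Longrightarrow> finprod G (\<lambda>i. if sg i then g i else inv (g i)) J \<noteq> \<one>) \<Longrightarrow>
        \<forall>i<s. \<exists>m. g i = sh N m (g 0)"

text \<open>The axioms behind \<open>R_model\<close>. They hold in ultrapowers again, which is why the group
  theoretic arguments below may be carried out there.\<close>

definition core_axioms :: "(nat \<Rightarrow> nat) \<Rightarrow> (int poly list \<Rightarrow> int list set) \<Rightarrow> rfm set" where
  "core_axioms r E = Ax1 r \<union> Ax2 \<union> Ax4 \<union> Ax6 \<union> Ax8 E"

lemma LR_simps [simp]: "far LR f = Some (fsym_arity f)" "par LR p = psym_arity p"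
  by (auto simp: LR_def)

lemma wf_Spow_tm: "wf_tm LR t \<Longrightarrow> wf_tm LR (Spow_tm i t)"
proof -
  assume t: "wf_tm LR t"
  have "wf_tm LR ((S_tm ^^ n) t)" for n by (induction n) (auto simp: t)
  moreover have "wf_tm LR ((Sinv_tm ^^ n) t)" for n by (induction n) (auto simp: t)
  ultimately show ?thesis by (simp add: Spow_tm_def)
qed

lemma wf_f_tm: "wf_tm LR t \<Longrightarrow> wf_tm LR (f_tm Q t)"
  unfolding f_tm_def by (auto intro!: wf_sum_tm wf_mult_tm wf_Spow_tm)

lemma wf_conjs: "wf_fm L (conjs \<phi>s) \<longleftrightarrow> (\<forall>\<phi>\<in>set \<phi>s. wf_fm L \<phi>)"
  by (induction \<phi>s) (auto simp: conjs_def)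

lemma wf_foldr_AllR: "wf_fm LR (foldr AllR vs \<phi>) \<longleftrightarrow> wf_fm LR \<phi>"
  by (induction vs) auto

lemma wf_foldr_ExR: "wf_fm L (foldr ExR vs \<phi>) \<longleftrightarrow> (vs \<noteq> [] \<longrightarrow> par L InR = Some 1) \<and> wf_fm L \<phi>"
  by (induction vs) auto

lemma wf_foldr_All: "wf_fm L (foldr All vs \<phi>) \<longleftrightarrow> wf_fm L \<phi>"
  by (induction vs) auto

text \<open>The language without the predicates \<open>Im\<close>. As \<open>Im\<close> is defined by formulas of this language,
  relations that preserve all its formulas preserve \<open>Im\<close> as well.\<close>

definition Lb :: "(fsym, psym) lang" where
  "Lb = \<lparr>far = far LR, par = (\<lambda>p. case p of Im _ _ \<Rightarrow> None | _ \<Rightarrow> psym_arity p)\<rparr>"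

lemma Lb_simps [simp]: "far Lb f = Some (fsym_arity f)" "par Lb InR = Some 1"
  "par Lb (Dvs n) = (if n > 1 then Some 1 else None)" "par Lb (Im Q D) = None"
  by (auto simp: Lb_def)

lemma wf_tm_Lb: "wf_tm Lb t \<longleftrightarrow> wf_tm LR t"
  by (induction t) (auto simp: list_all_iff)

lemma wf_Lb: "wf_fm Lb \<phi> \<Longrightarrow> wf_fm LR \<phi>"
proof (induction \<phi>)
  case (Rel p ts)
  then show ?case by (cases p) (auto simp: wf_tm_Lb split: if_splits)
qed (auto simp: wf_tm_Lb)

lemma wf_phi_D:
  assumes "\<forall>(P, l, k)\<in>set D. k < l" "\<And>x. x \<in> set xs \<Longrightarrow> wf_tm LR x"
  shows "wf_fm Lb (phi_D D xs)"
proof -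
  have "wf_fm Lb (D_fm l (plus_tm (f_tm P x) (num_tm (int k))))" if "((P, l, k), x) \<in> set (zip D xs)" for P l k x
  proof -
    have "k < l" "wf_tm LR x" using assms that by (auto dest: set_zip_leftD set_zip_rightD)
    then show ?thesis by (auto simp: D_fm_def num_tm_def wf_tm_Lb intro!: wf_f_tm wf_mult_tm)
  qed
  then show ?thesis by (auto simp: phi_D_def wf_conjs)
qed

lemma wf_phi_Q:
  assumes "\<And>j. j < dim_col Q \<Longrightarrow> wf_tm LR (xs ! j)" "\<And>i. i < dim_row Q \<Longrightarrow> wf_tm LR (ys ! i)"
  shows "wf_fm Lb (phi_Q Q xs ys)"
  using assms by (auto simp: phi_Q_def wf_conjs wf_tm_Lb intro!: wf_sum_tm wf_f_tm)

lemma wf_Im_fm: "valid_Im Q D \<Longrightarrow> wf_fm Lb (Im_fm Q D)"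
  unfolding Im_fm_def Let_def wf_foldr_ExR
  by (auto simp: valid_Im_def valid_conds_def intro!: wf_phi_D wf_phi_Q)

lemma wf_N_nd:
  assumes "\<And>i. i < length Qs \<Longrightarrow> wf_tm LR (xs ! i)" "wf_tm LR y"
  shows "wf_fm LR (N_nd Qs xs y)"
proof -
  have "i < length Qs" if "I \<in> set (subseqs [0..<length Qs])" "i \<in> set I" for I i
  proof -
    have "set I \<in> Pow (set [0..<length Qs])" using that(1) unfolding subseqs_powset[symmetric] by blast
    then show ?thesis using that(2) by auto
  qed
  then show ?thesis unfolding N_nd_def Let_def
    using assms by (auto simp: wf_conjs intro!: wf_sum_tm wf_f_tm)
qed

lemma wf_L0: "wf_fm L0 \<phi> \<Longrightarrow> wf_fm LR \<phi>"
proof -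
  have tm: "wf_tm L0 t \<Longrightarrow> wf_tm LR t" for t
    by (induction t) (auto simp: L0_def list_all_iff split: if_splits)
  show "wf_fm L0 \<phi> \<Longrightarrow> wf_fm LR \<phi>"
    by (induction \<phi>) (auto simp: tm L0_def split: psym.splits)
qed

lemma wf_core_axioms: "\<phi> \<in> core_axioms r E \<Longrightarrow> wf_fm LR \<phi>"
proof -
  have 1: "wf_fm LR \<phi>" if "\<phi> \<in> Ax1 r" using that wf_L0 by (auto simp: Ax1_def)
  have 2: "wf_fm LR \<phi>" if "\<phi> \<in> Ax2" using that by (auto simp: Ax2_def Let_def)
  have 4: "wf_fm LR \<phi>" if "\<phi> \<in> Ax4" using that by (auto simp: Ax4_def Let_def)
  have 6: "wf_fm LR \<phi>" if "\<phi> \<in> Ax6" using that by (auto simp: Ax6_def wf_foldr_All wf_Lb[OF wf_Im_fm])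
  have 8: "wf_fm LR \<phi>" if "\<phi> \<in> Ax8 E"
    using that by (auto simp: Ax8_def wf_foldr_AllR wf_conjs wf_disjs intro!: wf_N_nd wf_Spow_tm)
  show "\<phi> \<in> core_axioms r E \<Longrightarrow> wf_fm LR \<phi>" using 1 2 4 6 8 by (auto simp: core_axioms_def)
qed

context
  fixes r E and N :: "(fsym, psym, 'b) struct"
  assumes model: "is_model LR (core_axioms r E) N" and isE: "is_E r E"
begin

lemma model_struct: "is_struct LR N"
  using model by (simp add: is_model_def)

lemma model_fint: "length as = fsym_arity f \<Longrightarrow> set as \<subseteq> univ N \<Longrightarrow> fint N f as \<in> univ N"
  using model_struct by (auto simp: is_struct_def LR_def)

lemma model_sat: "\<phi> \<in> core_axioms r E \<Longrightarrow> range v \<subseteq> univ N \<Longrightarrow> sat N v \<phi>"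
  using model by (simp add: is_model_def)

text \<open>Every sentence about the group of integers may be transferred to \<open>N\<close>; the algebraic lemmas
  that follow are the instances that matter.\<close>

lemma model_Ax1:
  assumes "wf_fm L0 \<phi>" "fv \<phi> = {}" "\<And>v. sat (Z_str r) v \<phi>" "range v \<subseteq> univ N"
  shows "sat N v \<phi>"
  by (rule model_sat) (use assms in \<open>auto simp: core_axioms_def Ax1_def\<close>)

lemma Z_simps [simp]: "univ (Z_str r) = UNIV" "fint (Z_str r) = Z_fun r" 
  "pint (Z_str r) (Dvs n) [x] = (int n dvd x)"
  by (auto simp: Z_str_def)

lemma L0_simps [simp]: "far L0 Plus = Some 2" "far L0 Zero = Some 0" "far L0 Minus = Some 1" "far L0 One = Some 0"
  "par L0 (Dvs n) = (if n > 1 then Some 1 else None)"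
  by (auto simp: L0_def)

lemma model_comm_group: "comm_group (grp N)"
proof (rule comm_groupI)
  obtain a where "a \<in> univ N" using model_struct by (auto simp: is_struct_def)
  define v where "v = (\<lambda>_::nat. a)"
  have v: "range v \<subseteq> univ N" using \<open>a \<in> univ N\<close> by (auto simp: v_def)
  let ?x = "Var 0 :: rtm" and ?y = "Var 1 :: rtm" and ?z = "Var 2 :: rtm"
  have as: "sat N v (All 0 (All 1 (All 2 (Eq (plus_tm (plus_tm ?x ?y) ?z) (plus_tm ?x (plus_tm ?y ?z))))))"
    by (rule model_Ax1[OF _ _ _ v]) auto
  have cm: "sat N v (All 0 (All 1 (Eq (plus_tm ?x ?y) (plus_tm ?y ?x))))"
    by (rule model_Ax1[OF _ _ _ v]) auto
  have ze: "sat N v (All 0 (Eq (plus_tm zero_tm ?x) ?x))"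
    by (rule model_Ax1[OF _ _ _ v]) auto
  have mi: "sat N v (All 0 (Eq (plus_tm (minus_tm ?x) ?x) zero_tm))"
    by (rule model_Ax1[OF _ _ _ v]) auto
  show "x \<otimes>\<^bsub>grp N\<^esub> y \<in> carrier (grp N)" if "x \<in> carrier (grp N)" "y \<in> carrier (grp N)" for x y
    using that by (auto intro!: model_fint)
  show "\<one>\<^bsub>grp N\<^esub> \<in> carrier (grp N)" by (auto intro!: model_fint)
  show "x \<otimes>\<^bsub>grp N\<^esub> y \<otimes>\<^bsub>grp N\<^esub> z = x \<otimes>\<^bsub>grp N\<^esub> (y \<otimes>\<^bsub>grp N\<^esub> z)"
    if "x \<in> carrier (grp N)" "y \<in> carrier (grp N)" "z \<in> carrier (grp N)" for x y z
    using as that by simp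
  show "x \<otimes>\<^bsub>grp N\<^esub> y = y \<otimes>\<^bsub>grp N\<^esub> x"
    if "x \<in> carrier (grp N)" "y \<in> carrier (grp N)" for x y
    using cm that by simp
  show "\<one>\<^bsub>grp N\<^esub> \<otimes>\<^bsub>grp N\<^esub> x = x" if "x \<in> carrier (grp N)" for x
    using ze that by simp
  show "\<exists>y\<in>carrier (grp N). y \<otimes>\<^bsub>grp N\<^esub> x = \<one>\<^bsub>grp N\<^esub>" if "x \<in> carrier (grp N)" for x
    using mi that by (intro bexI[of _ "fint N Minus [x]"]) (auto intro!: model_fint)
qed

interpretation comm_group "grp N" by (rule model_comm_group)

lemma model_minus: "x \<in> univ N \<Longrightarrow> fint N Minus [x] = inv\<^bsub>grp N\<^esub> x"
proof -
  assume x: "x \<in> univ N"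
  have "sat N (\<lambda>_. x) (All 0 (Eq (plus_tm (minus_tm (Var 0)) (Var 0)) zero_tm))"
    by (rule model_Ax1) (use x in auto)
  moreover have "fint N Minus [x] \<in> univ N" using x by (intro model_fint) auto
  ultimately show ?thesis using x inv_equality[of "fint N Minus [x]" x] by simp
qed

lemma model_sum_replicate:
  "teval N v t \<in> univ N \<Longrightarrow> teval N v (sum_tm (replicate n t)) = teval N v t [^]\<^bsub>grp N\<^esub> n"
proof (induction n)
  case (Suc n)
  then show ?case
    using nat_pow_Suc2[of "teval N v t" n] by (simp add: sum_tm_def)
qed (simp add: sum_tm_def)

lemma model_mult_tm:
  "teval N v t \<in> univ N \<Longrightarrow> teval N v (mult_tm (int n) t) = teval N v t [^]\<^bsub>grp N\<^esub> n"
  by (simp add: mult_tm_def model_sum_replicate)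

lemma model_torsion_free:
  assumes x: "x \<in> univ N" and "n > 0" "x [^]\<^bsub>grp N\<^esub> (n::nat) = \<one>\<^bsub>grp N\<^esub>"
  shows "x = \<one>\<^bsub>grp N\<^esub>"
proof -
  have "sat N (\<lambda>_. x) (All 0 (Imp (Eq (mult_tm (int n) (Var 0)) zero_tm) (Eq (Var 0) zero_tm)))"
    by (rule model_Ax1)
      (use x \<open>n > 0\<close> tvars_mult_tm[of "int n" "Var 0"] in \<open>auto simp: Z_mult_tm intro!: wf_mult_tm\<close>)
  then show ?thesis using assms by (simp add: model_mult_tm)
qed

lemma model_Dvs:
  assumes x: "x \<in> univ N" and "n > 1"
  shows "pint N (Dvs n) [x] \<longleftrightarrow> (\<exists>y\<in>univ N. y [^]\<^bsub>grp N\<^esub> n = x)"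
proof -
  have "sat N (\<lambda>_. x) (All 0 (Iff (Rel (Dvs n) [Var 0]) (Ex 1 (Eq (mult_tm (int n) (Var 1)) (Var 0)))))"
    by (rule model_Ax1)
      (use x \<open>n > 1\<close> tvars_mult_tm[of "int n" "Var 1"] in \<open>auto simp: Z_mult_tm dvd_def intro!: wf_mult_tm\<close>)
  then show ?thesis using assms by (auto simp: model_mult_tm)
qed

text \<open>The sentence that is transferred bounds the residue by \<open>n\<close>, so that it is a finite
  disjunction.\<close>

lemma model_residue:
  assumes x: "x \<in> univ N" and "n > 0"
  shows "\<exists>k::nat. \<exists>y\<in>univ N. y [^]\<^bsub>grp N\<^esub> (n::nat) = x \<otimes>\<^bsub>grp N\<^esub> fint N One [] [^]\<^bsub>grp N\<^esub> k"
proof -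
  let ?\<phi> = "\<lambda>k. Ex 1 (Eq (mult_tm (int n) (Var 1)) (plus_tm (Var 0) (mult_tm (int k) one_tm)))"
  have tv: "tvars (mult_tm m one_tm) = {}" for m using tvars_mult_tm[of m one_tm] by auto
  have "sat N (\<lambda>_. x) (All 0 (disjs (map ?\<phi> [0..<n])))"
  proof (rule model_Ax1)
    show "wf_fm L0 (All 0 (disjs (map ?\<phi> [0..<n])))"
      by (auto simp: wf_disjs intro!: wf_mult_tm)
    show "fv (All 0 (disjs (map ?\<phi> [0..<n]))) = {}"
      using tvars_mult_tm[of "int n" "Var 1"] by (auto simp: fv_disjs tv)
    show "sat (Z_str r) v (All 0 (disjs (map ?\<phi> [0..<n])))" for v
    proof -
      have "\<exists>k<n. \<exists>y. int n * y = z + int k" for z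
      proof (intro exI conjI)
        show "nat ((- z) mod int n) < n" using \<open>n > 0\<close> by (simp add: nat_less_iff)
        show "int n * (- ((- z) div int n)) = z + int (nat ((- z) mod int n))"
        proof -
          have "int n * ((- z) div int n) + (- z) mod int n = - z" by (rule mult_div_mod_eq)
          moreover have "int (nat ((- z) mod int n)) = (- z) mod int n" using \<open>n > 0\<close> by simp
          ultimately show ?thesis unfolding mult_minus_right by linarith
        qed
      qed
      then show ?thesis
        by (simp add: sat_disjs Z_mult_tm Bex_def atLeast0LessThan)
    qed
    show "range (\<lambda>_. x) \<subseteq> univ N" using x by auto
  qed
  moreover have "fint N One [] \<in> univ N" by (rule model_fint) auto
  ultimately have "\<forall>x\<in>univ N. \<exists>k\<in>{0..<n}. \<exists>y\<in>univ N.
      y [^]\<^bsub>grp N\<^esub> (n::nat) = x \<otimes>\<^bsub>grp N\<^esub> fint N One [] [^]\<^bsub>grp N\<^esub> k"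
    by (simp add: sat_disjs model_mult_tm)
  then show ?thesis using x by blast
qed

lemma model_Ax2: "\<phi> \<in> Ax2 \<Longrightarrow> x \<in> univ N \<Longrightarrow> sat N (\<lambda>_. x) \<phi>"
  by (rule model_sat) (auto simp: core_axioms_def)

lemma model_cst: "fint N Cst [] \<in> univ N" by (rule model_fint) auto

text \<open>The term \<open>f\<^sub>Q(x)\<close> is \<open>x\<close> for \<open>Q = 1\<close> and \<open>- x\<close> for \<open>Q = -1\<close>, so a vanishing signed sum
  without vanishing proper subsums is an instance of \<open>N_nd\<close>.\<close>

lemma model_nondegenerate:
  assumes s: "(s::nat) > 0" and g: "g \<in> {..<s} \<rightarrow> Rel_R N"
    and sum0: "finprod (grp N) (\<lambda>i. if sg i then g i else inv\<^bsub>grp N\<^esub> (g i)) {..<s} = \<one>\<^bsub>grp N\<^esub>"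
    and nd: "\<And>J. J \<noteq> {} \<Longrightarrow> J \<subset> {..<s} \<Longrightarrow>
       finprod (grp N) (\<lambda>i. if sg i then g i else inv\<^bsub>grp N\<^esub> (g i)) J \<noteq> \<one>\<^bsub>grp N\<^esub>"
  shows "\<forall>i<s. \<exists>m. g i = sh N m (g 0)"
proof -
  let ?g = "\<lambda>i. if sg i then g i else inv\<^bsub>grp N\<^esub> (g i)"
  have gU: "g i \<in> univ N" if "i < s" for i using g that by (auto simp: Rel_R_def)
  \<comment> \<open>The constant polynomials 1 and -1.\<close>
  define Qs where "Qs = map (\<lambda>i. if sg i then [:1:] else [:- 1 :: int:]) [0..<s]"
  have Qs: "Qs \<noteq> []" "length Qs = s" using s by (auto simp: Qs_def)
  obtain ms where ms: "distinct ms" "set ms = E Qs"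
    using finite_distinct_list isE Qs unfolding is_E_def by metis
  define v where "v i = (if i < s then g i else g 0)" for i
  have v: "range v \<subseteq> univ N" using gU s by (auto simp: v_def)
  let ?\<phi> = "Imp (N_nd Qs (map Var [0..<s]) zero_tm)
     (disjs (map (\<lambda>m. conjs (map (\<lambda>i. Eq (Var i) (Spow_tm (m ! i) (Var 0))) [0..<s])) ms))"
  have "foldr AllR [0..<s] ?\<phi> \<in> Ax8 E"
    unfolding Ax8_def using Qs ms by blast
  then have "sat N v (foldr AllR [0..<0 + s] ?\<phi>)" using v by (intro model_sat) (auto simp: core_axioms_def)
  from this[unfolded sat_AllR_block, rule_format, of "map g [0..<s]"]
  have "sat N (\<lambda>i. if 0 \<le> i \<and> i < 0 + s then map g [0..<s] ! (i - 0) else v i) ?\<phi>"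
    using g by (simp add: image_subset_iff Pi_iff)
  also have "(\<lambda>i. if 0 \<le> i \<and> i < 0 + s then map g [0..<s] ! (i - 0) else v i) = v"
    by (auto simp: v_def)
  finally have sat: "sat N v ?\<phi>" .
  have ev: "teval N v (f_tm (Qs ! i) (Var i)) = ?g i" if "i < s" for i
  proof -
    have z: "fint N Plus [x, fint N Zero []] = x" if "x \<in> univ N" for x using r_one[of x] that by simp
    have "inv\<^bsub>grp N\<^esub> (g i) \<in> univ N" using inv_closed[of "g i"] gU[OF that] by simp
    then show ?thesis using that gU[OF that] z
      by (cases "sg i") (simp_all add: Qs_def f_tm_def mult_tm_def Spow_tm_def sum_tm_def v_def model_minus)
  qed
  have sum: "teval N v (sum_tm (map (\<lambda>i. f_tm (Qs ! i) (map Var [0..<s] ! i)) I)) = finprod (grp N) ?g (set I)"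
    if "distinct I" "set I \<subseteq> {..<s}" for I
    using that
  proof (induction I)
    case (Cons i I)
    have gc: "?g j \<in> carrier (grp N)" if "j < s" for j
      using gU[OF that] inv_closed[of "g j"] by simp
    have "finprod (grp N) ?g (insert i (set I)) = ?g i \<otimes>\<^bsub>grp N\<^esub> finprod (grp N) ?g (set I)"
      using Cons.prems gc by (intro finprod_insert) auto
    then show ?case using Cons ev[of i] by (simp add: sum_tm_def del: finprod_insert)
  qed (simp add: sum_tm_def)
  let ?\<Sigma> = "\<lambda>I. teval N v (sum_tm (map (\<lambda>i. f_tm (Qs ! i) (map Var [0..<s] ! i)) I))"
  have "set [0..<s] = {..<s}" by auto
  then have c1: "?\<Sigma> [0..<s] = fint N Zero []" using sum[of "[0..<s]"] sum0 by simp
  have c2: "?\<Sigma> I \<noteq> fint N Zero []" if I: "I \<in> set (subseqs [0..<s])" "I \<noteq> []" "I \<noteq> [0..<s]" for I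
  proof -
    have "set I \<in> Pow (set [0..<s])" using I(1) unfolding subseqs_powset[symmetric] by blast
    then have d: "distinct I" "set I \<subseteq> {..<s}"
      using I subseqs_distinctD[of I "[0..<s]"] by auto
    have "inj_on set (set (subseqs [0..<s]))"
      using distinct_set_subseqs[of "[0..<s]"] by (simp add: distinct_map)
    then have "set I \<noteq> {..<s}"
      using I subseqs_refl[of "[0..<s]"] \<open>set [0..<s] = {..<s}\<close> unfolding inj_on_def by metis
    then show ?thesis using sum[OF d] nd[of "set I"] d I(2) by (simp add: psubset_eq)
  qed
  have "sat N v (N_nd Qs (map Var [0..<s]) zero_tm)"
    unfolding N_nd_def Let_def Qs(2) using c1 c2 by (simp add: sat_conjs del: map_map)
  then have "sat N v (disjs (map (\<lambda>m. conjs (map (\<lambda>i. Eq (Var i) (Spow_tm (m ! i) (Var 0))) [0..<s])) ms))"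
    using sat by (simp only: sat.simps)
  then obtain m where "sat N v (conjs (map (\<lambda>i. Eq (Var i) (Spow_tm (m ! i) (Var 0))) [0..<s]))"
    unfolding sat_disjs set_map by blast
  then have eq: "sat N v (Eq (Var i) (Spow_tm (m ! i) (Var 0)))" if "i < s" for i
    unfolding sat_conjs set_map using that by auto
  have "g i = sh N (m ! i) (g 0)" if "i < s" for i
  proof -
    have "v i = g i" "v 0 = g 0" using s that by (simp_all add: v_def)
    then show ?thesis using eq[OF that]
      unfolding sat.simps teval_Spow teval.simps by argo
  qed
  then show ?thesis by blast
qed

theorem model_R_model: "R_model (grp N) N"
proof (unfold_locales, goal_cases)
  case 1 show ?case by simp
next
  case 2 show ?case by (rule model_struct)
next
  case (3 x) then show ?case by (simp add: model_minus)
next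
  case (4 x n) then show ?case using model_torsion_free by simp
next
  case (5 x n) then show ?case using model_Dvs by simp
next
  case (6 x n) then show ?case using model_residue by simp
next
  case 7
  show ?case using model_Ax2[of "InR_fm c_tm", OF _ model_cst] model_cst by (auto simp: Ax2_def Let_def Rel_R_def)
next
  case (8 x)
  then show ?case using model_Ax2[of "AllR 0 (InR_fm (S_tm (Var 0)))", OF _ model_cst] model_fint[of "[x]" Succ]
    by (auto simp: Ax2_def Let_def Rel_R_def)
next
  case (9 x)
  then show ?case using model_Ax2[of "AllR 0 (InR_fm (Sinv_tm (Var 0)))", OF _ model_cst] model_fint[of "[x]" SuccInv]
    by (auto simp: Ax2_def Let_def Rel_R_def)
next
  case (10 x)
  then show ?case using model_Ax2[of "AllR 0 (Imp (Neg (Eq (Var 0) c_tm)) (Eq (S_tm (Sinv_tm (Var 0))) (Var 0)))", OF _ model_cst]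
    by (auto simp: Ax2_def Let_def Rel_R_def)
next
  case (11 x)
  then show ?case using model_Ax2[of "AllR 0 (Eq (Sinv_tm (S_tm (Var 0))) (Var 0))", OF _ model_cst]
    by (auto simp: Ax2_def Let_def Rel_R_def)
next
  case (12 x)
  then show ?case using model_Ax2[of "AllR 0 (Neg (Eq (S_tm (Var 0)) c_tm))", OF _ model_cst]
    by (auto simp: Ax2_def Let_def Rel_R_def)
next
  case 13
  show ?case using model_Ax2[of "Eq (Sinv_tm c_tm) c_tm", OF _ model_cst] by (auto simp: Ax2_def Let_def)
next
  case (14 x)
  have "sat N (\<lambda>_. x) (All 0 (Imp (Neg (InR_fm (Var 0))) (And (Eq (S_tm (Var 0)) (Var 0)) (Eq (Var 0) (Sinv_tm (Var 0))))))"
    by (rule model_sat) (use 14 in \<open>auto simp: core_axioms_def Ax4_def Let_def\<close>)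
  then show ?case using 14 by (auto simp: Rel_R_def)
next
  case (15 x)
  have "sat N (\<lambda>_. x) (All 0 (Imp (Neg (InR_fm (Var 0))) (And (Eq (S_tm (Var 0)) (Var 0)) (Eq (Var 0) (Sinv_tm (Var 0))))))"
    by (rule model_sat) (use 15 in \<open>auto simp: core_axioms_def Ax4_def Let_def\<close>)
  then show ?case using 15 by (auto simp: Rel_R_def)
next
  case (16 Q D ys v)
  let ?n = "dim_row Q"
  have "foldr All [0..<0 + ?n] (Iff (Rel (Im Q D) (map Var [0..<?n])) (Im_fm Q D)) \<in> core_axioms r E"
    using 16(1) by (auto simp: core_axioms_def Ax6_def)
  then have "sat N v (foldr All [0..<0 + ?n] (Iff (Rel (Im Q D) (map Var [0..<?n])) (Im_fm Q D)))"
    using 16(4) by (intro model_sat) auto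
  from this[unfolded sat_All_block, rule_format, of ys]
  have "sat N (\<lambda>i. if 0 \<le> i \<and> i < 0 + ?n then ys ! (i - 0) else v i)
      (Iff (Rel (Im Q D) (map Var [0..<?n])) (Im_fm Q D))"
    using 16(2,3) by (simp only: grp_simps simp_thms)
  also have "(\<lambda>i. if 0 \<le> i \<and> i < 0 + ?n then ys ! (i - 0) else v i) = v"
    using 16(5) by auto
  finally have "pint N (Im Q D) (map (teval N v) (map Var [0..<?n])) \<longleftrightarrow> sat N v (Im_fm Q D)"
    by (simp only: sat.simps) blast
  then have "pint N (Im Q D) (map v [0..<?n]) \<longleftrightarrow> sat N v (Im_fm Q D)"
    by (simp add: comp_def)
  moreover have "map v [0..<?n] = ys" using 16 by (intro nth_equalityI) auto
  ultimately show ?case by simp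
next
  case (17 s g sg) then show ?case using model_nondegenerate[of s g sg] by blast
qed

end

section \<open>Independence of orbits\<close>

type_synonym word = "bool list"
type_synonym lin = "(bool \<times> word \<times> nat) list"

text \<open>Since \<open>S\<^sup>-\<^sup>1(c) = c\<close>, iterates of \<open>S\<close> and \<open>S\<^sup>-\<^sup>1\<close> do not cancel in general. Words in the
  two functions are closed under composition, which integer exponents are not.\<close>

definition shw :: "(fsym, psym, 'b) struct \<Rightarrow> word \<Rightarrow> 'b \<Rightarrow> 'b" where
  "shw N w x = foldr (\<lambda>b y. if b then fint N Succ [y] else fint N SuccInv [y]) w x"

lemma shw_simps [simp]: "shw N [] x = x" 
  "shw N (b # w) x = (if b then fint N Succ [shw N w x] else fint N SuccInv [shw N w x])"
  by (auto simp: shw_def)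

lemma shw_append: "shw N (v @ w) x = shw N v (shw N w x)"
  by (simp add: shw_def)

context R_model
begin

abbreviation "R \<equiv> Rel_R N"
abbreviation "u \<equiv> fint N One []"
abbreviation "c0 \<equiv> fint N Cst []"
abbreviation "S x \<equiv> fint N Succ [x]"
abbreviation "S' x \<equiv> fint N SuccInv [x]"

lemma carrier_eq: "carrier G = univ N"
  by (simp add: G_eq)

lemma Plus_eq: "fint N Plus [x, y] = x \<otimes> y"
  by (simp add: G_eq)

lemma Zero_eq: "fint N Zero [] = \<one>"
  by (simp add: G_eq)

lemma fint_closed: "length as = fsym_arity f \<Longrightarrow> set as \<subseteq> carrier G \<Longrightarrow> fint N f as \<in> carrier G"
  using struct by (auto simp: is_struct_def LR_def carrier_eq)

lemma u_closed [simp, intro]: "u \<in> carrier G" and c0_closed [simp, intro]: "c0 \<in> carrier G"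
  by (auto intro!: fint_closed)

lemma S_closed [simp, intro]: "x \<in> carrier G \<Longrightarrow> S x \<in> carrier G"
  and S'_closed [simp, intro]: "x \<in> carrier G \<Longrightarrow> S' x \<in> carrier G"
  by (auto intro!: fint_closed)

lemma R_carrier: "R \<subseteq> carrier G"
  by (auto simp: Rel_R_def carrier_eq)

lemma R_closed [intro]: "x \<in> R \<Longrightarrow> x \<in> carrier G"
  using R_carrier by auto

lemma shw_closed [simp, intro]: "x \<in> carrier G \<Longrightarrow> shw N w x \<in> carrier G"
  by (induction w) auto

lemma shw_R: "x \<in> R \<Longrightarrow> shw N w x \<in> R"
  by (induction w) (auto simp: S_R S'_R)

lemma shw_off: "x \<in> carrier G \<Longrightarrow> x \<notin> R \<Longrightarrow> shw N w x = x"
  by (induction w) (auto simp: S_off S'_off)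

text \<open>\<open>eqv\<close> is the relation of lying in one orbit, phrased with \<open>S\<close> only: two elements of \<open>R\<close>
  lie in one orbit if some iterates of \<open>S\<close> at them agree.\<close>

definition eqv :: "'b \<Rightarrow> 'b \<Rightarrow> bool" where
  "eqv x y \<longleftrightarrow> (\<exists>i j. shw N (replicate i True) x = shw N (replicate j True) y)"

lemma eqv_refl: "eqv x x"
  by (auto simp: eqv_def)

lemma eqv_sym: "eqv x y \<Longrightarrow> eqv y x"
  unfolding eqv_def by metis

lemma eqv_trans:
  assumes "eqv x y" "eqv y z" shows "eqv x z"
proof -
  obtain i j k l where 1: "shw N (replicate i True) x = shw N (replicate j True) y"
    and 2: "shw N (replicate k True) y = shw N (replicate l True) z"
    using assms unfolding eqv_def by blast
  have "shw N (replicate (k + i) True) x = shw N (replicate (j + k) True) y"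
    using 1 by (simp add: replicate_add shw_append add.commute[of j k])
  also have "\<dots> = shw N (replicate (j + l) True) z"
    using 2 by (simp add: replicate_add shw_append)
  finally show ?thesis unfolding eqv_def by blast
qed

lemma eqv_S: "eqv x (S x)"
  unfolding eqv_def by (rule exI[of _ 1], rule exI[of _ 0]) simp

lemma eqv_S': "x \<in> R \<Longrightarrow> eqv x (S' x)"
proof (cases "x = c0")
  case True
  then show ?thesis using S'_cst eqv_refl by simp
next
  case False
  assume "x \<in> R"
  then have "S (S' x) = x" using False SS' by simp
  then show ?thesis unfolding eqv_def by (intro exI[of _ 0] exI[of _ 1]) simp
qed

lemma eqv_shw: "x \<in> R \<Longrightarrow> eqv x (shw N w x)"
proof (induction w)
  case (Cons b w)
  then show ?case using eqv_trans[OF Cons.IH] eqv_S eqv_S' shw_R by simp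
qed (simp add: eqv_refl)

lemma eqv_imp_shw:
  assumes "eqv x y" "y \<in> R"
  shows "\<exists>w. y = shw N w x"
proof -
  have inv: "shw N (replicate j False) (shw N (replicate j True) y) = y" for j
  proof (induction j)
    case (Suc j)
    have "shw N (replicate (Suc j) False) (shw N (replicate (Suc j) True) y)
      = shw N (replicate j False) (S' (S (shw N (replicate j True) y)))"
      using shw_append[of N "replicate j False" "[False]"] by (simp add: replicate_append_same)
    then show ?case using Suc S'S[OF shw_R[OF assms(2)]] by simp
  qed simp
  obtain i j where "shw N (replicate i True) x = shw N (replicate j True) y"
    using assms(1) unfolding eqv_def by blast
  then have "y = shw N (replicate j False @ replicate i True) x"
    using inv[of j] by (simp add: shw_append)
  then show ?thesis by blast
qed

lemma sh_eq_shw: "sh N i x = shw N (if i \<ge> 0 then replicate (nat i) True else replicate (nat (- i)) False) x"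
proof -
  have "((\<lambda>x. S x) ^^ n) x = shw N (replicate n True) x" for n by (induction n) auto
  moreover have "((\<lambda>x. S' x) ^^ n) x = shw N (replicate n False) x" for n by (induction n) auto
  ultimately show ?thesis by (auto simp: sh_def)
qed

definition orbit_closed :: "'b set \<Rightarrow> bool" where
  "orbit_closed Y \<longleftrightarrow> Y \<subseteq> R \<and> (\<forall>x\<in>Y. \<forall>y\<in>R. eqv x y \<longrightarrow> y \<in> Y)"

definition orb :: "'b \<Rightarrow> 'b set" where "orb x = {y \<in> R. eqv x y}"

lemma orbit_closed_orb: "orbit_closed (orb x)"
  unfolding orbit_closed_def orb_def using eqv_trans by blast

lemma orb_self: "x \<in> R \<Longrightarrow> x \<in> orb x"
  by (simp add: orb_def eqv_refl)

abbreviation sg :: "bool \<Rightarrow> 'b \<Rightarrow> 'b" where "sg b x \<equiv> if b then x else inv x"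

text \<open>Induction on the index set: a vanishing signed sum either splits into two shorter ones, or
  it is nondegenerate, and then all its elements lie in a single orbit. Hence the part of a
  vanishing sum that lies in a union of orbits vanishes.\<close>

lemma finprod_orbit_part:
  assumes "finite I" "g \<in> I \<rightarrow> R" "orbit_closed Y"
    and "finprod G (\<lambda>i. sg (b i) (g i)) (I :: nat set) = \<one>"
  shows "finprod G (\<lambda>i. sg (b i) (g i)) {i\<in>I. g i \<in> Y} = \<one>"
  using assms(1,2,4)
proof (induction I rule: finite_psubset_induct)
  case (psubset I)
  let ?f = "\<lambda>i. sg (b i) (g i)"
  have fI: "?f \<in> I \<rightarrow> carrier G" using psubset.prems(1) by (auto simp: Pi_iff)
  consider "I = {}" | J where "J \<noteq> {}" "J \<subset> I" "finprod G ?f J = \<one>"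
    | "I \<noteq> {}" "\<And>J. J \<noteq> {} \<Longrightarrow> J \<subset> I \<Longrightarrow> finprod G ?f J \<noteq> \<one>" by blast
  then show ?case
  proof cases
    case 1
    then show ?thesis by simp
  next
    case (2 J)
    have fin: "finite J" "finite (I - J)" using 2 psubset.hyps finite_subset by auto
    have IJ: "I = J \<union> (I - J)" using 2 by auto
    have "finprod G ?f I = finprod G ?f J \<otimes> finprod G ?f (I - J)"
      using fI 2 fin by (subst IJ, intro finprod_Un_disjoint) auto
    moreover have cl: "finprod G ?f (I - J) \<in> carrier G" using fI by (intro finprod_closed) auto
    ultimately have 0: "finprod G ?f (I - J) = \<one>" using 2 psubset.prems by simp
    have "{i\<in>I. g i \<in> Y} = {i\<in>J. g i \<in> Y} \<union> {i\<in>I - J. g i \<in> Y}" using 2 by auto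
    then have "finprod G ?f {i\<in>I. g i \<in> Y} = finprod G ?f {i\<in>J. g i \<in> Y} \<otimes> finprod G ?f {i\<in>I - J. g i \<in> Y}"
      using fI 2(2) fin by (auto intro!: finprod_Un_disjoint)
    moreover have "finprod G ?f {i\<in>J. g i \<in> Y} = \<one>"
      using 2 psubset.prems by (intro psubset.IH) auto
    moreover have "finprod G ?f {i\<in>I - J. g i \<in> Y} = \<one>"
      using 2 psubset.prems 0 by (intro psubset.IH) auto
    ultimately show ?thesis by simp
  next
    case 3
    obtain h where h: "bij_betw h {..<card I} I"
      using ex_bij_betw_nat_finite[OF psubset.hyps(1)] by (auto simp: atLeast0LessThan)
    then have inj: "inj_on h {..<card I}" and im: "h ` {..<card I} = I" by (auto simp: bij_betw_def)
    have re: "finprod G (\<lambda>i. ?f (h i)) J = finprod G ?f (h ` J)" if "J \<subseteq> {..<card I}" for J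
      using that inj im fI by (intro finprod_reindex[symmetric]) (auto intro: inj_on_subset)
    have "\<forall>i<card I. \<exists>m. (g \<circ> h) i = sh N m ((g \<circ> h) 0)"
    proof (rule nondegenerate[where sg = "b \<circ> h"])
      show "0 < card I" using 3 psubset.hyps by (simp add: card_gt_0_iff)
      have "h i \<in> I" if "i < card I" for i using im that by blast
      then show "g \<circ> h \<in> {..<card I} \<rightarrow> R" using psubset.prems(1) by (auto simp: Pi_iff)
      show "(\<Otimes>i\<in>{..<card I}. sg ((b \<circ> h) i) ((g \<circ> h) i)) = \<one>"
        using re[of "{..<card I}"] psubset.prems(2) unfolding im comp_apply by simp
      fix J assume J: "J \<noteq> {}" "J \<subset> {..<card I}"
      then have "h ` J \<noteq> {}" "h ` J \<subset> I"
        using inj_on_image_eq_iff[OF inj, of J "{..<card I}"] im by auto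
      then show "(\<Otimes>i\<in>J. sg ((b \<circ> h) i) ((g \<circ> h) i)) \<noteq> \<one>"
        using 3(2)[of "h ` J"] re[of J] J(2) unfolding comp_apply by auto
    qed
    then have 00: "eqv (g (h 0)) (g (h i))" if "i < card I" for i
      using that eqv_shw[of "g (h 0)"] psubset.prems(1) im unfolding sh_eq_shw by fastforce
    have eq: "eqv (g i) (g j)" if "i \<in> I" "j \<in> I" for i j
      using that 00 eqv_sym eqv_trans im by (metis imageE lessThan_iff)
    have "{i\<in>I. g i \<in> Y} = I \<or> {i\<in>I. g i \<in> Y} = {}"
      using eq assms(3) psubset.prems(1) unfolding orbit_closed_def by blast
    then show ?thesis by (elim disjE) (simp_all only: psubset.prems(2) finprod_empty)
  qed
qed

fun lc :: "(bool \<times> 'b) list \<Rightarrow> 'b" where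
  "lc [] = \<one>"
| "lc ((b, x) # l) = sg b x \<otimes> lc l"

lemma lc_closed [simp]: "snd ` set l \<subseteq> carrier G \<Longrightarrow> lc l \<in> carrier G"
  by (induction l rule: lc.induct) auto

lemma lc_append: "snd ` set l \<subseteq> carrier G \<Longrightarrow> snd ` set l' \<subseteq> carrier G \<Longrightarrow> lc (l @ l') = lc l \<otimes> lc l'"
  by (induction l rule: lc.induct) (auto simp: m_assoc)

lemma lc_flip: "snd ` set l \<subseteq> carrier G \<Longrightarrow> lc (map (\<lambda>(b, x). (\<not> b, x)) l) = inv (lc l)"
  by (induction l rule: lc.induct) (auto simp: inv_mult)

lemma lc_finprod:
  "snd ` set l \<subseteq> carrier G \<Longrightarrow> lc l = finprod G (\<lambda>i. sg (fst (l ! i)) (snd (l ! i))) {..<length l}"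
proof (induction l rule: rev_induct)
  case (snoc p l)
  have cl: "snd (l ! i) \<in> carrier G" if "i < length l" for i
    using snoc.prems that by (auto simp: image_subset_iff)
  have "finprod G (\<lambda>i. sg (fst ((l @ [p]) ! i)) (snd ((l @ [p]) ! i))) {..<length (l @ [p])}
    = sg (fst p) (snd p) \<otimes> finprod G (\<lambda>i. sg (fst ((l @ [p]) ! i)) (snd ((l @ [p]) ! i))) {..<length l}"
    using snoc.prems cl by (simp add: lessThan_Suc nth_append Pi_iff)
  also have "finprod G (\<lambda>i. sg (fst ((l @ [p]) ! i)) (snd ((l @ [p]) ! i))) {..<length l}
     = finprod G (\<lambda>i. sg (fst (l ! i)) (snd (l ! i))) {..<length l}"
    using cl by (intro finprod_cong') (auto simp: nth_append)
  also have "\<dots> = lc l" using snoc by simp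
  also have "sg (fst p) (snd p) \<otimes> lc l = lc (l @ [p])"
    using snoc.prems by (cases p) (auto simp: lc_append m_comm)
  finally show ?case by simp
qed simp

lemma generate_lc:
  assumes "X \<subseteq> carrier G" 
  shows "x \<in> generate G X \<longleftrightarrow> (\<exists>l. snd ` set l \<subseteq> X \<and> x = lc l)"
proof
  assume "x \<in> generate G X"
  then show "\<exists>l. snd ` set l \<subseteq> X \<and> x = lc l"
  proof induction
    case one
    show ?case by (rule exI[of _ "[]"]) simp
  next
    case (incl h)
    then show ?case using assms by (intro exI[of _ "[(True, h)]"]) auto
  next
    case (inv h)
    then show ?case using assms by (intro exI[of _ "[(False, h)]"]) auto
  next
    case (eng h1 h2)
    then obtain l l' where l: "snd ` set l \<subseteq> X" "h1 = lc l" "snd ` set l' \<subseteq> X" "h2 = lc l'" by blast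
    then show ?case using assms by (intro exI[of _ "l @ l'"]) (auto simp: lc_append image_Un)
  qed
next
  assume "\<exists>l. snd ` set l \<subseteq> X \<and> x = lc l"
  then obtain l where "snd ` set l \<subseteq> X" "x = lc l" by blast
  then show "x \<in> generate G X"
    by (induction l arbitrary: x rule: lc.induct) (auto intro: generate.intros)
qed

text \<open>The subgroups generated by a union of orbits and by elements of \<open>R\<close> outside it intersect
  trivially: the difference of two presentations of \<open>x\<close> is a vanishing signed sum, whose part in
  \<open>X\<close> is the first presentation. All facts about sums of elements of \<open>R\<close> below derive from this
  one.\<close>

theorem orbits_independent:
  assumes X: "orbit_closed X" and Y: "Y \<subseteq> R" "X \<inter> Y = {}" and x: "x \<in> generate G X" "x \<in> generate G Y"
  shows "x = \<one>"
proof -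
  have XR: "X \<subseteq> R" using X by (simp add: orbit_closed_def)
  obtain l1 where l1: "snd ` set l1 \<subseteq> X" "x = lc l1" using x XR R_carrier generate_lc by (metis subset_trans)
  obtain l2 where l2: "snd ` set l2 \<subseteq> Y" "x = lc l2" using x Y R_carrier generate_lc by (metis subset_trans)
  define l where "l = l1 @ map (\<lambda>(b, x). (\<not> b, x)) l2"
  have c12: "snd ` set l1 \<subseteq> carrier G" "snd ` set l2 \<subseteq> carrier G" using l1 l2 XR Y R_carrier by blast+
  have s2: "snd ` set (map (\<lambda>(b, x). (\<not> b, x)) l2) = snd ` set l2" by (force simp: image_iff)
  have lR: "snd ` set l \<subseteq> R" 
    using l1(1) l2(1) XR Y(1) unfolding l_def set_append image_Un s2 by blast
  then have lc: "snd ` set l \<subseteq> carrier G" using R_carrier by auto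
  have "lc l = x \<otimes> inv x" using lc_append[of l1] lc_flip[of l2] c12 l1(2) l2(2) s2 by (simp add: l_def)
  then have l0: "lc l = \<one>" using c12 l1 by simp
  let ?f = "\<lambda>i. sg (fst (l ! i)) (snd (l ! i))"
  have "finprod G ?f {i\<in>{..<length l}. snd (l ! i) \<in> X} = \<one>"
    using l0 lc_finprod[OF lc] lR X by (intro finprod_orbit_part) auto
  moreover have "{i\<in>{..<length l}. snd (l ! i) \<in> X} = {..<length l1}"
  proof -
    have "snd (l ! i) \<in> X" if "i < length l1" for i
      using that l1 by (auto simp: l_def nth_append image_subset_iff)
    moreover have "snd (l ! i) \<notin> X" if "length l1 \<le> i" "i < length l" for i
    proof -
      have "snd (l ! i) = snd (l2 ! (i - length l1))" "i - length l1 < length l2"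
        using that by (auto simp: l_def nth_append split: prod.splits)
      then have "snd (l ! i) \<in> Y" using l2 by (auto simp: image_subset_iff)
      then show ?thesis using Y by auto
    qed
    ultimately show ?thesis by (auto simp: l_def) (metis leI length_append length_map l_def)
  qed
  moreover have "finprod G ?f {..<length l1} = finprod G (\<lambda>i. sg (fst (l1 ! i)) (snd (l1 ! i))) {..<length l1}"
    using c12(1) by (intro finprod_cong') (auto simp: l_def nth_append image_subset_iff)
  ultimately show ?thesis using lc_finprod[OF c12(1)] l1 by simp
qed

end

section \<open>Good relations and their one-step extensions\<close>

definition lvars :: "lin \<Rightarrow> nat set" where "lvars l = (\<lambda>(b, w, v). v) ` set l"

definition lflip :: "lin \<Rightarrow> lin" where "lflip = map (\<lambda>(b, w, v). (\<not> b, w, v))"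

definition lpow :: "nat \<Rightarrow> lin \<Rightarrow> lin" where "lpow n l = concat (replicate n l)"

context R_model
begin

lemma mult_inv_eq_one:
  assumes "x \<in> carrier G" "y \<in> carrier G"
  shows "x \<otimes> inv y = \<one> \<longleftrightarrow> x = y"
proof
  assume "x \<otimes> inv y = \<one>"
  then have "x \<otimes> inv y \<otimes> y = y" using assms by simp
  then show "x = y" using assms by (simp add: m_assoc)
qed (use assms in simp)

lemma pow_inj:
  assumes "x \<in> carrier G" "y \<in> carrier G" "n > 0" "x [^] (n::nat) = y [^] n"
  shows "x = y"
proof -
  have "(x \<otimes> inv y) [^] n = \<one>"
    using assms by (simp add: nat_pow_distrib nat_pow_inv)
  then have "x \<otimes> inv y = \<one>" using torsion_free[of "x \<otimes> inv y" n] assms by simp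
  then show ?thesis using assms by (simp add: mult_inv_eq_one)
qed

text \<open>For \<open>n = 0\<close> this says that \<open>x\<close> is zero. Equations and congruences are therefore instances
  of the same condition.\<close>

definition dv :: "nat \<Rightarrow> 'b \<Rightarrow> bool" where
  "dv n x \<longleftrightarrow> (\<exists>y\<in>carrier G. y [^] n = x)"

lemma dv_0 [simp]: "dv 0 x \<longleftrightarrow> x = \<one>"
  by (auto simp: dv_def)

lemma dv_mult: "dv n a \<Longrightarrow> dv n b \<Longrightarrow> dv n (a \<otimes> b)"
  unfolding dv_def by (metis nat_pow_distrib m_closed)

lemma dv_inv: "dv n a \<Longrightarrow> dv n (inv a)"
  unfolding dv_def by (metis nat_pow_inv inv_closed)

lemma dv_cancel:
  assumes "a \<in> carrier G" "b \<in> carrier G" "dv n a"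
  shows "dv n (a \<otimes> b) \<longleftrightarrow> dv n b"
proof
  assume "dv n (a \<otimes> b)"
  then have "dv n (inv a \<otimes> (a \<otimes> b))" using assms dv_inv dv_mult by blast
  then show "dv n b" using assms by (simp add: m_assoc[symmetric])
qed (use assms dv_mult in blast)

lemma dv_pow: "x \<in> carrier G \<Longrightarrow> dv n (x [^] n)"
  by (auto simp: dv_def)

lemma dv_pow_mult:
  assumes "x \<in> carrier G" "n > 0"
  shows "dv (n * m) (x [^] n) \<longleftrightarrow> dv m x"
proof
  assume "dv (n * m) (x [^] n)"
  then obtain y where y: "y \<in> carrier G" "(y [^] m) [^] n = x [^] n"
    by (auto simp: dv_def nat_pow_pow mult.commute)
  then have "y [^] m = x" using assms pow_inj[of "y [^] m" x n] by simp
  then show "dv m x" using y by (auto simp: dv_def)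
next
  assume "dv m x"
  then obtain y where "y \<in> carrier G" "x = y [^] m" by (auto simp: dv_def)
  then show "dv (n * m) (x [^] n)" by (auto simp: dv_def nat_pow_pow mult.commute)
qed

text \<open>\<open>x\<close> and \<open>y\<close> have the same image in the profinite completion of the integers.\<close>

definition res :: "'b \<Rightarrow> 'b \<Rightarrow> bool" where
  "res x y \<longleftrightarrow> (\<forall>n>0. \<forall>k::nat. dv n (u [^] k \<otimes> x) \<longleftrightarrow> dv n (u [^] k \<otimes> y))"

lemma res_sym: "res x y \<Longrightarrow> res y x"
  unfolding res_def by simp

lemma res_shift:
  assumes "x \<in> carrier G" "y \<in> carrier G" "res x y"
  shows "res (u [^] (k::nat) \<otimes> x) (u [^] k \<otimes> y)"
proof -
  have "u [^] j \<otimes> (u [^] k \<otimes> z) = u [^] (j + k) \<otimes> z" if "z \<in> carrier G" for z and j :: nat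
    using that by (simp add: m_assoc[symmetric] nat_pow_mult)
  then show ?thesis using assms unfolding res_def by simp
qed

text \<open>The residue of a sum is determined by the residues of its summands: modulo \<open>n\<close>, the
  summand \<open>v\<close> may be replaced by the integer \<open>- j\<close>, that is, by \<open>(n - 1) j\<close>.\<close>

lemma dv_sum_residue:
  assumes xv: "x \<in> carrier G" "v \<in> carrier G" and n: "n > 0"
    and j: "dv n (v \<otimes> u [^] (j::nat))"
  shows "dv n (x \<otimes> v) \<longleftrightarrow> dv n (u [^] ((n - 1) * j) \<otimes> x)"
proof -
  have uj: "u [^] ((n - 1) * j) \<otimes> u [^] j = (u [^] j) [^] n"
  proof -
    have "(n - 1) * j + j = j * n" using n by (cases n) auto
    then show ?thesis by (simp add: nat_pow_mult nat_pow_pow)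
  qed
  have "(u [^] ((n - 1) * j) \<otimes> x) \<otimes> (v \<otimes> u [^] j) = (u [^] ((n - 1) * j) \<otimes> u [^] j) \<otimes> (x \<otimes> v)"
    using xv by (simp add: m_ac)
  then have e: "(v \<otimes> u [^] j) \<otimes> (u [^] ((n - 1) * j) \<otimes> x) = (u [^] j) [^] n \<otimes> (x \<otimes> v)"
    using xv unfolding uj by (subst m_comm) simp_all
  have "dv n (u [^] ((n - 1) * j) \<otimes> x) \<longleftrightarrow> dv n ((v \<otimes> u [^] j) \<otimes> (u [^] ((n - 1) * j) \<otimes> x))"
    using j xv by (intro dv_cancel[symmetric]) auto
  also have "\<dots> \<longleftrightarrow> dv n ((u [^] j) [^] n \<otimes> (x \<otimes> v))" by (simp only: e)
  also have "\<dots> \<longleftrightarrow> dv n (x \<otimes> v)" using xv by (intro dv_cancel dv_pow) auto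
  finally show ?thesis by simp
qed

lemma residue_ex: 
  assumes "v \<in> carrier G" "n > 0"
  obtains j :: nat where "dv n (v \<otimes> u [^] j)"
  using residue[OF assms] unfolding dv_def by blast

lemma dv_add_res:
  assumes c: "x \<in> carrier G" "y \<in> carrier G" "v \<in> carrier G" "w \<in> carrier G"
    and r: "res x y" "res v w" and n: "n > 0"
  shows "dv n (x \<otimes> v) \<longleftrightarrow> dv n (y \<otimes> w)"
proof -
  obtain j :: nat where j: "dv n (v \<otimes> u [^] j)" using residue_ex c n by blast
  then have "dv n (w \<otimes> u [^] j)" using r(2) n c by (simp add: res_def m_comm)
  then show ?thesis using dv_sum_residue[OF c(1,3) n j] dv_sum_residue[OF c(2,4) n] r(1) n
    by (simp add: res_def)
qed

lemma res_mult:
  assumes c: "x \<in> carrier G" "y \<in> carrier G" "v \<in> carrier G" "w \<in> carrier G"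
    and r: "res x y" "res v w"
  shows "res (x \<otimes> v) (y \<otimes> w)"
  unfolding res_def
proof (intro allI impI)
  fix n k :: nat assume n: "0 < n"
  have "dv n ((u [^] k \<otimes> x) \<otimes> v) \<longleftrightarrow> dv n ((u [^] k \<otimes> y) \<otimes> w)"
    using c r n by (intro dv_add_res res_shift) auto
  then show "dv n (u [^] k \<otimes> (x \<otimes> v)) \<longleftrightarrow> dv n (u [^] k \<otimes> (y \<otimes> w))"
    using c by (simp add: m_assoc)
qed

lemma res_inv:
  assumes c: "x \<in> carrier G" "y \<in> carrier G" and r: "res x y"
  shows "res (inv x) (inv y)"
proof -
  have "dv n (u [^] k \<otimes> inv x) \<longleftrightarrow> dv n (u [^] ((n - 1) * k) \<otimes> x)" if x: "x \<in> carrier G" and n: "n > 0" for x and n k :: nat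
  proof -
    have e: "inv (u [^] k \<otimes> inv x) \<otimes> (u [^] k) [^] n = u [^] ((n - 1) * k) \<otimes> x"
    proof -
      have "(u [^] k) [^] n = u [^] ((n - 1) * k) \<otimes> u [^] k"
        using n by (cases n) (auto simp: nat_pow_pow nat_pow_mult add.commute mult.commute)
      then have "inv (u [^] k \<otimes> inv x) \<otimes> (u [^] k) [^] n = inv (u [^] k) \<otimes> x \<otimes> (u [^] ((n - 1) * k) \<otimes> u [^] k)"
        using x by (simp add: inv_mult)
      also have "\<dots> = u [^] ((n - 1) * k) \<otimes> x \<otimes> (inv (u [^] k) \<otimes> u [^] k)"
        using x by (simp only: m_ac m_closed inv_closed nat_pow_closed u_closed)
      finally show ?thesis using x by simp
    qed
    have "dv n (u [^] k \<otimes> inv x) \<longleftrightarrow> dv n (inv (u [^] k \<otimes> inv x))"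
      using dv_inv[of n "u [^] k \<otimes> inv x"] dv_inv[of n "inv (u [^] k \<otimes> inv x)"] x by auto
    also have "\<dots> \<longleftrightarrow> dv n ((u [^] k) [^] n \<otimes> inv (u [^] k \<otimes> inv x))"
      using x by (intro dv_cancel[symmetric] dv_pow) auto
    also have "\<dots> \<longleftrightarrow> dv n (u [^] ((n - 1) * k) \<otimes> x)"
      using x by (subst e[symmetric]) (simp add: m_comm)
    finally show ?thesis .
  qed
  then show ?thesis using assms unfolding res_def by simp
qed

lemma res_nat_pow:
  assumes c: "x \<in> carrier G" "y \<in> carrier G" and r: "res x y"
  shows "res (x [^] (n::nat)) (y [^] n)"
proof (induction n)
  case 0
  show ?case by (simp add: res_def)
next
  case (Suc n)
  then show ?case using assms by (simp add: res_mult)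
qed

lemma res_int_pow:
  assumes c: "x \<in> carrier G" "y \<in> carrier G" and r: "res x y"
  shows "res (x [^] (k::int)) (y [^] k)"
  unfolding int_pow_def2
  by (cases "k < 0"; simp only: if_True if_False) (intro res_inv res_nat_pow nat_pow_closed assms)+

text \<open>Linear combinations of variables shifted by words; a coefficient is expressed by
  repetition. In \<open>lin1 c l\<close> every variable has the value \<open>c\<close>.\<close>

definition lin :: "(nat \<Rightarrow> 'b) \<Rightarrow> lin \<Rightarrow> 'b" where
  "lin e l = lc (map (\<lambda>(b, w, v). (b, shw N w (e v))) l)"

abbreviation "lin1 c l \<equiv> lin (\<lambda>_. c) l"

lemma lin_set_closed: 
  assumes "e ` lvars l \<subseteq> carrier G"
  shows "snd ` set (map (\<lambda>(b, w, v). (b, shw N w (e v))) l) \<subseteq> carrier G"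
proof -
  have "shw N w (e v) \<in> carrier G" if "(b, w, v) \<in> set l" for b w v
    using assms that by (intro shw_closed) (force simp: lvars_def)
  then show ?thesis by auto
qed

lemma lin_closed [simp]: "e ` lvars l \<subseteq> carrier G \<Longrightarrow> lin e l \<in> carrier G"
  unfolding lin_def by (intro lc_closed lin_set_closed)

lemma lin1_closed [simp]: "c \<in> carrier G \<Longrightarrow> lin1 c l \<in> carrier G"
  by (rule lin_closed) auto

lemma lin_append: 
  assumes "e ` lvars l \<subseteq> carrier G" "e ` lvars l' \<subseteq> carrier G"
  shows "lin e (l @ l') = lin e l \<otimes> lin e l'"
  unfolding lin_def map_append using assms by (intro lc_append lin_set_closed)

lemma lin1_append: "c \<in> carrier G \<Longrightarrow> lin1 c (l @ l') = lin1 c l \<otimes> lin1 c l'"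
  by (rule lin_append) auto

lemma lin_lflip: 
  assumes "e ` lvars l \<subseteq> carrier G"
  shows "lin e (lflip l) = inv (lin e l)"
proof -
  have "map (\<lambda>(b, w, v). (b, shw N w (e v))) (lflip l)
    = map (\<lambda>(b, x). (\<not> b, x)) (map (\<lambda>(b, w, v). (b, shw N w (e v))) l)"
    by (auto simp: lflip_def)
  then show ?thesis using lc_flip[OF lin_set_closed[OF assms]] by (simp only: lin_def)
qed

lemma lin1_lflip: "c \<in> carrier G \<Longrightarrow> lin1 c (lflip l) = inv (lin1 c l)"
  by (rule lin_lflip) auto

lemma lvars_lpow: "lvars (lpow n l) \<subseteq> lvars l"
  by (cases "n = 0") (auto simp: lvars_def lpow_def image_iff intro: rev_bexI)

lemma lin_lpow: 
  assumes "e ` lvars l \<subseteq> carrier G"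
  shows "lin e (lpow n l) = lin e l [^] n"
proof (induction n)
  case 0
  show ?case by (simp add: lpow_def lin_def)
next
  case (Suc n)
  have "lin e (lpow (Suc n) l) = lin e l \<otimes> lin e (lpow n l)"
    using assms lvars_lpow[of n l] lin_append[of e l "lpow n l"] by (simp add: lpow_def) blast
  then show ?case using Suc assms by (simp add: m_comm)
qed

lemma lin1_lpow: "c \<in> carrier G \<Longrightarrow> lin1 c (lpow n l) = lin1 c l [^] n"
  by (rule lin_lpow) auto

lemma lin1_single: "c \<in> carrier G \<Longrightarrow> lin1 c [(True, w, v)] = shw N w c"
  by (simp add: lin_def)

lemma lin1_generate:
  assumes "c \<in> R" shows "lin1 c l \<in> generate G (orb c)"
proof -
  have "orb c \<subseteq> carrier G" using R_carrier by (auto simp: orb_def)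
  moreover have "snd ` set (map (\<lambda>(b, w, v). (b, shw N w c)) l) \<subseteq> orb c"
    using assms shw_R eqv_shw by (auto simp: orb_def)
  ultimately show ?thesis unfolding lin_def by (subst generate_lc) blast+
qed

text \<open>Off \<open>R\<close> the functions \<open>S\<close> and \<open>S\<^sup>-\<^sup>1\<close> are the identity, so a linear combination of shifts
  is a multiple.\<close>

lemma lin1_off:
  assumes "c \<in> carrier G" "c \<notin> R" 
  shows "\<exists>k::int. \<forall>d\<in>carrier G - R. lin1 d l = d [^] k"
proof (induction l)
  case Nil
  show ?case by (rule exI[of _ 0]) (simp add: lin_def)
next
  case (Cons p l)
  obtain b w v where p: "p = (b, w, v)" by (cases p)
  from Cons obtain k :: int where k: "\<forall>d\<in>carrier G - R. lin1 d l = d [^] k" by blast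
  have "lin1 d (p # l) = d [^] ((if b then 1 else -1) + k)" if d: "d \<in> carrier G - R" for d
  proof -
    have "lin1 d (p # l) = sg b d \<otimes> lin1 d l" using d shw_off by (auto simp: lin_def p)
    then show ?thesis using d k by (auto simp: int_pow_mult int_pow_neg)
  qed
  then show ?case by blast
qed

text \<open>\<open>half f\<close> is one half of the conditions that make \<open>f\<close> an isomorphism between substructures.
  Two clauses go beyond preservation: \<open>f\<close> is closed under division by \<open>n\<close>, and each element of
  the domain that is a sum of elements of \<open>R\<close> has a multiple that is already a sum of elements
  of \<open>R\<close> in the domain. The last clause is the independence of the domain from \<open>R\<close> over its own
  part of \<open>R\<close>; it guarantees that a new element of \<open>R\<close> satisfies no unforeseen equation over the
  domain.\<close>

definition half :: "('b \<times> 'b) set \<Rightarrow> bool" where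
  "half f \<longleftrightarrow> f \<subseteq> carrier G \<times> carrier G \<and>
     (\<one>, \<one>) \<in> f \<and> (u, u) \<in> f \<and> (c0, c0) \<in> f \<and>
     (\<forall>x y x' y'. (x, y) \<in> f \<longrightarrow> (x', y') \<in> f \<longrightarrow> (x \<otimes> x', y \<otimes> y') \<in> f) \<and>
     (\<forall>x y. (x, y) \<in> f \<longrightarrow> (inv x, inv y) \<in> f \<and> (S x, S y) \<in> f \<and> (S' x, S' y) \<in> f) \<and>
     (\<forall>y. (\<one>, y) \<in> f \<longrightarrow> y = \<one>) \<and>
     (\<forall>x y n. (x, y) \<in> f \<longrightarrow> n > 0 \<longrightarrow> dv n x \<longrightarrow> dv n y) \<and>
     (\<forall>x y. (x, y) \<in> f \<longrightarrow> x \<in> R \<longrightarrow> y \<in> R) \<and>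
     (\<forall>x\<in>carrier G. \<forall>y\<in>carrier G. \<forall>n>0. (x [^] (n::nat), y [^] n) \<in> f \<longrightarrow> (x, y) \<in> f) \<and>
     (\<forall>x\<in>Domain f \<inter> generate G R. \<exists>n>0. x [^] (n::nat) \<in> generate G (Domain f \<inter> R))"

lemma half_one: "half f \<Longrightarrow> (\<one>, y) \<in> f \<Longrightarrow> y = \<one>"
  and half_dv: "half f \<Longrightarrow> (x, y) \<in> f \<Longrightarrow> n > 0 \<Longrightarrow> dv n x \<Longrightarrow> dv n y"
  and half_R: "half f \<Longrightarrow> (x, y) \<in> f \<Longrightarrow> x \<in> R \<Longrightarrow> y \<in> R"
  and half_pure: "half f \<Longrightarrow> x \<in> carrier G \<Longrightarrow> y \<in> carrier G \<Longrightarrow> n > 0 \<Longrightarrow>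
    (x [^] (n::nat), y [^] n) \<in> f \<Longrightarrow> (x, y) \<in> f"
  and half_free: "half f \<Longrightarrow> x \<in> Domain f \<Longrightarrow> x \<in> generate G R \<Longrightarrow>
    \<exists>n>0. x [^] (n::nat) \<in> generate G (Domain f \<inter> R)"
  unfolding half_def by (simp_all only: Int_iff Ball_def)

definition good :: "('b \<times> 'b) set \<Rightarrow> bool" where
  "good f \<longleftrightarrow> half f \<and> half (f\<inverse>)"

lemma good_converse: "good f \<Longrightarrow> good (f\<inverse>)"
  by (simp add: good_def)

context
  fixes f assumes f: "good f"
begin

lemma good_closed: "(x, y) \<in> f \<Longrightarrow> x \<in> carrier G" "(x, y) \<in> f \<Longrightarrow> y \<in> carrier G"
  using f by (auto simp: good_def half_def)

lemma good_consts: "(\<one>, \<one>) \<in> f" "(u, u) \<in> f" "(c0, c0) \<in> f"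
  using f by (auto simp: good_def half_def)

lemma good_mult: "(x, y) \<in> f \<Longrightarrow> (x', y') \<in> f \<Longrightarrow> (x \<otimes> x', y \<otimes> y') \<in> f"
  using f by (auto simp: good_def half_def)

lemma good_inv: "(x, y) \<in> f \<Longrightarrow> (inv x, inv y) \<in> f"
  and good_S: "(x, y) \<in> f \<Longrightarrow> (S x, S y) \<in> f"
  and good_S': "(x, y) \<in> f \<Longrightarrow> (S' x, S' y) \<in> f"
  using f by (auto simp: good_def half_def)

lemma good_halves: "half f" "half (f\<inverse>)"
  using f by (auto simp: good_def)

lemma good_one: "(x, y) \<in> f \<Longrightarrow> x = \<one> \<longleftrightarrow> y = \<one>"
  using half_one[OF good_halves(1), of y] half_one[OF good_halves(2), of x] by auto

lemma good_dv: "(x, y) \<in> f \<Longrightarrow> n > 0 \<Longrightarrow> dv n x \<longleftrightarrow> dv n y"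
  using half_dv[OF good_halves(1), of x y n] half_dv[OF good_halves(2), of y x n] by auto

lemma good_R: "(x, y) \<in> f \<Longrightarrow> x \<in> R \<longleftrightarrow> y \<in> R"
  using half_R[OF good_halves(1), of x y] half_R[OF good_halves(2), of y x] by auto

lemmas good_pure = half_pure[OF good_halves(1)]
lemmas good_free = half_free[OF good_halves(1)]

lemma good_pow: "(x, y) \<in> f \<Longrightarrow> (x [^] (n::nat), y [^] n) \<in> f"
  by (induction n) (auto simp: good_consts good_mult)

lemma good_shw: "(x, y) \<in> f \<Longrightarrow> (shw N w x, shw N w y) \<in> f"
  by (induction w) (auto simp: good_S good_S')

lemma good_fun: 
  assumes "(x, y) \<in> f" "(x', y') \<in> f" shows "x = x' \<longleftrightarrow> y = y'"
  using good_one[OF good_mult[OF assms(1) good_inv[OF assms(2)]]] good_closed[OF assms(1)] good_closed[OF assms(2)]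
  by (simp add: mult_inv_eq_one)

text \<open>The constant 1 is related to itself, so divisibility of \<open>k + x\<close> is preserved.\<close>

lemma good_res: 
  assumes "(x, y) \<in> f" shows "res x y"
  unfolding res_def using good_dv[OF good_mult[OF good_pow[OF good_consts(2)] assms]] by blast

lemma good_dom_pure:
  assumes "x \<in> carrier G" "n > 0" "x [^] (n::nat) \<in> Domain f"
  shows "x \<in> Domain f"
proof -
  obtain y where y: "(x [^] n, y) \<in> f" using assms by auto
  have "dv n y" using good_dv[OF y \<open>n > 0\<close>] dv_pow[OF assms(1)] by blast
  then obtain z where "z \<in> carrier G" "z [^] n = y" by (auto simp: dv_def)
  then show ?thesis using good_pure[OF assms(1) _ \<open>n > 0\<close>] y by blast
qed

lemma good_dom_subgroup: "subgroup (Domain f) G"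
  using good_closed good_mult good_inv good_consts by (unfold_locales) blast+

lemma good_dom_eqv:
  assumes "x \<in> Domain f" "eqv x y" "y \<in> R"
  shows "y \<in> Domain f"
  using eqv_imp_shw[OF assms(2,3)] good_shw assms(1) by blast

lemma good_dom_lin: 
  assumes "\<And>v. v \<in> lvars l \<Longrightarrow> (e v, e' v) \<in> f"
  shows "(lin e l, lin e' l) \<in> f"
  using assms
proof (induction l)
  case Nil
  then show ?case by (simp add: lin_def good_consts)
next
  case (Cons p l)
  obtain b w v where p: "p = (b, w, v)" by (cases p)
  have "(shw N w (e v), shw N w (e' v)) \<in> f" using Cons.prems by (intro good_shw) (simp add: lvars_def p)
  moreover have "(lin e l, lin e' l) \<in> f" using Cons by (simp add: lvars_def)
  ultimately show ?case using good_inv by (auto simp: lin_def p intro!: good_mult)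
qed

end

text \<open>The pure closure of the relation generated by \<open>f\<close> and the orbit of \<open>(c, d)\<close>.\<close>

definition ext :: "('b \<times> 'b) set \<Rightarrow> 'b \<Rightarrow> 'b \<Rightarrow> ('b \<times> 'b) set" where
  "ext f c d = {(x', y'). x' \<in> carrier G \<and> y' \<in> carrier G \<and>
     (\<exists>n>0. \<exists>x y l. (x, y) \<in> f \<and> x' [^] (n::nat) = x \<otimes> lin1 c l \<and> y' [^] n = y \<otimes> lin1 d l)}"

lemma ext_converse: "(ext f c d)\<inverse> = ext (f\<inverse>) d c"
  by (auto simp: ext_def)

lemma ext_extends:
  assumes "good f" "c \<in> carrier G" "d \<in> carrier G"
  shows "f \<subseteq> ext f c d"
proof safe
  fix x y assume xy: "(x, y) \<in> f"
  have "lin1 c [] = \<one>" "lin1 d [] = \<one>" by (auto simp: lin_def)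
  then have "x [^] (1::nat) = x \<otimes> lin1 c []" "y [^] (1::nat) = y \<otimes> lin1 d []"
    using good_closed[OF assms(1) xy] by simp_all
  then show "(x, y) \<in> ext f c d"
    unfolding ext_def using good_closed[OF assms(1) xy] xy lessI[of 0, folded One_nat_def] by blast
qed

lemma ext_new:
  assumes "good f" "c \<in> carrier G" "d \<in> carrier G"
  shows "(shw N w c, shw N w d) \<in> ext f c d"
proof -
  have "shw N w c [^] (1::nat) = \<one> \<otimes> lin1 c [(True, w, 0)]" "shw N w d [^] (1::nat) = \<one> \<otimes> lin1 d [(True, w, 0)]"
    using assms by (simp_all add: lin1_single)
  then show ?thesis unfolding ext_def using good_consts[OF assms(1)] assms lessI[of 0, folded One_nat_def] by blast
qed

context
  fixes f c d
  assumes f: "good f" and c: "c \<in> carrier G" and d: "d \<in> carrier G"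
    and A1: "\<And>l. res (lin1 c l) (lin1 d l)"
    and A2: "\<forall>x y l. (x, y) \<in> f \<longrightarrow> x \<otimes> lin1 c l = \<one> \<longrightarrow> y \<otimes> lin1 d l = \<one>"
begin

text \<open>After raising both presentations to a common exponent, the linear combinations are added.\<close>

lemma ext_mult:
  assumes "(x, y) \<in> ext f c d" "(x', y') \<in> ext f c d"
  shows "(x \<otimes> x', y \<otimes> y') \<in> ext f c d"
proof -
  obtain n g h l where 1: "x \<in> carrier G" "y \<in> carrier G" "n > 0" "(g, h) \<in> f"
    "x [^] (n::nat) = g \<otimes> lin1 c l" "y [^] n = h \<otimes> lin1 d l"
    using assms(1) unfolding ext_def by blast
  obtain n' g' h' l' where 2: "x' \<in> carrier G" "y' \<in> carrier G" "n' > 0" "(g', h') \<in> f"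
    "x' [^] (n'::nat) = g' \<otimes> lin1 c l'" "y' [^] n' = h' \<otimes> lin1 d l'"
    using assms(2) unfolding ext_def by blast
  \<comment> \<open>The exponents of the two presentations are \<open>n\<close> and \<open>n'\<close>; that of the product is \<open>n n'\<close>.\<close>
  let ?l = "lpow n' l @ lpow n l'"
  have key: "(z \<otimes> z') [^] (n * n') = (k [^] n' \<otimes> k' [^] n) \<otimes> lin1 e ?l"
    if "z \<in> carrier G" "z' \<in> carrier G" "k \<in> carrier G" "k' \<in> carrier G" "e \<in> carrier G"
      "z [^] n = k \<otimes> lin1 e l" "z' [^] n' = k' \<otimes> lin1 e l'" for z z' k k' e
  proof -
    have "(z \<otimes> z') [^] (n * n') = (z [^] n) [^] n' \<otimes> (z' [^] n') [^] n"
      using that(1,2) by (simp add: nat_pow_distrib nat_pow_pow mult.commute)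
    also have "\<dots> = (k [^] n' \<otimes> lin1 e l [^] n') \<otimes> (k' [^] n \<otimes> lin1 e l' [^] n)"
      using that(3-) by (simp add: nat_pow_distrib)
    also have "\<dots> = (k [^] n' \<otimes> k' [^] n) \<otimes> lin1 e ?l"
      using that(3-5) by (simp add: lin1_append lin1_lpow m_ac)
    finally show ?thesis .
  qed
  have "(x \<otimes> x') [^] (n * n') = (g [^] n' \<otimes> g' [^] n) \<otimes> lin1 c ?l"
    "(y \<otimes> y') [^] (n * n') = (h [^] n' \<otimes> h' [^] n) \<otimes> lin1 d ?l"
    using 1 2 good_closed[OF f 1(4)] good_closed[OF f 2(4)] c d by (auto intro!: key)
  moreover have "(g [^] n' \<otimes> g' [^] n, h [^] n' \<otimes> h' [^] n) \<in> f"
    using 1 2 by (intro good_mult[OF f] good_pow[OF f])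
  moreover have "0 < n * n'" using 1 2 by simp
  ultimately show ?thesis unfolding ext_def using 1(1,2) 2(1,2) m_closed by blast
qed

lemma ext_inv:
  assumes "(x, y) \<in> ext f c d"
  shows "(inv x, inv y) \<in> ext f c d"
proof -
  obtain n g h l where 1: "x \<in> carrier G" "y \<in> carrier G" "n > 0" "(g, h) \<in> f"
    "x [^] (n::nat) = g \<otimes> lin1 c l" "y [^] n = h \<otimes> lin1 d l"
    using assms(1) unfolding ext_def by blast
  note gh = good_closed[OF f 1(4)]
  have "inv x [^] n = inv g \<otimes> lin1 c (lflip l)" "inv y [^] n = inv h \<otimes> lin1 d (lflip l)"
    using 1 gh c d by (simp_all add: nat_pow_inv lin1_lflip inv_mult)
  then show ?thesis unfolding ext_def using 1(1-3) good_inv[OF f 1(4)] inv_closed by blast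
qed

lemma ext_one:
  assumes "(\<one>, y) \<in> ext f c d" shows "y = \<one>"
proof -
  obtain n g h l where 1: "y \<in> carrier G" "n > 0" "(g, h) \<in> f"
    "\<one> [^] (n::nat) = g \<otimes> lin1 c l" "y [^] n = h \<otimes> lin1 d l"
    using assms(1) unfolding ext_def by blast
  then have "y [^] n = \<one>" using A2 by simp
  then show ?thesis using torsion_free 1 by blast
qed

lemma ext_fun:
  assumes "(x, y) \<in> ext f c d" "(x, y') \<in> ext f c d" shows "y = y'"
proof -
  have cl: "x \<in> carrier G" "y \<in> carrier G" "y' \<in> carrier G" using assms unfolding ext_def by auto
  \<comment> \<open>Linearity reduces uniqueness of the image to the image of zero.\<close>
  have "(\<one>, y \<otimes> inv y') \<in> ext f c d" using ext_mult[OF assms(1) ext_inv[OF assms(2)]] cl by simp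
  then have "y \<otimes> inv y' = \<one>" by (rule ext_one)
  then show ?thesis using cl by (simp add: mult_inv_eq_one)
qed

text \<open>Divisibility of \<open>x\<close> by \<open>m\<close> is divisibility of its multiple \<open>n x\<close> by \<open>n m\<close>, and this is a
  matter of residues of the element of \<open>f\<close> and of the linear combination in \<open>c\<close>.\<close>

lemma ext_dv:
  assumes "(x, y) \<in> ext f c d" "m > 0" 
  shows "dv m x \<longleftrightarrow> dv m y"
proof -
  obtain n g h l where 1: "x \<in> carrier G" "y \<in> carrier G" "n > 0" "(g, h) \<in> f"
    "x [^] (n::nat) = g \<otimes> lin1 c l" "y [^] n = h \<otimes> lin1 d l"
    using assms(1) unfolding ext_def by blast
  have "dv m x \<longleftrightarrow> dv (n * m) (g \<otimes> lin1 c l)" using dv_pow_mult[of x n m] 1 by simp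
  also have "\<dots> \<longleftrightarrow> dv (n * m) (h \<otimes> lin1 d l)"
    using good_closed[OF f 1(4)] c d good_res[OF f 1(4)] A1 1 assms(2) by (intro dv_add_res) auto
  also have "\<dots> \<longleftrightarrow> dv m y" using dv_pow_mult[of y n m] 1 by simp
  finally show ?thesis .
qed

lemma ext_pure:
  assumes "x \<in> carrier G" "y \<in> carrier G" "m > 0" "(x [^] (m::nat), y [^] m) \<in> ext f c d"
  shows "(x, y) \<in> ext f c d"
proof -
  obtain n g h l where 1: "n > 0" "(g, h) \<in> f"
    "(x [^] m) [^] (n::nat) = g \<otimes> lin1 c l" "(y [^] m) [^] n = h \<otimes> lin1 d l"
    using assms(4) unfolding ext_def by blast
  then have "x [^] (m * n) = g \<otimes> lin1 c l" "y [^] (m * n) = h \<otimes> lin1 d l" "m * n > 0"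
    using assms by (simp_all add: nat_pow_pow)
  then show ?thesis unfolding ext_def using assms 1(2) by blast
qed

text \<open>What remains to be checked for a specific extension: which elements of \<open>R\<close> it contains,
  and that it is still independent from \<open>R\<close>.\<close>

lemma ext_half:
  assumes A3: "\<And>x y. (x, y) \<in> ext f c d \<Longrightarrow> x \<in> R \<Longrightarrow>
      (x, y) \<in> f \<or> c \<in> R \<and> d \<in> R \<and> (\<exists>w. x = shw N w c \<and> y = shw N w d)"
    and A3': "\<And>x y. (x, y) \<in> ext f c d \<Longrightarrow> y \<in> R \<Longrightarrow> x \<in> R"
    and A4: "\<And>x. x \<in> Domain (ext f c d) \<Longrightarrow> x \<in> generate G R \<Longrightarrow>
       \<exists>n>0. x [^] (n::nat) \<in> generate G (Domain (ext f c d) \<inter> R)"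
  shows "half (ext f c d)"
proof -
  have R: "y \<in> R" if "(x, y) \<in> ext f c d" "x \<in> R" for x y
    using A3[OF that] good_R[OF f] that(2) shw_R by blast
  have SS: "(S x, S y) \<in> ext f c d \<and> (S' x, S' y) \<in> ext f c d" if xy: "(x, y) \<in> ext f c d" for x y
  proof (cases "x \<in> R")
    case True
    from A3[OF xy True] show ?thesis
    proof
      assume "(x, y) \<in> f"
      then show ?thesis using good_S[OF f] good_S'[OF f] ext_extends[OF f c d] by blast
    next
      assume "c \<in> R \<and> d \<in> R \<and> (\<exists>w. x = shw N w c \<and> y = shw N w d)"
      then obtain w where "x = shw N w c" "y = shw N w d" by blast
      then show ?thesis using ext_new[OF f c d, of "True # w"] ext_new[OF f c d, of "False # w"] by simp
    qed
  next
    case False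
    then have "y \<notin> R" using A3' xy by blast
    moreover have "x \<in> carrier G" "y \<in> carrier G" using xy by (auto simp: ext_def)
    ultimately show ?thesis using xy False S_off S'_off by simp
  qed
  show ?thesis
    unfolding half_def
  proof (intro conjI)
    show "ext f c d \<subseteq> carrier G \<times> carrier G" by (auto simp: ext_def)
    show "(\<one>, \<one>) \<in> ext f c d" "(u, u) \<in> ext f c d" "(c0, c0) \<in> ext f c d"
      using ext_extends[OF f c d] good_consts[OF f] by auto
    show "\<forall>x y x' y'. (x, y) \<in> ext f c d \<longrightarrow> (x', y') \<in> ext f c d \<longrightarrow> (x \<otimes> x', y \<otimes> y') \<in> ext f c d"
      by (intro allI impI ext_mult)
    show "\<forall>x y. (x, y) \<in> ext f c d \<longrightarrow> (inv x, inv y) \<in> ext f c d \<and> (S x, S y) \<in> ext f c d \<and> (S' x, S' y) \<in> ext f c d"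
      using ext_inv SS by (intro allI impI conjI) simp_all
    show "\<forall>y. (\<one>, y) \<in> ext f c d \<longrightarrow> y = \<one>"
      by (intro allI impI ext_one)
    show "\<forall>x y n. (x, y) \<in> ext f c d \<longrightarrow> 0 < n \<longrightarrow> dv n x \<longrightarrow> dv n y"
      using ext_dv by (intro allI impI) simp
    show "\<forall>x y. (x, y) \<in> ext f c d \<longrightarrow> x \<in> R \<longrightarrow> y \<in> R"
      using R by (intro allI impI) simp
    show "\<forall>x\<in>carrier G. \<forall>y\<in>carrier G. \<forall>n>0. (x [^] (n::nat), y [^] n) \<in> ext f c d \<longrightarrow> (x, y) \<in> ext f c d"
      by (intro ballI allI impI) (rule ext_pure)
    show "\<forall>x\<in>Domain (ext f c d) \<inter> generate G R. \<exists>n>0. x [^] (n::nat) \<in> generate G (Domain (ext f c d) \<inter> R)"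
      using A4 by (intro ballI) (simp only: Int_iff)
  qed
qed

end

lemma generate_closed: "X \<subseteq> carrier G \<Longrightarrow> subgroup (generate G X) G"
  by (rule generate_is_subgroup)

lemma subgroup_pow: "subgroup H G \<Longrightarrow> x \<in> H \<Longrightarrow> x [^] (n::nat) \<in> H"
  by (induction n) (auto intro: subgroup.one_closed subgroup.m_closed)

context
  fixes f c d
  assumes f: "good f" and c: "c \<in> R" "c \<notin> Domain f" and d: "d \<in> R" "d \<notin> Range f"
    and B1: "\<And>l. res (lin1 c l) (lin1 d l)" and B2: "\<And>l. lin1 c l = \<one> \<longleftrightarrow> lin1 d l = \<one>"
begin

lemma R_step_orb: "orb c \<inter> Domain f = {}"
  using good_dom_eqv[OF f] c eqv_sym unfolding orb_def by blast

text \<open>An equation \<open>x + lin1 c l = 0\<close> puts \<open>x\<close> into the subgroup generated by \<open>R\<close>, hence a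
  multiple of \<open>x\<close> into that generated by the elements of \<open>R\<close> in the domain. These orbits are
  disjoint from that of \<open>c\<close>, so \<open>x\<close> and \<open>lin1 c l\<close> vanish separately.\<close>

lemma R_step_vanish: "\<forall>x y l. (x, y) \<in> f \<longrightarrow> x \<otimes> lin1 c l = \<one> \<longrightarrow> y \<otimes> lin1 d l = \<one>"
proof (intro allI impI)
  fix x y l assume assms: "(x, y) \<in> f" "x \<otimes> lin1 c l = \<one>"
  note cl = good_closed[OF f assms(1)]
  have lx: "lin1 c l = inv x"
    using assms(2) cl c R_closed by (intro inv_equality[symmetric]) (auto simp: m_comm)
  have "orb c \<subseteq> R" by (auto simp: orb_def)
  then have "inv x \<in> generate G R"
    using lin1_generate[OF c(1), of l] mono_generate[of "orb c" R] lx by auto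
  moreover have "inv x \<in> Domain f" using good_inv[OF f assms(1)] by blast
  ultimately obtain n :: nat where n: "n > 0" "inv x [^] n \<in> generate G (Domain f \<inter> R)"
    using good_free[OF f] by blast
  have "inv x [^] n \<in> generate G (orb c)"
    using lin1_generate[OF c(1), of l] lx R_carrier
    by (auto simp: orb_def intro!: subgroup_pow generate_closed)
  then have "inv x [^] n = \<one>"
    using n(2) R_step_orb by (intro orbits_independent[OF orbit_closed_orb, of "Domain f \<inter> R"]) auto
  then have "inv x = \<one>" using torsion_free[of "inv x" n] n cl by simp
  then have "x = \<one>" "lin1 c l = \<one>" using lx cl by auto
  then show "y \<otimes> lin1 d l = \<one>" using B2 good_one[OF f assms(1)] by simp
qed

lemma R_step_free:
  assumes "x \<in> Domain (ext f c d)" "x \<in> generate G R"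
  shows "\<exists>n>0. x [^] (n::nat) \<in> generate G ((Domain f \<inter> R) \<union> orb c)"
proof -
  obtain n g h l where 1: "x \<in> carrier G" "n > 0" "(g, h) \<in> f" "x [^] (n::nat) = g \<otimes> lin1 c l"
    using assms(1) unfolding ext_def by blast
  note gh = good_closed[OF f 1(3)]
  have lcl: "lin1 c l \<in> carrier G" using c R_closed by simp
  have oc: "orb c \<subseteq> R" by (auto simp: orb_def)
  have sR: "subgroup (generate G R) G" using R_carrier by (rule generate_closed)
  have lR: "lin1 c l \<in> generate G R" using lin1_generate[OF c(1)] mono_generate[OF oc] by blast
  have xR: "x [^] n \<in> generate G R" using assms(2) by (intro subgroup_pow sR)
  have "g = x [^] n \<otimes> inv (lin1 c l)" unfolding 1(4) using gh lcl by (simp add: m_assoc)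
  then have "g \<in> generate G R" using sR lR xR subgroup.m_closed subgroup.m_inv_closed by metis
  then obtain m :: nat where m: "m > 0" "g [^] m \<in> generate G (Domain f \<inter> R)"
    using good_free[OF f] 1(3) by blast
  let ?Y = "(Domain f \<inter> R) \<union> orb c"
  have sY: "subgroup (generate G ?Y) G" using oc R_carrier by (intro generate_closed) auto
  have "g [^] m \<in> generate G ?Y" using m mono_generate[of "Domain f \<inter> R" ?Y] by blast
  moreover have "lin1 c l [^] m \<in> generate G ?Y"
    using lin1_generate[OF c(1), of l] mono_generate[of "orb c" ?Y] by (intro subgroup_pow sY) blast
  moreover have "x [^] (n * m) = g [^] m \<otimes> lin1 c l [^] m"
    using 1 gh lcl by (simp add: nat_pow_pow[symmetric] nat_pow_distrib)
  ultimately have "x [^] (n * m) \<in> generate G ?Y" using sY subgroup.m_closed by metis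
  then show ?thesis using 1 m by (intro exI[of _ "n * m"]) simp
qed

text \<open>An element of \<open>R\<close> outside the domain and outside the orbit of \<open>c\<close> is independent from both
  by \<open>orbits_independent\<close>, and no multiple of it can be generated by them, except if the element
  is zero.\<close>

lemma R_step_R:
  assumes xy: "(x, y) \<in> ext f c d" and x: "x \<in> R"
  shows "(x, y) \<in> f \<or> c \<in> R \<and> d \<in> R \<and> (\<exists>w. x = shw N w c \<and> y = shw N w d)"
proof -
  note cd = R_closed[OF c(1)] R_closed[OF d(1)]
  note F = ext_fun[OF f cd B1 R_step_vanish]
  consider "eqv c x" | "x \<in> Domain f" | "\<not> eqv c x" "x \<notin> Domain f" by blast
  then show ?thesis
  proof cases
    case 1
    then obtain w where w: "x = shw N w c" using eqv_imp_shw x by blast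
    then have "y = shw N w d" using F[OF xy] ext_new[OF f cd, of w] by simp
    then show ?thesis using w c d by blast
  next
    case 2
    then obtain y' where y': "(x, y') \<in> f" by blast
    then have "y = y'" using F[OF xy] ext_extends[OF f cd] by blast
    then show ?thesis using y' by blast
  next
    case 3
    let ?Y = "(Domain f \<inter> R) \<union> orb c"
    obtain n :: nat where n: "n > 0" "x [^] n \<in> generate G ?Y"
      using R_step_free[of x] xy generate.incl[OF x, of G] by blast
    have YR: "?Y \<subseteq> R" by (auto simp: orb_def)
    have "x [^] n \<in> generate G (orb x)"
      using R_carrier orb_self[OF x] by (intro subgroup_pow generate_closed generate.incl) (auto simp: orb_def)
    moreover have "orb x \<inter> ?Y = {}"
      using 3 good_dom_eqv[OF f] x eqv_sym eqv_trans unfolding orb_def by blast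
    ultimately have "x [^] n = \<one>" using YR n(2) by (intro orbits_independent[OF orbit_closed_orb, of ?Y]) auto
    then have "x = \<one>" using torsion_free[OF R_closed[OF x] n(1)] by simp
    then show ?thesis using 3 good_consts[OF f] by blast
  qed
qed

lemma R_step_generate:
  assumes "x \<in> Domain (ext f c d)" "x \<in> generate G R"
  shows "\<exists>n>0. x [^] (n::nat) \<in> generate G (Domain (ext f c d) \<inter> R)"
proof -
  note cd = R_closed[OF c(1)] R_closed[OF d(1)]
  have "orb c \<subseteq> Domain (ext f c d) \<inter> R"
  proof
    fix z assume "z \<in> orb c"
    then obtain w where "z = shw N w c" "z \<in> R" unfolding orb_def using eqv_imp_shw by blast
    then show "z \<in> Domain (ext f c d) \<inter> R" using ext_new[OF f cd, of w] by blast
  qed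
  then have "(Domain f \<inter> R) \<union> orb c \<subseteq> Domain (ext f c d) \<inter> R" using ext_extends[OF f cd] by blast
  then show ?thesis using R_step_free[OF assms] mono_generate by blast
qed

end

text \<open>A new element \<open>c\<close> of \<open>R\<close> can be mapped to any new element \<open>d\<close> of \<open>R\<close> that satisfies the
  same conditions in one variable, because \<open>c\<close> has no relations with the domain.\<close>

theorem good_ext_R:
  assumes f: "good f" and c: "c \<in> R" "c \<notin> Domain f" and d: "d \<in> R" "d \<notin> Range f"
    and B1: "\<And>l. res (lin1 c l) (lin1 d l)" and B2: "\<And>l. lin1 c l = \<one> \<longleftrightarrow> lin1 d l = \<one>"
  shows "good (ext f c d)"
proof -
  have f': "good (f\<inverse>)" using f by (rule good_converse)
  have c': "c \<notin> Range (f\<inverse>)" and d': "d \<notin> Domain (f\<inverse>)" using c d by auto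
  have B1': "res (lin1 d l) (lin1 c l)" for l using B1 res_sym by blast
  have B2': "lin1 d l = \<one> \<longleftrightarrow> lin1 c l = \<one>" for l using B2 by blast
  note cd = R_closed[OF c(1)] R_closed[OF d(1)]
  note P = R_step_R[OF f c d B1 B2] and P' = R_step_R[OF f' d(1) d' c(1) c' B1' B2']
  have R1: "y \<in> R" if "(x, y) \<in> ext f c d" "x \<in> R" for x y
    using P[OF that] good_R[OF f] that(2) shw_R by blast
  have R2: "x \<in> R" if "(x, y) \<in> ext f c d" "y \<in> R" for x y
  proof -
    have "(y, x) \<in> ext (f\<inverse>) d c" using that(1) unfolding ext_converse[symmetric] by blast
    from P'[OF this that(2)] show ?thesis using good_R[OF f] that(2) shw_R by blast
  qed
  have R1': "y \<in> R" if "(x, y) \<in> ext (f\<inverse>) d c" "x \<in> R" for x y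
    using that R2[of y x] unfolding ext_converse[symmetric] by blast
  have R2': "x \<in> R" if "(x, y) \<in> ext (f\<inverse>) d c" "y \<in> R" for x y
    using that R1[of y x] unfolding ext_converse[symmetric] by blast
  have "half (ext f c d)"
    by (rule ext_half[OF f cd B1 R_step_vanish[OF f c d B1 B2]]) (fact P, fact R2, fact R_step_generate[OF f c d B1 B2])
  moreover have "half (ext (f\<inverse>) d c)"
    by (rule ext_half[OF f' cd(2,1) B1' R_step_vanish[OF f' d(1) d' c(1) c' B1' B2']])
      (fact P', fact R2', fact R_step_generate[OF f' d(1) d' c(1) c' B1' B2'])
  ultimately show ?thesis by (simp add: good_def ext_converse)
qed

definition free_over :: "'b \<Rightarrow> 'b set \<Rightarrow> bool" where
  "free_over c X \<longleftrightarrow> (\<forall>n>0. \<forall>x\<in>X. \<forall>z\<in>generate G R. c [^] (n::nat) \<noteq> x \<otimes> z)"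

lemma free_overD: "free_over c X \<Longrightarrow> n > 0 \<Longrightarrow> x \<in> X \<Longrightarrow> z \<in> generate G R \<Longrightarrow> c [^] (n::nat) = x \<otimes> z \<Longrightarrow> False"
  unfolding free_over_def by blast

context
  fixes f c d
  assumes f: "good f" and c: "c \<in> carrier G" "free_over c (Domain f)"
    and d: "d \<in> carrier G" "free_over d (Range f)" and r: "res c d"
begin

lemma free_step_not_R: "c \<notin> R" "d \<notin> R"
proof -
  show "c \<notin> R"
  proof
    assume cR: "c \<in> R"
    have "c [^] (1::nat) = \<one> \<otimes> c" using c by simp
    with free_overD[OF c(2), of 1 \<one> c] good_consts(1)[OF f] generate.incl[OF cR, of G]
    show False by auto
  qed
  show "d \<notin> R"
  proof
    assume dR: "d \<in> R"
    have "d [^] (1::nat) = \<one> \<otimes> d" using d by simp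
    with free_overD[OF d(2), of 1 \<one> d] good_consts(1)[OF f] generate.incl[OF dR, of G]
    show False by auto
  qed
qed

lemma free_step_zero:
  assumes x: "x \<in> Domain f" and z: "z \<in> generate G R" and e: "x \<otimes> lin1 c l = z"
  shows "lin1 c l = \<one> \<and> lin1 d l = \<one>"
proof -
  obtain k :: int where k: "lin1 c l = c [^] k" "lin1 d l = d [^] k"
    using lin1_off[OF c(1) free_step_not_R(1)] c d free_step_not_R by blast
  have sG: "subgroup (Domain f) G" using good_dom_subgroup[OF f] .
  have sR: "subgroup (generate G R) G" using R_carrier by (rule generate_closed)
  have cl: "x \<in> carrier G" "z \<in> carrier G" using x z sG sR subgroup.mem_carrier by metis+
  have ck: "c [^] k = inv x \<otimes> z" using e cl c unfolding k by (auto simp: m_assoc[symmetric])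
  have "k = 0"
  proof (rule ccontr)
    assume "k \<noteq> 0"
    then consider "k > 0" | "- k > 0" by linarith
    then show False
    proof cases
      case 1
      then obtain m where m: "k = int m" "m > 0" using zero_less_imp_eq_int by blast
      have "c [^] m = inv x \<otimes> z" using ck by (simp only: m(1) int_pow_int)
      moreover have "inv x \<in> Domain f" using sG x subgroup.m_inv_closed by metis
      ultimately show False using free_overD[OF c(2) m(2) _ z, of "inv x"] by blast
    next
      case 2
      then obtain m where m: "k = - int m" "m > 0" 
        using zero_less_imp_eq_int[of "- k"] by (metis minus_minus)
      have "inv (c [^] m) = inv x \<otimes> z" using ck by (simp only: m(1) int_pow_neg_int[OF c(1)])
      then have "inv (inv (c [^] m)) = inv (inv x \<otimes> z)" by simp
      then have "c [^] m = x \<otimes> inv z" using cl c by (simp add: inv_mult)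
      moreover have "inv z \<in> generate G R" using sR z subgroup.m_inv_closed by metis
      ultimately show False using free_overD[OF c(2) m(2) x, of "inv z"] by blast
    qed
  qed
  then show ?thesis using k by simp
qed

lemma free_step_res: "res (lin1 c l) (lin1 d l)"
proof -
  obtain k :: int where "lin1 c l = c [^] k" "lin1 d l = d [^] k"
    using lin1_off[OF c(1) free_step_not_R(1)] c d free_step_not_R by blast
  then show ?thesis using res_int_pow[OF c(1) d(1) r] by simp
qed

lemma free_step_vanish: "\<forall>x y l. (x, y) \<in> f \<longrightarrow> x \<otimes> lin1 c l = \<one> \<longrightarrow> y \<otimes> lin1 d l = \<one>"
proof (intro allI impI)
  fix x y l assume assms: "(x, y) \<in> f" "x \<otimes> lin1 c l = \<one>"
  have l: "lin1 c l = \<one>" "lin1 d l = \<one>"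
    using free_step_zero[of x \<one> l] assms generate.one by blast+
  then show "y \<otimes> lin1 d l = \<one>"
    using assms good_one[OF f assms(1)] good_closed[OF f assms(1)] by simp
qed

text \<open>The extension by a free element adds nothing to the subgroup generated by \<open>R\<close>.\<close>

lemma free_step_in:
  assumes xy: "(x, y) \<in> ext f c d" and x: "x \<in> generate G R"
  shows "(x, y) \<in> f"
proof -
  obtain n g h l where 1: "x \<in> carrier G" "y \<in> carrier G" "n > 0" "(g, h) \<in> f"
    "x [^] (n::nat) = g \<otimes> lin1 c l" "y [^] n = h \<otimes> lin1 d l"
    using xy unfolding ext_def by blast
  have sR: "subgroup (generate G R) G" using R_carrier by (rule generate_closed)
  have "lin1 c l = \<one> \<and> lin1 d l = \<one>"
    using 1(4,5) subgroup_pow[OF sR x, of n] by (intro free_step_zero[of g "x [^] n"]) auto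
  then have "(x [^] n, y [^] n) \<in> f" using 1 good_closed[OF f 1(4)] by simp
  then show ?thesis using good_pure[OF f 1(1,2,3)] by blast
qed

end

text \<open>A free element can be mapped to any free element with the same residues: neither of them
  satisfies an equation, and both the elements of \<open>R\<close> and their sums stay as they were.\<close>

theorem good_ext_free:
  assumes f: "good f" and c: "c \<in> carrier G" "free_over c (Domain f)"
    and d: "d \<in> carrier G" "free_over d (Range f)" and r: "res c d"
  shows "good (ext f c d)"
proof -
  have f': "good (f\<inverse>)" using f by (rule good_converse)
  have c': "free_over c (Range (f\<inverse>))" and d': "free_over d (Domain (f\<inverse>))" using c d by auto
  note r' = res_sym[OF r]
  note P = free_step_in[OF f c d r] and P' = free_step_in[OF f' d(1) d' c(1) c' r']
  have R1: "y \<in> R" if "(x, y) \<in> ext f c d" "x \<in> R" for x y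
    using P[OF that(1) generate.incl[OF that(2)]] good_R[OF f] that(2) by blast
  have R2: "x \<in> R" if "(x, y) \<in> ext f c d" "y \<in> R" for x y
  proof -
    have "(y, x) \<in> ext (f\<inverse>) d c" using that(1) unfolding ext_converse[symmetric] by blast
    from P'[OF this generate.incl[OF that(2)]] show ?thesis using good_R[OF f] that(2) by blast
  qed
  have R2': "x \<in> R" if "(x, y) \<in> ext (f\<inverse>) d c" "y \<in> R" for x y
    using that R1[of y x] unfolding ext_converse[symmetric] by blast
  have mono: "Domain f \<inter> R \<subseteq> Domain (ext f c d) \<inter> R"
    "Domain (f\<inverse>) \<inter> R \<subseteq> Domain (ext (f\<inverse>) d c) \<inter> R"
    using ext_extends[OF f c(1) d(1)] ext_extends[OF f' d(1) c(1)] by blast+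
  have "half (ext f c d)"
  proof (rule ext_half[OF f c(1) d(1) free_step_res[OF f c d r] free_step_vanish[OF f c d r]])
    show "(x, y) \<in> f \<or> c \<in> R \<and> d \<in> R \<and> (\<exists>w. x = shw N w c \<and> y = shw N w d)"
      if "(x, y) \<in> ext f c d" "x \<in> R" for x y
      using P[OF that(1) generate.incl[OF that(2)]] by blast
    show "x \<in> R" if "(x, y) \<in> ext f c d" "y \<in> R" for x y using R2 that by blast
    show "\<exists>n>0. x [^] (n::nat) \<in> generate G (Domain (ext f c d) \<inter> R)"
      if x: "x \<in> Domain (ext f c d)" "x \<in> generate G R" for x
    proof -
      have "x \<in> Domain f" using x P by blast
      then show ?thesis using good_free[OF f _ x(2)] mono_generate[OF mono(1)] by blast
    qed
  qed
  moreover have "half (ext (f\<inverse>) d c)"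
  proof (rule ext_half[OF f' d(1) c(1) free_step_res[OF f' d(1) d' c(1) c' r'] free_step_vanish[OF f' d(1) d' c(1) c' r']])
    show "(x, y) \<in> f\<inverse> \<or> d \<in> R \<and> c \<in> R \<and> (\<exists>w. x = shw N w d \<and> y = shw N w c)"
      if "(x, y) \<in> ext (f\<inverse>) d c" "x \<in> R" for x y
      using P'[OF that(1) generate.incl[OF that(2)]] by blast
    show "x \<in> R" if "(x, y) \<in> ext (f\<inverse>) d c" "y \<in> R" for x y using R2' that by blast
    show "\<exists>n>0. x [^] (n::nat) \<in> generate G (Domain (ext (f\<inverse>) d c) \<inter> R)"
      if x: "x \<in> Domain (ext (f\<inverse>) d c)" "x \<in> generate G R" for x
    proof -
      have "x \<in> Domain (f\<inverse>)" using x P' by blast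
      then show ?thesis using good_free[OF f' _ x(2)] mono_generate[OF mono(2)] by blast
    qed
  qed
  ultimately show ?thesis by (simp add: good_def ext_converse)
qed

end

section \<open>The formulas used for saturation arguments\<close>

primrec w_tm :: "word \<Rightarrow> rtm \<Rightarrow> rtm" where
  "w_tm [] t = t"
| "w_tm (b # w) t = (if b then S_tm (w_tm w t) else Sinv_tm (w_tm w t))"

definition lin_tm :: "lin \<Rightarrow> rtm" where
  "lin_tm l = sum_tm (map (\<lambda>(b, w, v). if b then w_tm w (Var v) else minus_tm (w_tm w (Var v))) l)"

definition one_var :: "lin \<Rightarrow> lin" where "one_var = map (\<lambda>(b, w, v). (b, w, 0))"

text \<open>The formula \<open>\<exists>y. n y = k + l\<close>, with all variables of the combination \<open>l\<close> identified. For
  \<open>n = 0\<close> and \<open>k = 0\<close> it is the equation \<open>l = 0\<close>.\<close>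

definition theta_fm :: "nat \<times> nat \<times> lin \<Rightarrow> rfm" where
  "theta_fm = (\<lambda>(n, k, l). Ex 1 (Eq (mult_tm (int n) (Var 1)) (plus_tm (mult_tm (int k) one_tm) (lin_tm (one_var l)))))"

text \<open>The formula says that \<open>n\<close> times variable 0 is the sum of variable 1 and of elements of \<open>R\<close>
  with the signs \<open>\<sigma>\<close>. Its negations, for all \<open>n\<close> and \<open>\<sigma>\<close>, express freeness.\<close>

definition dep_fm :: "nat \<Rightarrow> bool list \<Rightarrow> rfm" where
  "dep_fm n \<sigma> = Neg (foldr AllR [2..<2 + length \<sigma>] (Neg (Eq (mult_tm (int n) (Var 0))
     (plus_tm (Var 1) (lin_tm (map (\<lambda>i. (\<sigma> ! i, [], 2 + i)) [0..<length \<sigma>]))))))"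

lemma wf_w_tm: "wf_tm LR t \<Longrightarrow> wf_tm LR (w_tm w t)"
  by (induction w) auto

lemma tvars_w_tm [simp]: "tvars (w_tm w t) = tvars t"
  by (induction w) auto

lemma wf_lin_tm: "wf_tm LR (lin_tm l)"
  unfolding lin_tm_def by (rule wf_sum_tm) (auto intro!: wf_w_tm)

lemma tvars_lin_tm: "tvars (lin_tm l) = (\<lambda>(b, w, v). v) ` set l"
  by (induction l) (auto simp: lin_tm_def split: if_splits)

lemma wf_theta_fm: "wf_fm LR (theta_fm \<iota>)"
  by (auto simp: theta_fm_def wf_lin_tm intro!: wf_mult_tm split: prod.splits)

lemma wf_dep_fm: "wf_fm LR (dep_fm n \<sigma>)"
  by (auto simp: dep_fm_def wf_foldr_AllR wf_lin_tm intro!: wf_mult_tm)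

context R_model
begin

lemma teval_sum_replicate:
  "teval N e t \<in> carrier G \<Longrightarrow> teval N e (sum_tm (replicate n t)) = teval N e t [^] n"
proof (induction n)
  case (Suc n)
  then show ?case
    using nat_pow_Suc2[of "teval N e t" n] by (simp add: sum_tm_def Plus_eq)
qed (simp add: sum_tm_def Zero_eq)

lemma teval_mult_tm:
  "teval N e t \<in> carrier G \<Longrightarrow> teval N e (mult_tm (int n) t) = teval N e t [^] n"
  by (simp add: mult_tm_def teval_sum_replicate)

lemma teval_w_tm: "teval N e (w_tm w t) = shw N w (teval N e t)"
  by (induction w) auto

lemma teval_lin_tm:
  assumes "e ` lvars l \<subseteq> carrier G"
  shows "teval N e (lin_tm l) = lin e l"
  using assms
proof (induction l)
  case Nil
  then show ?case by (simp add: lin_tm_def lin_def sum_tm_def Zero_eq)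
next
  case (Cons p l)
  obtain b w v where p: "p = (b, w, v)" by (cases p)
  have "e v \<in> carrier G" "e ` lvars l \<subseteq> carrier G" using Cons.prems by (auto simp: lvars_def p)
  then show ?case using Cons.IH
    by (simp add: lin_tm_def lin_def sum_tm_def p Plus_eq teval_w_tm minus)
qed

definition Theta :: "nat \<times> nat \<times> lin \<Rightarrow> 'b \<Rightarrow> bool" where
  "Theta = (\<lambda>(n, k, l) x. dv n (u [^] k \<otimes> lin1 x l))"

lemma lin_one_var: "lin e (one_var l) = lin1 (e 0) l"
  by (auto simp: lin_def one_var_def comp_def split_beta intro!: arg_cong[of _ _ lc])

lemma sat_theta_fm:
  assumes "e 0 \<in> carrier G"
  shows "sat N e (theta_fm \<iota>) \<longleftrightarrow> Theta \<iota> (e 0)"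
proof -
  obtain n k l where i: "\<iota> = (n, k, l)" by (cases \<iota>)
  have "(\<exists>y\<in>univ N. teval N (e(1 := y)) (mult_tm (int n) (Var 1)) =
      teval N (e(1 := y)) (plus_tm (mult_tm (int k) one_tm) (lin_tm (one_var l)))) \<longleftrightarrow>
      (\<exists>y\<in>carrier G. y [^] n = u [^] k \<otimes> lin1 (e 0) l)"
  proof (intro bex_cong)
    fix y assume y: "y \<in> carrier G"
    have "(e(1 := y)) ` lvars (one_var l) \<subseteq> carrier G" using assms by (auto simp: lvars_def one_var_def)
    then have "teval N (e(1 := y)) (lin_tm (one_var l)) = lin1 (e 0) l"
      by (simp add: teval_lin_tm lin_one_var)
    then show "teval N (e(1 := y)) (mult_tm (int n) (Var 1)) =
      teval N (e(1 := y)) (plus_tm (mult_tm (int k) one_tm) (lin_tm (one_var l))) \<longleftrightarrow>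
      y [^] n = u [^] k \<otimes> lin1 (e 0) l"
      using y by (simp add: teval_mult_tm Plus_eq)
  qed (simp add: carrier_eq)
  then show ?thesis by (simp add: i theta_fm_def Theta_def dv_def)
qed

lemma lin_zip:
  assumes "length zs = length \<sigma>" "\<And>i. i < length \<sigma> \<Longrightarrow> e (a + i) = zs ! i"
  shows "lin e (map (\<lambda>i. (\<sigma> ! i, [], a + i)) [0..<length \<sigma>]) = lc (zip \<sigma> zs)"
proof -
  have "map (\<lambda>(b, w, v). (b, shw N w (e v))) (map (\<lambda>i. (\<sigma> ! i, [], a + i)) [0..<length \<sigma>]) = zip \<sigma> zs"
    using assms by (intro nth_equalityI) auto
  then show ?thesis by (simp only: lin_def)
qed

lemma sat_dep_fm:
  assumes "e 0 \<in> carrier G" "e 1 \<in> carrier G"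
  shows "sat N e (dep_fm n \<sigma>) \<longleftrightarrow>
    (\<exists>zs. length zs = length \<sigma> \<and> set zs \<subseteq> R \<and> e 0 [^] n = e 1 \<otimes> lc (zip \<sigma> zs))"
proof -
  let ?l = "map (\<lambda>i. (\<sigma> ! i, [], 2 + i)) [0..<length \<sigma>]"
  have "sat N (\<lambda>v. if 2 \<le> v \<and> v < 2 + length \<sigma> then zs ! (v - 2) else e v)
     (Eq (mult_tm (int n) (Var 0)) (plus_tm (Var 1) (lin_tm ?l))) \<longleftrightarrow> e 0 [^] n = e 1 \<otimes> lc (zip \<sigma> zs)"
    if zs: "length zs = length \<sigma>" "set zs \<subseteq> R" for zs
  proof -
    let ?e = "\<lambda>v. if 2 \<le> v \<and> v < 2 + length \<sigma> then zs ! (v - 2) else e v"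
    have "?e ` lvars ?l \<subseteq> carrier G"
      using zs R_carrier by (auto simp: lvars_def subset_iff)
    then have "teval N ?e (lin_tm ?l) = lin ?e ?l" by (rule teval_lin_tm)
    also have "\<dots> = lc (zip \<sigma> zs)" by (rule lin_zip) (use zs in auto)
    finally have "teval N ?e (lin_tm ?l) = lc (zip \<sigma> zs)" .
    then show ?thesis using assms by (simp add: teval_mult_tm Plus_eq)
  qed
  then show ?thesis unfolding dep_fm_def sat.simps(1,4) sat_AllR_block by blast
qed

lemma generate_R_lc: "z \<in> generate G R \<longleftrightarrow> (\<exists>\<sigma> zs. length zs = length \<sigma> \<and> set zs \<subseteq> R \<and> z = lc (zip \<sigma> zs))"
  unfolding generate_lc[OF R_carrier]
proof
  assume "\<exists>l. snd ` set l \<subseteq> R \<and> z = lc l"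
  then obtain l where "snd ` set l \<subseteq> R" "z = lc l" by blast
  then show "\<exists>\<sigma> zs. length zs = length \<sigma> \<and> set zs \<subseteq> R \<and> z = lc (zip \<sigma> zs)"
    by (intro exI[of _ "map fst l"] exI[of _ "map snd l"]) (simp add: zip_map_fst_snd)
next
  assume "\<exists>\<sigma> zs. length zs = length \<sigma> \<and> set zs \<subseteq> R \<and> z = lc (zip \<sigma> zs)"
  then obtain \<sigma> zs where "length zs = length \<sigma>" "set zs \<subseteq> R" "z = lc (zip \<sigma> zs)" by blast
  then show "\<exists>l. snd ` set l \<subseteq> R \<and> z = lc l"
    by (intro exI[of _ "zip \<sigma> zs"]) (auto dest: set_zip_rightD)
qed

text \<open>Elements of \<open>R\<close> that finitely many of the formulas \<open>Theta\<close> show to be algebraic. An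
  element of \<open>R\<close> that is not thin has infinitely many companions in \<open>R\<close> for each finite set of
  these formulas; thin elements, of which there are countably many, are simply put into all
  domains.\<close>

definition thin :: "'b \<Rightarrow> bool" where
  "thin c \<longleftrightarrow> (\<exists>T. finite T \<and> finite {d \<in> R. \<forall>\<iota>\<in>T. Theta \<iota> d \<longleftrightarrow> Theta \<iota> c})"

text \<open>The successor is injective on \<open>R\<close> but misses \<open>c\<close>.\<close>

lemma infinite_R: "infinite R"
proof
  assume fin: "finite R"
  have "inj_on (\<lambda>x. S x) R" by (rule inj_onI) (metis S'S)
  then have "(\<lambda>x. S x) ` R = R" using fin S_R by (intro endo_inj_surj) auto
  then have "c0 \<in> (\<lambda>x. S x) ` R" using cst_R by simp
  then obtain x where "x \<in> R" "c0 = S x" by (rule imageE)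
  then show False using S_cst[of x] by simp
qed

lemma same_Theta:
  assumes "c \<in> carrier G" "d \<in> carrier G" and same: "\<And>\<iota>. Theta \<iota> c \<longleftrightarrow> Theta \<iota> d"
  shows "res (lin1 c l) (lin1 d l)" "lin1 c l = \<one> \<longleftrightarrow> lin1 d l = \<one>"
proof -
  show "res (lin1 c l) (lin1 d l)"
    unfolding res_def using same[of "(_, _, l)"] by (auto simp: Theta_def)
  show "lin1 c l = \<one> \<longleftrightarrow> lin1 d l = \<one>"
    using same[of "(0, 0, l)"] assms by (simp add: Theta_def)
qed

text \<open>By torsion freeness, division by \<open>n\<close> is unique.\<close>

lemma countable_ext:
  assumes "countable f" "good f" "c \<in> carrier G" "d \<in> carrier G"
  shows "countable (ext f c d)"
proof -
  let ?q = "\<lambda>(n::nat) z. THE x. x \<in> carrier G \<and> x [^] n = z"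
  have q: "?q n (x [^] n) = x" if "n > 0" "x \<in> carrier G" for n x
    using that pow_inj by (intro the_equality) auto
  have "ext f c d \<subseteq> (\<lambda>(n, (x, y), l). (?q n (x \<otimes> lin1 c l), ?q n (y \<otimes> lin1 d l))) ` (UNIV \<times> f \<times> UNIV)"
  proof
    fix p assume "p \<in> ext f c d"
    then obtain x' y' n x y l where p: "p = (x', y')" "x' \<in> carrier G" "y' \<in> carrier G" "n > 0" "(x, y) \<in> f"
      "x' [^] (n::nat) = x \<otimes> lin1 c l" "y' [^] n = y \<otimes> lin1 d l"
      unfolding ext_def by blast
    then have "p = (\<lambda>(n, (x, y), l). (?q n (x \<otimes> lin1 c l), ?q n (y \<otimes> lin1 d l))) (n, (x, y), l)"
      using q[OF p(4,2)] q[OF p(4,3)] by simp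
    then show "p \<in> (\<lambda>(n, (x, y), l). (?q n (x \<otimes> lin1 c l), ?q n (y \<otimes> lin1 d l))) ` (UNIV \<times> f \<times> UNIV)"
      using p(5) by blast
  qed
  then show ?thesis by (rule countable_subset) (use assms in auto)
qed

end

section \<open>Back and forth in an ultrapower\<close>

locale ultra_model =
  fixes r :: "nat \<Rightarrow> nat" and E :: "int poly list \<Rightarrow> int list set"
    and M :: "(fsym, psym, 'a) struct" and W :: "nat filter"
  assumes core: "is_model LR (core_axioms r E) M" and isE: "is_E r E"
    and W: "ultra W" "W \<le> sequentially"
begin

definition N :: "(fsym, psym, nat \<Rightarrow> 'a) struct" where "N = upow W M"

lemma M_struct: "is_struct LR M"
  using core by (simp add: is_model_def)

lemma los_N: "wf_fm LR \<phi> \<Longrightarrow> (\<And>v. v \<in> fv \<phi> \<Longrightarrow> e v \<in> univ N) \<Longrightarrow>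
  sat N e \<phi> \<longleftrightarrow> (\<forall>\<^sub>F k in W. sat M (\<lambda>v. e v k) \<phi>)"
  unfolding N_def by (rule los[OF W(1) M_struct])

lemma N_core: "is_model LR (core_axioms r E) N"
  unfolding is_model_def
proof (intro conjI ballI allI impI)
  show "is_struct LR N" unfolding N_def by (rule upow_is_struct[OF M_struct])
  fix \<phi> and e :: "nat \<Rightarrow> nat \<Rightarrow> 'a" assume p: "\<phi> \<in> core_axioms r E" and e: "range e \<subseteq> univ N"
  have "sat M (\<lambda>v. e v k) \<phi>" for k
  proof -
    have "range (\<lambda>v. e v k) \<subseteq> univ M" using e univ_upow_range unfolding N_def by blast
    then show ?thesis using core p by (simp add: is_model_def)
  qed
  then show "sat N e \<phi>" using e by (subst los_N[OF wf_core_axioms[OF p]]) auto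
qed

sublocale M: R_model "grp M" M
  by (rule model_R_model[OF core isE])

sublocale N: R_model "grp N" N
  by (rule model_R_model[OF N_core isE])

lemma N_mem_range: "x \<in> univ N \<Longrightarrow> x k \<in> univ M"
  unfolding N_def by (rule univ_upow_range)

lemma N_eq_iff: "x \<in> univ N \<Longrightarrow> y \<in> univ N \<Longrightarrow> x = y \<longleftrightarrow> (\<forall>\<^sub>F k in W. x k = y k)"
  unfolding N_def by (rule upow_eq_iff)

lemma N_R: "x \<in> univ N \<Longrightarrow> x \<in> N.R \<longleftrightarrow> (\<forall>\<^sub>F k in W. x k \<in> M.R)"
  using N_mem_range[of x] by (simp add: Rel_R_def) (simp add: N_def upow_def)

lemma N_Theta: "x \<in> univ N \<Longrightarrow> N.Theta \<iota> x \<longleftrightarrow> (\<forall>\<^sub>F k in W. M.Theta \<iota> (x k))"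
proof -
  assume x: "x \<in> univ N"
  have "N.Theta \<iota> x \<longleftrightarrow> sat N (\<lambda>_. x) (theta_fm \<iota>)" using x by (simp add: N.sat_theta_fm)
  also have "\<dots> \<longleftrightarrow> (\<forall>\<^sub>F k in W. sat M (\<lambda>_. x k) (theta_fm \<iota>))" using x by (intro los_N wf_theta_fm)
  also have "\<dots> \<longleftrightarrow> (\<forall>\<^sub>F k in W. M.Theta \<iota> (x k))" using N_mem_range[OF x] by (simp add: M.sat_theta_fm)
  finally show ?thesis .
qed

text \<open>Membership in an internal predicate is decided at almost all places; the predicates
  involved are not required to be definable. Countable saturation holds for all of them, so
  finite conjunctions of simple conditions need not be turned into formulas.\<close>

definition internal :: "((nat \<Rightarrow> 'a) \<Rightarrow> bool) \<Rightarrow> bool" where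
  "internal P \<longleftrightarrow> (\<exists>Q. \<forall>d\<in>univ N. P d \<longleftrightarrow> (\<forall>\<^sub>F k in W. Q k (d k)))"

lemma internal_R: "internal (\<lambda>d. d \<in> N.R)"
  unfolding internal_def using N_R by (intro exI[of _ "\<lambda>_ x. x \<in> M.R"]) blast

lemma internal_Theta: "internal (N.Theta \<iota>)"
  unfolding internal_def using N_Theta by (intro exI[of _ "\<lambda>_. M.Theta \<iota>"]) blast

lemma internal_eq: "h \<in> univ N \<Longrightarrow> internal (\<lambda>d. d = h)"
  unfolding internal_def using N_eq_iff by (intro exI[of _ "\<lambda>k x. x = h k"]) blast

lemma internal_not: "internal P \<Longrightarrow> internal (\<lambda>d. \<not> P d)"
proof -
  assume "internal P"
  then obtain Q where "\<forall>d\<in>univ N. P d \<longleftrightarrow> (\<forall>\<^sub>F k in W. Q k (d k))" unfolding internal_def by blast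
  then show ?thesis unfolding internal_def
    by (intro exI[of _ "\<lambda>k x. \<not> Q k x"]) (simp add: ultra_not[OF W(1)])
qed

lemma internal_conj: "internal P \<Longrightarrow> internal P' \<Longrightarrow> internal (\<lambda>d. P d \<and> P' d)"
proof -
  assume "internal P" "internal P'"
  then obtain Q Q' where "\<forall>d\<in>univ N. P d \<longleftrightarrow> (\<forall>\<^sub>F k in W. Q k (d k))"
    "\<forall>d\<in>univ N. P' d \<longleftrightarrow> (\<forall>\<^sub>F k in W. Q' k (d k))" unfolding internal_def by blast
  then show ?thesis unfolding internal_def
    by (intro exI[of _ "\<lambda>k x. Q k x \<and> Q' k x"]) (simp add: eventually_conj_iff)
qed

lemma internal_iff: "internal P \<Longrightarrow> internal (\<lambda>d. b \<longleftrightarrow> P d)"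
  by (cases b) (simp_all add: internal_not)

lemma internal_sat:
  assumes "wf_fm LR \<phi>" "h \<in> univ N"
  shows "internal (\<lambda>d. sat N ((\<lambda>_. h)(0 := d)) \<phi>)"
  unfolding internal_def
proof (intro exI ballI)
  fix d assume d: "d \<in> univ N"
  have "sat N ((\<lambda>_. h)(0 := d)) \<phi> \<longleftrightarrow> (\<forall>\<^sub>F k in W. sat M (\<lambda>v. ((\<lambda>_. h)(0 := d)) v k) \<phi>)"
    using assms d by (intro los_N) auto
  also have "\<dots> \<longleftrightarrow> (\<forall>\<^sub>F k in W. sat M ((\<lambda>_. h k)(0 := d k)) \<phi>)"
    by (intro arg_cong[where f = "\<lambda>P. eventually P W"] ext arg_cong[where f = "\<lambda>e. sat M e \<phi>"]) auto
  finally show "sat N ((\<lambda>_. h)(0 := d)) \<phi> \<longleftrightarrow> (\<forall>\<^sub>F k in W. sat M ((\<lambda>_. h k)(0 := d k)) \<phi>)" .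
qed

lemma N_saturated:
  assumes P: "\<And>i :: nat. internal (P i)" and fs: "\<And>j. \<exists>d\<in>univ N. \<forall>i\<le>j. P i d"
  shows "\<exists>d\<in>univ N. \<forall>i. P i d"
proof -
  have "\<forall>i. \<exists>Q. \<forall>d\<in>univ N. P i d \<longleftrightarrow> (\<forall>\<^sub>F k in W. Q k (d k))"
    using P unfolding internal_def by blast
  from choice[OF this] obtain Q where Q: "\<And>i d. d \<in> univ N \<Longrightarrow> P i d \<longleftrightarrow> (\<forall>\<^sub>F k in W. Q i k (d k))"
    by blast
  have "\<exists>d\<in>univ N. \<forall>i\<le>j. \<forall>\<^sub>F k in W. Q i k (d k)" for j
    using fs[of j] Q by auto
  then have "\<exists>d\<in>univ N. \<forall>i. \<forall>\<^sub>F k in W. Q i k (d k)"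
    unfolding N_def by (rule upow_saturated[OF W])
  then show ?thesis using Q by auto
qed

text \<open>Given finitely many formulas \<open>Theta\<close> and finitely many elements to avoid, infinitely many
  elements of \<open>R\<close> are candidates, because \<open>c\<close> is not thin.\<close>

lemma realize_R:
  assumes c: "c \<in> N.R" "\<not> N.thin c" and H: "countable H" "H \<subseteq> univ N" "H \<noteq> {}"
  shows "\<exists>d\<in>N.R - H. \<forall>\<iota>. N.Theta \<iota> c \<longleftrightarrow> N.Theta \<iota> d"
proof -
  define h where "h = from_nat_into H"
  have h: "range h = H" using H by (simp add: h_def)
  define P where "P i d \<longleftrightarrow> d \<in> N.R \<and> (N.Theta (from_nat i) c \<longleftrightarrow> N.Theta (from_nat i) d) \<and> \<not> d = h i" for i d
  have "\<exists>d\<in>univ N. \<forall>i. P i d"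
  proof (rule N_saturated)
    have "h i \<in> univ N" for i using h H(2) by blast
    then show "internal (P i)" for i
      unfolding P_def by (intro internal_conj internal_R internal_iff internal_Theta internal_not internal_eq)
    fix j
    have "infinite {d \<in> N.R. \<forall>\<iota>\<in>from_nat ` {..j}. N.Theta \<iota> d \<longleftrightarrow> N.Theta \<iota> c}"
      using c(2) unfolding N.thin_def by blast
    then have "{d \<in> N.R. \<forall>\<iota>\<in>from_nat ` {..j}. N.Theta \<iota> d \<longleftrightarrow> N.Theta \<iota> c} - h ` {..j} \<noteq> {}"
      using Diff_infinite_finite[of "h ` {..j}"] infinite_imp_nonempty by blast
    then obtain d where d: "d \<in> N.R" "\<And>i. i \<le> j \<Longrightarrow> N.Theta (from_nat i) d \<longleftrightarrow> N.Theta (from_nat i) c"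
      "\<And>i. i \<le> j \<Longrightarrow> d \<noteq> h i" by auto
    then show "\<exists>d\<in>univ N. \<forall>i\<le>j. P i d"
      unfolding P_def by (intro bexI[of _ d]) (auto simp: Rel_R_def)
  qed
  then obtain d where d: "\<And>i. P i d" by blast
  have "d \<notin> H" using d h unfolding P_def by blast
  moreover have "N.Theta \<iota> c \<longleftrightarrow> N.Theta \<iota> d" for \<iota> using d[of "to_nat \<iota>"] by (simp add: P_def)
  ultimately show ?thesis using d by (auto simp: P_def)
qed

lemma R_uncountable: "uncountable N.R"
proof (rule notI)
  assume cR: "countable N.R"
  define h where "h = from_nat_into N.R"
  have h: "range h = N.R" unfolding h_def using cR N.cst_R by (intro range_from_nat_into) auto
  have "\<exists>d\<in>univ N. \<forall>i. d \<in> N.R \<and> \<not> d = h i"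
  proof (rule N_saturated)
    have "h i \<in> univ N" for i using h by (auto simp: Rel_R_def)
    then show "internal (\<lambda>d. d \<in> N.R \<and> \<not> d = h i)" for i
      by (intro internal_conj internal_R internal_not internal_eq)
    show "\<exists>d\<in>univ N. \<forall>i\<le>j. d \<in> N.R \<and> \<not> d = h i" for j
    proof -
      have "N.R - h ` {..j} \<noteq> {}"
        using Diff_infinite_finite[OF _ N.infinite_R] infinite_imp_nonempty by blast
      then obtain d where "d \<in> N.R" "d \<notin> h ` {..j}" by blast
      then show ?thesis by (intro bexI[of _ d]) (auto simp: Rel_R_def)
    qed
  qed
  then show False using h by blast
qed

text \<open>Orbits are countable, whereas \<open>R\<close> is uncountable by saturation.\<close>

lemma inequivalent_sequence:
  "\<exists>w :: nat \<Rightarrow> nat \<Rightarrow> 'a. (\<forall>i. w i \<in> N.R \<and> w i \<noteq> \<one>\<^bsub>grp N\<^esub>) \<and> (\<forall>i j. N.eqv (w i) (w j) \<longrightarrow> i = j)"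
proof -
  let ?A = "N.orb ` (N.R - {\<one>\<^bsub>grp N\<^esub>})"
  have ctb: "countable (N.orb x)" for x
  proof -
    have "N.orb x \<subseteq> range (\<lambda>w. shw N w x)"
    proof
      fix y assume "y \<in> N.orb x"
      then obtain w where "y = shw N w x" unfolding N.orb_def using N.eqv_imp_shw by blast
      then show "y \<in> range (\<lambda>w. shw N w x)" by blast
    qed
    then show ?thesis by (rule countable_subset) simp
  qed
  have "N.R - {\<one>\<^bsub>grp N\<^esub>} \<subseteq> \<Union> ?A" using N.orb_self by blast
  moreover have "uncountable (N.R - {\<one>\<^bsub>grp N\<^esub>})" using R_uncountable by (simp add: uncountable_minus_countable)
  ultimately have "\<not> countable (\<Union> ?A)" using countable_subset by blast
  have "infinite ?A"
  proof
    assume "finite ?A"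
    then have "countable ?A" by (rule countable_finite)
    then have "countable (\<Union>X\<in>?A. X)" by (rule countable_UN) (use ctb in blast)
    then show False using \<open>\<not> countable (\<Union> ?A)\<close> unfolding image_ident by blast
  qed
  then obtain Os :: "nat \<Rightarrow> _" where Os: "inj Os" "range Os \<subseteq> ?A" using infinite_countable_subset by blast
  then have "\<forall>i. \<exists>x. x \<in> N.R \<and> x \<noteq> \<one>\<^bsub>grp N\<^esub> \<and> Os i = N.orb x" by blast
  then obtain w where w: "\<And>i. w i \<in> N.R \<and> w i \<noteq> \<one>\<^bsub>grp N\<^esub> \<and> Os i = N.orb (w i)" by metis
  have "i = j" if "N.eqv (w i) (w j)" for i j
  proof -
    have "N.orb (w i) = N.orb (w j)" unfolding N.orb_def using that N.eqv_trans N.eqv_sym by blast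
    then show ?thesis using w Os(1) by (metis injD)
  qed
  then show ?thesis using w by blast
qed

end

context R_model
begin

lemma finprod_in_subgroup:
  assumes "subgroup P G" "finite B" "\<And>b. b \<in> B \<Longrightarrow> w b \<in> P"
  shows "finprod G w B \<in> P"
  using assms(2,3)
proof (induction B rule: finite_induct)
  case empty
  show ?case using subgroup.one_closed[OF assms(1)] by simp
next
  case (insert b B)
  have "w b \<in> carrier G" "w \<in> B \<rightarrow> carrier G"
    using insert.prems subgroup.mem_carrier[OF assms(1)] by auto
  then have "finprod G w (insert b B) = w b \<otimes> finprod G w B" using insert.hyps by simp
  moreover have "w b \<otimes> finprod G w B \<in> P"
    using insert by (intro subgroup.m_closed[OF assms(1)]) auto
  ultimately show ?case by simp
qed

lemma lc_zip_generate:
  assumes "set zs \<subseteq> X" "X \<subseteq> R" "length zs = length \<sigma>"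
  shows "lc (zip \<sigma> zs) \<in> generate G X"
proof -
  have "X \<subseteq> carrier G" using assms R_carrier by auto
  moreover have "snd ` set (zip \<sigma> zs) \<subseteq> X" using assms by (auto dest: set_zip_rightD)
  ultimately show ?thesis using generate_lc by blast
qed

text \<open>The elements that are \<open>h\<close> plus at most \<open>s\<close> elements of \<open>R\<close>, up to signs and a factor, are
  sparse. Let \<open>V j\<close> be the sum of the \<open>j\<close>-th block of \<open>2 s + 1\<close> pairwise inequivalent elements
  of \<open>R\<close>. If each \<open>c + K V j\<close> satisfied one of the finitely many equations, two blocks would
  satisfy the same one, and subtracting would express a multiple of \<open>V i - V j\<close> by at most \<open>2 s\<close>
  elements of \<open>R\<close>. Some member of the first block is equivalent to none of these, and to no
  other member of the two blocks, which contradicts independence of orbits.\<close>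

lemma sparse:
  fixes w :: "nat \<Rightarrow> 'b" and D0 :: "(nat \<times> bool list \<times> 'b) set"
  assumes w: "\<And>i. w i \<in> R" "\<And>i. w i \<noteq> \<one>" "\<And>i j. eqv (w i) (w j) \<Longrightarrow> i = j"
    and c: "c \<in> carrier G" and D0: "finite D0" "\<And>n \<sigma> h. (n, \<sigma>, h) \<in> D0 \<Longrightarrow> n > 0 \<and> h \<in> carrier G"
    and K: "K > (0::nat)"
  shows "\<exists>V\<in>carrier G. \<forall>(n, \<sigma>, h)\<in>D0. \<forall>zs. length zs = length \<sigma> \<longrightarrow> set zs \<subseteq> R \<longrightarrow>
    (c \<otimes> V [^] K) [^] n \<noteq> h \<otimes> lc (zip \<sigma> zs)"
proof (rule ccontr)
  assume contra: "\<not> ?thesis"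
  define s where "s = Max (insert 0 ((\<lambda>(n, \<sigma>, h). length \<sigma>) ` D0))"
  define q where "q = 2 * s + 1"
  define B where "B j = {j * q..<j * q + q}" for j
  define V where "V j = finprod G w (B j)" for j
  have wc: "w i \<in> carrier G" for i using w(1) by blast
  have Vc: "V j \<in> carrier G" for j unfolding V_def using wc by (intro finprod_closed) auto
  have s: "length \<sigma> \<le> s" if "(n, \<sigma>, h) \<in> D0" for n \<sigma> h
    unfolding s_def using D0(1) that by (intro Max_ge) force+
  have "\<forall>j. \<exists>n \<sigma> h zs. (n, \<sigma>, h) \<in> D0 \<and> length zs = length \<sigma> \<and> set zs \<subseteq> R \<and>
     (c \<otimes> V j [^] K) [^] n = h \<otimes> lc (zip \<sigma> zs)"
    using contra Vc by fastforce
  then obtain n \<sigma> h zs where t: "\<And>j. (n j, \<sigma> j, h j) \<in> D0 \<and> length (zs j) = length (\<sigma> j) \<and> set (zs j) \<subseteq> R \<and>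
     (c \<otimes> V j [^] K) [^] (n j :: nat) = h j \<otimes> lc (zip (\<sigma> j) (zs j))"
    by metis
  \<comment> \<open>Infinitely many blocks, but finitely many equations: two blocks share one.\<close>
  have "\<not> inj (\<lambda>j. (n j, \<sigma> j, h j))"
  proof
    assume i: "inj (\<lambda>j. (n j, \<sigma> j, h j))"
    have "finite (range (\<lambda>j. (n j, \<sigma> j, h j)))" by (rule finite_subset[OF _ D0(1)]) (use t in auto)
    then show False using finite_imageD[OF _ i] infinite_UNIV_nat by blast
  qed
  then obtain i j where ij: "i \<noteq> j" "n i = n j" "\<sigma> i = \<sigma> j" "h i = h j" unfolding inj_def by blast
  define Z where "Z = set (zs i) \<union> set (zs j)"
  have ZR: "Z \<subseteq> R" using t unfolding Z_def by blast
  have cs: "card (set (zs k)) \<le> s" for k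
    using card_length[of "zs k"] s[of "n k" "\<sigma> k" "h k"] t[of k] by simp
  have "card Z \<le> card (set (zs i)) + card (set (zs j))" unfolding Z_def by (rule card_Un_le)
  also have "\<dots> \<le> s + s" by (intro add_mono cs)
  finally have cZ: "card Z < q" by (simp add: q_def)
  \<comment> \<open>A block has \<open>2 s + 1\<close> members, in different orbits, and \<open>Z\<close> has at most \<open>2 s\<close> elements.\<close>
  have "\<exists>a\<in>B i. \<forall>y\<in>Z. \<not> eqv (w a) y"
  proof (rule ccontr)
    assume "\<not> ?thesis"
    then obtain y where y: "\<And>a. a \<in> B i \<Longrightarrow> y a \<in> Z \<and> eqv (w a) (y a)" by metis
    have "inj_on y (B i)"
    proof (rule inj_onI)
      fix a b assume "a \<in> B i" "b \<in> B i" "y a = y b"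
      then have "eqv (w a) (w b)" using y eqv_sym eqv_trans by metis
      then show "a = b" by (rule w(3))
    qed
    then have "card (B i) \<le> card Z" using y by (intro card_inj_on_le) (auto simp: Z_def)
    then show False using cZ by (simp add: B_def)
  qed
  then obtain a where a: "a \<in> B i" "\<And>y. y \<in> Z \<Longrightarrow> \<not> eqv (w a) y" by blast
  define P where "P = generate G (R - orb (w a))"
  have sP: "subgroup P G" unfolding P_def using R_carrier by (intro generate_closed) auto
  note Pm = subgroup.m_closed[OF sP] and Pi = subgroup.m_inv_closed[OF sP] and Pc = subgroup.mem_carrier[OF sP]
  have wP: "w b \<in> P" if "b \<noteq> a" for b
    unfolding P_def using w(1) w(3)[of a b] that by (intro generate.incl) (auto simp: orb_def)
  have "a \<notin> B j"
  proof
    assume "a \<in> B j"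
    then have "a div q = j" "a div q = i" using a(1)
      by (auto simp: B_def intro!: div_nat_eqI simp: algebra_simps)
    then show False using ij by simp
  qed
  then have VjP: "V j \<in> P" unfolding V_def using wP by (intro finprod_in_subgroup[OF sP]) (auto simp: B_def)
  define Q where "Q = finprod G w (B i - {a})"
  have QP: "Q \<in> P" unfolding Q_def using wP by (intro finprod_in_subgroup[OF sP]) (auto simp: B_def)
  have "V i = finprod G w (insert a (B i - {a}))" unfolding V_def using a(1) by (simp add: insert_absorb)
  also have "\<dots> = w a \<otimes> Q" unfolding Q_def using wc by (intro finprod_insert) (auto simp: B_def)
  finally have Vi: "V i = w a \<otimes> Q" .
  define z where "z k = lc (zip (\<sigma> i) (zs k))" for k
  have ZP: "Z \<subseteq> R - orb (w a)" using ZR a(2) by (auto simp: orb_def)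
  have zP: "z i \<in> P" "z j \<in> P" unfolding z_def P_def using t[of i] t[of j] ij ZP
    by (auto intro!: lc_zip_generate simp: Z_def)
  let ?m = "K * n i"
  have hc: "h i \<in> carrier G" "n i > 0" using D0(2) t[of i] by blast+
  have cV: "(c \<otimes> V k [^] K) [^] n i = c [^] n i \<otimes> V k [^] ?m" for k
    using c Vc by (simp add: nat_pow_distrib nat_pow_pow)
  have ei: "c [^] n i \<otimes> V i [^] ?m = h i \<otimes> z i" using t[of i] cV[of i] by (simp add: z_def)
  have ej: "c [^] n i \<otimes> V j [^] ?m = h i \<otimes> z j" using t[of j] cV[of j] ij by (simp add: z_def)
  have zc: "z i \<in> carrier G" "z j \<in> carrier G" using zP Pc by auto
  have canc: "(x \<otimes> y) \<otimes> inv (x \<otimes> y') = y \<otimes> inv y'"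
    if "x \<in> carrier G" "y \<in> carrier G" "y' \<in> carrier G" for x y y'
  proof -
    have "(x \<otimes> y) \<otimes> inv (x \<otimes> y') = (x \<otimes> inv x) \<otimes> (y \<otimes> inv y')"
      using that by (simp only: inv_mult m_ac m_closed inv_closed)
    then show ?thesis using that by simp
  qed
  have "(c [^] n i \<otimes> V i [^] ?m) \<otimes> inv (c [^] n i \<otimes> V j [^] ?m) = (h i \<otimes> z i) \<otimes> inv (h i \<otimes> z j)"
    unfolding ei ej ..
  then have "V i [^] ?m \<otimes> inv (V j [^] ?m) = z i \<otimes> inv (z j)"
    using c Vc hc zc by (simp only: canc nat_pow_closed)
  then have "V i [^] ?m \<otimes> inv (V j [^] ?m) \<in> P" using zP Pm Pi by simp
  then have "V i [^] ?m \<otimes> inv (V j [^] ?m) \<otimes> V j [^] ?m \<in> P"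
    using Pm subgroup_pow[OF sP VjP, of ?m] by blast
  then have "V i [^] ?m \<in> P" using Vc by (simp add: m_assoc)
  then have "w a [^] ?m \<otimes> Q [^] ?m \<in> P" unfolding Vi using wc Pc[OF QP] by (simp add: nat_pow_distrib)
  then have "(w a [^] ?m \<otimes> Q [^] ?m) \<otimes> inv (Q [^] ?m) \<in> P"
    using Pm Pi subgroup_pow[OF sP QP, of ?m] by blast
  then have 1: "w a [^] ?m \<in> P" using wc Pc[OF QP] by (simp add: m_assoc)
  have "w a [^] ?m \<in> generate G (orb (w a))"
    using orb_self[OF w(1)] R_carrier by (intro subgroup_pow generate_closed generate.incl) (auto simp: orb_def)
  then have "w a [^] ?m = \<one>"
    using 1 unfolding P_def by (intro orbits_independent[OF orbit_closed_orb, of "R - orb (w a)"]) auto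
  then show False using torsion_free[OF wc, of ?m a] w(2) K hc(2) by simp
qed

lemma Theta_residue: "x \<in> carrier G \<Longrightarrow> Theta (n, k, [(True, [], 0)]) x \<longleftrightarrow> dv n (u [^] k \<otimes> x)"
  by (simp add: Theta_def lin_def)

end

context ultra_model
begin

lemma N_dep: "d \<in> univ N \<Longrightarrow> h \<in> univ N \<Longrightarrow> sat N ((\<lambda>_. h)(0 := d)) (dep_fm n \<sigma>) \<longleftrightarrow>
    (\<exists>zs. length zs = length \<sigma> \<and> set zs \<subseteq> N.R \<and> d [^]\<^bsub>grp N\<^esub> n = h \<otimes>\<^bsub>grp N\<^esub> N.lc (zip \<sigma> zs))"
  using N.sat_dep_fm[of "(\<lambda>_. h)(0 := d)" n \<sigma>] by simp

text \<open>The conditions for \<open>d\<close> are its residues and the negations of the formulas \<open>dep_fm\<close> with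
  parameters from \<open>H\<close>. Finitely many of them are satisfied by \<open>c + K V\<close> for a product \<open>K\<close> of the
  moduli involved and \<open>V\<close> as in \<open>sparse\<close>.\<close>

lemma realize_free:
  assumes c: "c \<in> univ N" and H: "countable H" "H \<subseteq> univ N" "H \<noteq> {}"
  shows "\<exists>d\<in>univ N. N.res c d \<and> N.free_over d H"
proof -
  define h where "h = from_nat_into H"
  have h: "range h = H" using H by (simp add: h_def)
  have hU: "h i \<in> univ N" for i using h H(2) by blast
  \<comment> \<open>One enumeration of all moduli, shifts, factors, lists of signs and parameters.\<close>
  define q :: "nat \<Rightarrow> (nat \<times> nat) \<times> nat \<times> bool list \<times> nat" where "q = from_nat"
  define n k m \<sigma> g where "n i = Suc (fst (fst (q i)))" and "k i = snd (fst (q i))" and "m i = Suc (fst (snd (q i)))"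
    and "\<sigma> i = fst (snd (snd (q i)))" and "g i = h (snd (snd (snd (q i))))" for i
  define \<iota> :: "nat \<Rightarrow> nat \<times> nat \<times> lin" where "\<iota> i = (n i, k i, [(True, [], 0)])" for i
  define P where "P i d \<longleftrightarrow> (N.Theta (\<iota> i) c \<longleftrightarrow> N.Theta (\<iota> i) d) \<and> \<not> sat N ((\<lambda>_. g i)(0 := d)) (dep_fm (m i) (\<sigma> i))" for i d
  have gU: "g i \<in> univ N" for i using hU by (simp add: g_def)
  have cc: "c \<in> carrier (grp N)" using c by simp
  obtain w :: "nat \<Rightarrow> nat \<Rightarrow> 'a" where w0: "\<forall>i. w i \<in> N.R \<and> w i \<noteq> \<one>\<^bsub>grp N\<^esub>"
      "\<forall>i j. N.eqv (w i) (w j) \<longrightarrow> i = j"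
    using inequivalent_sequence by (elim exE conjE)
  have w: "w i \<in> N.R" "w i \<noteq> \<one>\<^bsub>grp N\<^esub>" "N.eqv (w i) (w j) \<Longrightarrow> i = j" for i j
    using w0(1)[THEN spec, of i] w0(2)[THEN spec, THEN spec, of i j] by simp_all
  have "\<exists>d\<in>univ N. \<forall>i. P i d"
  proof (rule N_saturated)
    show "internal (P i)" for i
      unfolding P_def by (intro internal_conj internal_iff internal_Theta internal_not internal_sat wf_dep_fm gU)
    fix j
    define K where "K = (\<Prod>i\<le>j. n i)"
    have K: "K > 0" unfolding K_def by (intro prod_pos) (simp add: n_def)
    let ?D = "(\<lambda>i. (m i, \<sigma> i, g i)) ` {..j}"
    have "\<exists>V\<in>carrier (grp N). \<forall>(n, \<sigma>, h)\<in>?D. \<forall>zs. length zs = length \<sigma> \<longrightarrow> set zs \<subseteq> N.R \<longrightarrow>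
        (c \<otimes>\<^bsub>grp N\<^esub> V [^]\<^bsub>grp N\<^esub> K) [^]\<^bsub>grp N\<^esub> n \<noteq> h \<otimes>\<^bsub>grp N\<^esub> N.lc (zip \<sigma> zs)"
      by (rule N.sparse[OF w(1,2,3) cc _ _ K]) (use gU in \<open>auto simp: m_def\<close>)
    then obtain V where V: "V \<in> carrier (grp N)" "\<And>i zs. i \<le> j \<Longrightarrow> length zs = length (\<sigma> i) \<Longrightarrow> set zs \<subseteq> N.R \<Longrightarrow>
        (c \<otimes>\<^bsub>grp N\<^esub> V [^]\<^bsub>grp N\<^esub> K) [^]\<^bsub>grp N\<^esub> m i \<noteq> g i \<otimes>\<^bsub>grp N\<^esub> N.lc (zip (\<sigma> i) zs)"
      by fastforce
    let ?d = "c \<otimes>\<^bsub>grp N\<^esub> V [^]\<^bsub>grp N\<^esub> K"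
    have dc: "?d \<in> carrier (grp N)" using N.m_closed[OF cc N.nat_pow_closed[OF V(1)]] .
    have Th: "N.Theta (\<iota> i) c \<longleftrightarrow> N.Theta (\<iota> i) ?d" if i: "i \<le> j" for i
    proof -
      obtain l where l: "K = l * n i"
        unfolding K_def using i dvd_prodI[of "{..j}" i n] by (metis atMost_iff dvdE finite_atMost mult.commute)
      let ?u = "fint N One [] [^]\<^bsub>grp N\<^esub> k i" and ?v = "(V [^]\<^bsub>grp N\<^esub> l) [^]\<^bsub>grp N\<^esub> n i"
      have uc: "?u \<in> carrier (grp N)" by (rule N.nat_pow_closed) (rule N.u_closed)
      have vl: "V [^]\<^bsub>grp N\<^esub> l \<in> carrier (grp N)" using V(1) by (rule N.nat_pow_closed)
      have vc: "?v \<in> carrier (grp N)" using vl by (rule N.nat_pow_closed)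
      have "V [^]\<^bsub>grp N\<^esub> K = ?v" unfolding l using N.nat_pow_pow[OF V(1)] by simp
      then have "?u \<otimes>\<^bsub>grp N\<^esub> ?d = ?v \<otimes>\<^bsub>grp N\<^esub> (?u \<otimes>\<^bsub>grp N\<^esub> c)"
        using N.m_assoc[OF uc cc vc] N.m_comm[OF N.m_closed[OF uc cc] vc] by (simp only:)
      then show ?thesis unfolding \<iota>_def N.Theta_residue[OF dc] N.Theta_residue[OF cc]
        using N.dv_cancel[OF vc N.m_closed[OF uc cc] N.dv_pow[OF vl]] by (simp only:)
    qed
    have "P i ?d" if "i \<le> j" for i
      unfolding P_def N_dep[OF dc[unfolded grp_simps(1)] gU] using Th[OF that] V(2)[OF that] by blast
    then show "\<exists>d\<in>univ N. \<forall>i\<le>j. P i d" using dc unfolding grp_simps(1) by blast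
  qed
  then obtain d where d: "d \<in> univ N" "\<And>i. P i d" by blast
  have dc: "d \<in> carrier (grp N)" using d(1) by simp
  have "N.res c d" unfolding N.res_def
  proof (intro allI impI)
    fix n' k' :: nat assume "0 < n'"
    then have "\<iota> (to_nat ((n' - 1, k'), 0 :: nat, [] :: bool list, 0 :: nat)) = (n', k', [(True, [], 0)])"
      by (simp add: \<iota>_def n_def k_def q_def)
    then show "N.dv n' (fint N One [] [^]\<^bsub>grp N\<^esub> k' \<otimes>\<^bsub>grp N\<^esub> c) \<longleftrightarrow> N.dv n' (fint N One [] [^]\<^bsub>grp N\<^esub> k' \<otimes>\<^bsub>grp N\<^esub> d)"
      using d(2) unfolding P_def by (metis N.Theta_residue[OF dc] N.Theta_residue[OF cc])
  qed
  moreover have "N.free_over d H"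
    unfolding N.free_over_def
  proof (intro allI impI ballI)
    fix n' :: nat and x z assume n': "0 < n'" and x: "x \<in> H" and z: "z \<in> generate (grp N) N.R"
    obtain \<tau> zs where zs: "length zs = length \<tau>" "set zs \<subseteq> N.R" "z = N.lc (zip \<tau> zs)"
      using z N.generate_R_lc by blast
    obtain i' where i': "x = h i'" using x h by blast
    let ?i = "to_nat ((0 :: nat, 0 :: nat), n' - 1, \<tau>, i')"
    have eq: "m ?i = n'" "\<sigma> ?i = \<tau>" "g ?i = x" using n' i' by (simp_all add: m_def \<sigma>_def g_def q_def)
    have "\<not> sat N ((\<lambda>_. x)(0 := d)) (dep_fm n' \<tau>)" using d(2)[of ?i] unfolding P_def eq by (rule conjunct2)
    then show "d [^]\<^bsub>grp N\<^esub> n' \<noteq> x \<otimes>\<^bsub>grp N\<^esub> z"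
      using N_dep[OF d(1) subsetD[OF H(2) x]] zs by blast
  qed
  ultimately show ?thesis using d(1) by blast
qed

text \<open>The relations of the back and forth system. Countability of \<open>f\<close> makes the saturation
  results applicable.\<close>

definition bf :: "((nat \<Rightarrow> 'a) \<times> (nat \<Rightarrow> 'a)) set \<Rightarrow> bool" where
  "bf f \<longleftrightarrow> N.good f \<and> countable f \<and> (\<forall>c\<in>N.R. N.thin c \<longrightarrow> c \<in> Domain f \<and> c \<in> Range f)"

lemma bf_converse: "bf f \<Longrightarrow> bf (f\<inverse>)"
proof -
  assume f: "bf f"
  have "f\<inverse> = prod.swap ` f" by force
  then have "countable (f\<inverse>)" using f by (simp add: bf_def)
  then show ?thesis using f N.good_converse[of f] by (simp add: bf_def)
qed

lemma bf_countable: "bf f \<Longrightarrow> countable (Domain f)" "bf f \<Longrightarrow> countable (Range f)"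
  by (auto simp: bf_def Domain_fst Range_snd)

lemma bf_nonempty: "bf f \<Longrightarrow> Range f \<noteq> {}"
  using N.good_consts(1) unfolding bf_def by blast

lemma bf_closed: "bf f \<Longrightarrow> Domain f \<subseteq> univ N" "bf f \<Longrightarrow> Range f \<subseteq> univ N"
  using N.good_closed[of f] unfolding bf_def by auto

lemma bf_ext:
  assumes "bf f" "N.good (N.ext f c d)" "c \<in> carrier (grp N)" "d \<in> carrier (grp N)"
  shows "bf (N.ext f c d)" "f \<subseteq> N.ext f c d" "(c, d) \<in> N.ext f c d"
proof -
  have f: "N.good f" "countable f" using assms(1) by (auto simp: bf_def)
  show sub: "f \<subseteq> N.ext f c d" by (rule N.ext_extends[OF f(1) assms(3,4)])
  show "(c, d) \<in> N.ext f c d" using N.ext_new[OF f(1) assms(3,4), of "[]"] by simp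
  show "bf (N.ext f c d)"
    using assms(1,2) sub N.countable_ext[OF f(2,1) assms(3,4)] unfolding bf_def by blast
qed

lemma forth_R:
  assumes f: "bf f" and c: "c \<in> N.R"
  shows "\<exists>f'. bf f' \<and> f \<subseteq> f' \<and> c \<in> Domain f'"
proof (cases "c \<in> Domain f")
  case False
  have g: "N.good f" using f by (simp add: bf_def)
  have "\<not> N.thin c" using f c False by (auto simp: bf_def)
  then obtain d where d: "d \<in> N.R" "d \<notin> Range f" "\<And>\<iota>. N.Theta \<iota> c \<longleftrightarrow> N.Theta \<iota> d"
    using realize_R[OF c _ bf_countable(2)[OF f] bf_closed(2)[OF f] bf_nonempty[OF f]] by blast
  note cd = N.R_closed[OF c] N.R_closed[OF d(1)]
  have "N.good (N.ext f c d)"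
    by (rule N.good_ext_R[OF g c False d(1,2) N.same_Theta[OF cd d(3)]])
  then show ?thesis using bf_ext[OF f _ cd] by blast
qed (use f in blast)

lemma forth_R_list:
  assumes "bf f" "set zs \<subseteq> N.R"
  shows "\<exists>f'. bf f' \<and> f \<subseteq> f' \<and> set zs \<subseteq> Domain f'"
  using assms(2)
proof (induction zs)
  case Nil
  then show ?case using assms(1) by auto
next
  case (Cons z zs)
  then obtain f1 where f1: "bf f1" "f \<subseteq> f1" "set zs \<subseteq> Domain f1" by auto
  obtain f2 where "bf f2" "f1 \<subseteq> f2" "z \<in> Domain f2" using forth_R[OF f1(1), of z] Cons.prems by auto
  moreover have "Domain f1 \<subseteq> Domain f2" using calculation(2) by blast
  ultimately show ?case using f1 by (intro exI[of _ f2]) auto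
qed

text \<open>Either \<open>c\<close> is free over the domain, and a free element with the same residues is
  available. Or some multiple of \<open>c\<close> is the sum of an element of the domain and finitely many
  elements of \<open>R\<close>; once the latter have been added to the domain, \<open>c\<close> belongs to it by purity.\<close>

theorem forth:
  assumes f: "bf f" and c: "c \<in> univ N"
  shows "\<exists>f'. bf f' \<and> f \<subseteq> f' \<and> c \<in> Domain f'"
proof (cases "N.free_over c (Domain f)")
  case True
  have g: "N.good f" using f by (simp add: bf_def)
  obtain d where d: "d \<in> univ N" "N.res c d" "N.free_over d (Range f)"
    using realize_free[OF c bf_countable(2)[OF f] bf_closed(2)[OF f] bf_nonempty[OF f]] by blast
  have cd: "c \<in> carrier (grp N)" "d \<in> carrier (grp N)" using c d by auto
  have "N.good (N.ext f c d)" by (rule N.good_ext_free[OF g cd(1) True cd(2) d(3,2)])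
  then show ?thesis using bf_ext[OF f _ cd] by blast
next
  case False
  then obtain n x z where n: "(n::nat) > 0" "x \<in> Domain f" "z \<in> generate (grp N) N.R" "c [^]\<^bsub>grp N\<^esub> n = x \<otimes>\<^bsub>grp N\<^esub> z"
    unfolding N.free_over_def by blast
  obtain \<sigma> zs where zs: "length zs = length \<sigma>" "set zs \<subseteq> N.R" "z = N.lc (zip \<sigma> zs)"
    using n(3) N.generate_R_lc by blast
  obtain f' where f': "bf f'" "f \<subseteq> f'" "set zs \<subseteq> Domain f'" using forth_R_list[OF f zs(2)] by blast
  have g: "N.good f'" using f' by (simp add: bf_def)
  have sg: "subgroup (Domain f') (grp N)" by (rule N.good_dom_subgroup[OF g])
  have "z \<in> generate (grp N) (Domain f' \<inter> N.R)"
    unfolding zs(3) using zs f'(3) by (intro N.lc_zip_generate) auto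
  then have "z \<in> Domain f'" using N.generate_subgroup_incl[OF _ sg, of "Domain f' \<inter> N.R"] by blast
  then have "c [^]\<^bsub>grp N\<^esub> n \<in> Domain f'"
    unfolding n(4) using n(2) f'(2) by (intro subgroup.m_closed[OF sg]) auto
  then have "c \<in> Domain f'" using N.good_dom_pure[OF g _ n(1), of c] c by simp
  then show ?thesis using f' by blast
qed

end

text \<open>The classical induction on formulas, for relations between two copies of the same
  structure.\<close>

theorem back_and_forth:
  assumes forth: "\<And>f a. f \<in> \<F> \<Longrightarrow> a \<in> univ N \<Longrightarrow> \<exists>f'\<in>\<F>. f \<subseteq> f' \<and> a \<in> Domain f'"
    and backward: "\<And>f a. f \<in> \<F> \<Longrightarrow> a \<in> univ N \<Longrightarrow> \<exists>f'\<in>\<F>. f \<subseteq> f' \<and> a \<in> Range f'"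
    and closed: "\<And>f. f \<in> \<F> \<Longrightarrow> f \<subseteq> univ N \<times> univ N"
    and inj: "\<And>f x y x' y'. f \<in> \<F> \<Longrightarrow> (x, y) \<in> f \<Longrightarrow> (x', y') \<in> f \<Longrightarrow> x = x' \<longleftrightarrow> y = y'"
    and fint: "\<And>f g as bs. f \<in> \<F> \<Longrightarrow> far L g = Some (length as) \<Longrightarrow> list_all2 (\<lambda>a b. (a, b) \<in> f) as bs \<Longrightarrow>
       (fint N g as, fint N g bs) \<in> f"
    and pint: "\<And>f p as bs. f \<in> \<F> \<Longrightarrow> par L p = Some (length as) \<Longrightarrow> list_all2 (\<lambda>a b. (a, b) \<in> f) as bs \<Longrightarrow>
       pint N p as \<longleftrightarrow> pint N p bs"
  shows "wf_fm L \<phi> \<Longrightarrow> f \<in> \<F> \<Longrightarrow> (\<And>v. v \<in> fv \<phi> \<Longrightarrow> (e v, e' v) \<in> f) \<Longrightarrow> sat N e \<phi> \<longleftrightarrow> sat N e' \<phi>"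
proof -
  have tm: "(teval N e t, teval N e' t) \<in> f"
    if "wf_tm L t" "f \<in> \<F>" "\<And>v. v \<in> tvars t \<Longrightarrow> (e v, e' v) \<in> f" for e e' t f
    using that
  proof (induction t)
    case (Fn g ts)
    have "(teval N e t, teval N e' t) \<in> f" if "t \<in> set ts" for t
      using Fn.IH[OF that] Fn.prems that by (auto simp: list_all_iff)
    then have "list_all2 (\<lambda>a b. (a, b) \<in> f) (map (teval N e) ts) (map (teval N e') ts)"
      by (auto simp: list_all2_conv_all_nth)
    then show ?case using Fn.prems by (auto intro!: fint)
  qed auto
  show "wf_fm L \<phi> \<Longrightarrow> f \<in> \<F> \<Longrightarrow> (\<And>v. v \<in> fv \<phi> \<Longrightarrow> (e v, e' v) \<in> f) \<Longrightarrow> sat N e \<phi> \<longleftrightarrow> sat N e' \<phi>"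
  proof (induction \<phi> arbitrary: f e e')
    case (Eq s t)
    have "(teval N e s, teval N e' s) \<in> f" "(teval N e t, teval N e' t) \<in> f"
      by (rule tm; use Eq in simp)+
    then show ?case using inj[OF Eq.prems(2)] by simp
  next
    case (Rel p ts)
    have "(teval N e t, teval N e' t) \<in> f" if "t \<in> set ts" for t
      by (rule tm) (use Rel that in auto)
    then have "list_all2 (\<lambda>a b. (a, b) \<in> f) (map (teval N e) ts) (map (teval N e') ts)"
      by (auto simp: list_all2_conv_all_nth)
    then show ?case using pint[OF Rel.prems(2), of p "map (teval N e) ts" "map (teval N e') ts"] Rel.prems by simp
  next
    case (Imp \<phi> \<psi>)
    have "sat N e \<phi> \<longleftrightarrow> sat N e' \<phi>" by (rule Imp.IH(1)[of f]) (use Imp.prems in auto)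
    moreover have "sat N e \<psi> \<longleftrightarrow> sat N e' \<psi>" by (rule Imp.IH(2)[of f]) (use Imp.prems in auto)
    ultimately show ?case by simp
  next
    case (All v \<phi>)
    have step: "sat N (e(v := a)) \<phi> \<longleftrightarrow> sat N (e'(v := b)) \<phi>" if "f' \<in> \<F>" "f \<subseteq> f'" "(a, b) \<in> f'" for f' a b
      by (rule All.IH[of f']) (use All.prems that in auto)
    show ?case
    proof
      assume L: "sat N e (All v \<phi>)"
      show "sat N e' (All v \<phi>)" unfolding sat.simps
      proof
        fix b assume "b \<in> univ N"
        then obtain f' a where f': "f' \<in> \<F>" "f \<subseteq> f'" "(a, b) \<in> f'" using backward[OF All.prems(2)] by blast
        then have "a \<in> univ N" using closed[OF f'(1)] by blast
        then show "sat N (e'(v := b)) \<phi>" using L step[OF f'] by simp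
      qed
    next
      assume L: "sat N e' (All v \<phi>)"
      show "sat N e (All v \<phi>)" unfolding sat.simps
      proof
        fix a assume "a \<in> univ N"
        then obtain f' b where f': "f' \<in> \<F>" "f \<subseteq> f'" "(a, b) \<in> f'" using forth[OF All.prems(2)] by blast
        then have "b \<in> univ N" using closed[OF f'(1)] by blast
        then show "sat N (e(v := a)) \<phi>" using L step[OF f'] by simp
      qed
    qed
  qed simp
qed

context ultra_model
begin

lemma backward:
  assumes f: "bf f" and c: "c \<in> univ N"
  shows "\<exists>f'. bf f' \<and> f \<subseteq> f' \<and> c \<in> Range f'"
proof -
  obtain f' where "bf f'" "f\<inverse> \<subseteq> f'" "c \<in> Domain f'" using forth[OF bf_converse[OF f] c] by blast
  then show ?thesis using bf_converse[of f'] by (intro exI[of _ "f'\<inverse>"]) auto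
qed

lemma bf_fint:
  assumes f: "bf f" and as: "fsym_arity g = length as" "list_all2 (\<lambda>a b. (a, b) \<in> f) as bs"
  shows "(fint N g as, fint N g bs) \<in> f"
proof -
  have g: "N.good f" using f by (simp add: bf_def)
  have l: "length as = length bs" using as(2) by (rule list_all2_lengthD)
  show ?thesis
  proof (cases g)
    case Plus
    then obtain a b a' b' where "as = [a, b]" "bs = [a', b']"
      using as(1) l by (auto simp: numeral_2_eq_2 length_Suc_conv Suc_length_conv)
    then show ?thesis using Plus as(2) N.good_mult[OF g] by simp
  next
    case Minus
    then obtain a a' where ab: "as = [a]" "bs = [a']" using as(1) l by (auto simp: length_Suc_conv Suc_length_conv)
    then have "(a, a') \<in> f" using as by simp
    then show ?thesis using Minus ab N.good_inv[OF g] N.minus N.good_closed[OF g] by simp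
  next
    case Zero
    then show ?thesis using as l N.good_consts[OF g] by simp
  next
    case One
    then show ?thesis using as l N.good_consts[OF g] by simp
  next
    case Cst
    then show ?thesis using as l N.good_consts[OF g] by simp
  next
    case Succ
    then obtain a a' where "as = [a]" "bs = [a']" using as(1) l by (auto simp: length_Suc_conv Suc_length_conv)
    then show ?thesis using Succ as(2) N.good_S[OF g] by simp
  next
    case SuccInv
    then obtain a a' where "as = [a]" "bs = [a']" using as(1) l by (auto simp: length_Suc_conv Suc_length_conv)
    then show ?thesis using SuccInv as(2) N.good_S'[OF g] by simp
  qed
qed

lemma bf_pint_base:
  assumes f: "bf f" and as: "par Lb p = Some (length as)" "list_all2 (\<lambda>a b. (a, b) \<in> f) as bs"
  shows "pint N p as \<longleftrightarrow> pint N p bs"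
proof -
  have g: "N.good f" using f by (simp add: bf_def)
  have l: "length as = length bs" using as(2) by (rule list_all2_lengthD)
  have "length as = 1" using as(1) by (cases p) (auto split: if_splits)
  then obtain a b where ab: "as = [a]" "bs = [b]" using l by (auto simp: length_Suc_conv Suc_length_conv)
  then have abf: "(a, b) \<in> f" using as by simp
  note cl = N.good_closed[OF g abf]
  show ?thesis
  proof (cases p)
    case InR
    then show ?thesis using N.good_R[OF g abf] cl ab by (simp add: Rel_R_def)
  next
    case (Dvs n)
    then have "n > 1" using as(1) by (auto split: if_splits)
    then show ?thesis using N.good_dv[OF g abf, of n] N.Dvs[OF cl(1), of n] N.Dvs[OF cl(2), of n] ab Dvs
      by (simp add: N.dv_def)
  next
    case (Im Q D)
    then show ?thesis using as(1) by simp
  qed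
qed

lemma bf_system:
  assumes "f \<in> {f. bf f}"
  shows "f \<subseteq> univ N \<times> univ N" "(x, y) \<in> f \<Longrightarrow> (x', y') \<in> f \<Longrightarrow> x = x' \<longleftrightarrow> y = y'"
proof -
  have f: "bf f" using assms by simp
  show "f \<subseteq> univ N \<times> univ N" using bf_closed[OF f] by auto
  show "(x, y) \<in> f \<Longrightarrow> (x', y') \<in> f \<Longrightarrow> x = x' \<longleftrightarrow> y = y'"
    using N.good_fun[of f x y x' y'] f by (simp add: bf_def)
qed

lemma bf_base:
  assumes "bf f" "wf_fm Lb \<phi>" "\<And>v. v \<in> fv \<phi> \<Longrightarrow> (e v, e' v) \<in> f"
  shows "sat N e \<phi> \<longleftrightarrow> sat N e' \<phi>"
proof (rule back_and_forth[where \<F> = "{f. bf f}" and L = Lb and f = f])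
  show "\<exists>f'\<in>{f. bf f}. f \<subseteq> f' \<and> a \<in> Domain f'" if "f \<in> {f. bf f}" "a \<in> univ N" for f a
    using forth that by auto
  show "\<exists>f'\<in>{f. bf f}. f \<subseteq> f' \<and> a \<in> Range f'" if "f \<in> {f. bf f}" "a \<in> univ N" for f a
    using backward that by auto
  show "(fint N g as, fint N g bs) \<in> f"
    if "f \<in> {f. bf f}" "far Lb g = Some (length as)" "list_all2 (\<lambda>a b. (a, b) \<in> f) as bs" for f g as bs
    using that by (auto intro!: bf_fint)
  show "pint N p as \<longleftrightarrow> pint N p bs"
    if "f \<in> {f. bf f}" "par Lb p = Some (length as)" "list_all2 (\<lambda>a b. (a, b) \<in> f) as bs" for f p as bs
    using bf_pint_base[of f p as bs] that by simp
qed (use bf_system assms in auto)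

text \<open>Although \<open>Im\<close> belongs to the language, good relations are not required to preserve it.
  They do so because the defining formula of \<open>Im\<close> lies in the language without \<open>Im\<close>, to which
  back and forth applies first.\<close>

lemma bf_pint:
  assumes f: "bf f" and as: "par LR p = Some (length as)" "list_all2 (\<lambda>a b. (a, b) \<in> f) as bs"
  shows "pint N p as \<longleftrightarrow> pint N p bs"
proof (cases "\<exists>Q D. p = Im Q D")
  case False
  then have "par Lb p = par LR p" by (cases p) auto
  then show ?thesis using bf_pint_base[OF f _ as(2)] as(1) by simp
next
  case True
  then obtain Q D where p: "p = Im Q D" by blast
  have v: "valid_Im Q D" "length as = dim_row Q" using as(1) p by (auto split: if_splits)
  have l: "length as = length bs" using as(2) by (rule list_all2_lengthD)
  have g: "N.good f" using f by (simp add: bf_def)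
  let ?z = "fint N Zero []"
  let ?e = "\<lambda>xs i. if i < dim_row Q then xs ! i else ?z"
  have pr: "(?e as i, ?e bs i) \<in> f" for i
    using as(2) v l N.good_consts[OF g] by (auto simp: list_all2_conv_all_nth)
  have cl: "set as \<subseteq> carrier (grp N)" "set bs \<subseteq> carrier (grp N)"
  proof -
    have "(as ! i, bs ! i) \<in> f" if "i < length as" for i using as(2) that by (rule list_all2_nthD)
    then have "as ! i \<in> carrier (grp N)" "bs ! i \<in> carrier (grp N)" if "i < length as" for i
      using N.good_closed[OF g] that by blast+
    then show "set as \<subseteq> carrier (grp N)" "set bs \<subseteq> carrier (grp N)"
      using l by (auto simp: in_set_conv_nth)
  qed
  have r: "range (?e as) \<subseteq> carrier (grp N)" "range (?e bs) \<subseteq> carrier (grp N)"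
    using N.good_closed[OF g pr] by blast+
  have "pint N (Im Q D) as \<longleftrightarrow> sat N (?e as) (Im_fm Q D)"
    using N.Im_iff[OF v(1,2) cl(1) r(1)] by simp
  also have "\<dots> \<longleftrightarrow> sat N (?e bs) (Im_fm Q D)"
    by (rule bf_base[OF f wf_Im_fm[OF v(1)]]) (rule pr)
  also have "\<dots> \<longleftrightarrow> pint N (Im Q D) bs"
    using N.Im_iff[OF v(1) _ cl(2) r(2)] v l by simp
  finally show ?thesis by (simp add: p)
qed

text \<open>The diagonal embedding of \<open>M\<close> into its ultrapower.\<close>

definition cst :: "'a \<Rightarrow> nat \<Rightarrow> 'a" where "cst a = repr (univ M) W (\<lambda>_. a)"

text \<open>Parameters from \<open>M\<close> are interpreted by their constant sequences. They are fixed by the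
  system as soon as they are fixed by its smallest member.\<close>

theorem bf_params:
  assumes "bf f" "wf_fm (lang_params LR P0) \<phi>" "\<And>a. a \<in> P0 \<Longrightarrow> (cst a, cst a) \<in> f"
    "\<And>v. v \<in> fv \<phi> \<Longrightarrow> (e v, e' v) \<in> f"
  shows "sat (upow W (struct_params M)) e \<phi> \<longleftrightarrow> sat (upow W (struct_params M)) e' \<phi>"
proof -
  let ?F = "{f. bf f \<and> (\<forall>a\<in>P0. (cst a, cst a) \<in> f)}" and ?N = "upow W (struct_params M)"
  have N: "univ ?N = univ N" "pint ?N = pint N" "fint ?N (Inl g) = fint N g" "fint ?N (Inr a) as = cst a" for g a as
    by (auto simp: N_def upow_def struct_params_def cst_def fun_eq_iff)
  show ?thesis
  proof (rule back_and_forth[where \<F> = ?F and L = "lang_params LR P0" and f = f])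
    show "\<exists>f'\<in>?F. f \<subseteq> f' \<and> a \<in> Domain f'" if "f \<in> ?F" "a \<in> univ ?N" for f a
      using forth[of f a] that unfolding N by blast
    show "\<exists>f'\<in>?F. f \<subseteq> f' \<and> a \<in> Range f'" if "f \<in> ?F" "a \<in> univ ?N" for f a
      using backward[of f a] that unfolding N by blast
    show "(fint ?N g as, fint ?N g bs) \<in> f"
      if "f \<in> ?F" "far (lang_params LR P0) g = Some (length as)" "list_all2 (\<lambda>a b. (a, b) \<in> f) as bs" for f g as bs
      using that by (cases g) (auto simp: N lang_params_def split: if_splits intro!: bf_fint)
    show "pint ?N p as \<longleftrightarrow> pint ?N p bs"
      if "f \<in> ?F" "par (lang_params LR P0) p = Some (length as)" "list_all2 (\<lambda>a b. (a, b) \<in> f) as bs" for f p as bs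
      using bf_pint[of f p as bs] that by (simp add: N lang_params_def)
    show "f \<subseteq> univ ?N \<times> univ ?N" if "f \<in> ?F" for f using bf_system(1)[of f] that by (simp add: N)
    show "x = x' \<longleftrightarrow> y = y'" if "f \<in> ?F" "(x, y) \<in> f" "(x', y') \<in> f" for f x y x' y'
      using bf_system(2)[of f x y x' y'] that by simp
  qed (use assms in auto)
qed

end

section \<open>Cardinality of closures\<close>

lemma card_Un: "infinite K \<Longrightarrow> |A| \<le>o |K| \<Longrightarrow> |B| \<le>o |K| \<Longrightarrow> |A \<union> B| \<le>o |K|"
  by (rule card_of_Un_ordLeq_infinite_Field[OF _ _ _ card_of_Card_order]) (simp_all add: Field_card_of)

lemma card_Times: "infinite K \<Longrightarrow> |A| \<le>o |K| \<Longrightarrow> |B| \<le>o |K| \<Longrightarrow> |A \<times> B| \<le>o |K|"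
  by (rule card_of_Times_ordLeq_infinite_Field[OF _ _ _ card_of_Card_order]) (simp_all add: Field_card_of)

lemma card_countable: "infinite K \<Longrightarrow> countable X \<Longrightarrow> |X| \<le>o |K|"
proof -
  assume "infinite K" "countable X"
  then have "|UNIV :: nat set| \<le>o |K|" using infinite_iff_card_of_nat by blast
  moreover have "|X| \<le>o |UNIV :: nat set|"
    using \<open>countable X\<close> by (auto simp: countable_def intro: card_of_ordLeq[THEN iffD1])
  ultimately show ?thesis by (rule ordLeq_transitive[rotated])
qed

lemma card_lists:
  assumes "infinite K" "|X| \<le>o |K|"
  shows "|lists X| \<le>o |K|"
proof -
  have len: "|{xs \<in> lists X. length xs = n}| \<le>o |K|" for n
  proof (induction n)
    case 0
    have "{xs \<in> lists X. length xs = 0} \<subseteq> {[]}" by auto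
    then have "finite {xs \<in> lists X. length xs = 0}" by (rule finite_subset) simp
    then show ?case using assms(1) by (intro card_countable countable_finite)
  next
    case (Suc n)
    have "{xs \<in> lists X. length xs = Suc n} \<subseteq> (\<lambda>(x, xs). x # xs) ` (X \<times> {xs \<in> lists X. length xs = n})"
      by (auto simp: length_Suc_conv image_iff)
    then have "|{xs \<in> lists X. length xs = Suc n}| \<le>o |X \<times> {xs \<in> lists X. length xs = n}|"
      by (rule ordLeq_transitive[OF card_of_mono1 card_of_image])
    also have "|X \<times> {xs \<in> lists X. length xs = n}| \<le>o |K|"
      using assms(1,2) Suc by (rule card_Times)
    finally show ?case .
  qed
  have "lists X = (\<Union>n. {xs \<in> lists X. length xs = n})" by auto
  moreover have "|UNIV :: nat set| \<le>o |K|" using assms(1) infinite_iff_card_of_nat by blast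
  then have "|\<Union>n. {xs \<in> lists X. length xs = n}| \<le>o |K|"
    using assms(1) len by (intro card_of_UNION_ordLeq_infinite) auto
  ultimately show ?thesis by simp
qed

text \<open>The functions take lists, so that operations of all arities are treated alike. Values
  outside \<open>U\<close>, which arise when a choice operator has nothing to choose, are discarded.\<close>

inductive_set clos :: "('a list \<Rightarrow> 'a) set \<Rightarrow> 'a set \<Rightarrow> 'a set \<Rightarrow> 'a set" for \<F> U X where
  base: "x \<in> X \<Longrightarrow> x \<in> clos \<F> U X"
| step: "f \<in> \<F> \<Longrightarrow> xs \<in> lists (clos \<F> U X) \<Longrightarrow> f xs \<in> U \<Longrightarrow> f xs \<in> clos \<F> U X"

lemma clos_subset: "X \<subseteq> U \<Longrightarrow> clos \<F> U X \<subseteq> U"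
proof
  fix x assume "x \<in> clos \<F> U X" "X \<subseteq> U"
  then show "x \<in> U" by induction auto
qed

lemma clos_minimal: "X \<subseteq> clos \<F> U Y \<Longrightarrow> clos \<F> U X \<subseteq> clos \<F> U Y"
proof
  fix x assume "x \<in> clos \<F> U X" "X \<subseteq> clos \<F> U Y"
  then show "x \<in> clos \<F> U Y"
  proof induction
    case (step f xs)
    then show ?case by (intro clos.step) (auto elim: lists_mono[THEN subsetD, rotated])
  qed auto
qed

text \<open>The closure is reached in countably many steps, each of which applies countably many
  functions to finite lists.\<close>

lemma card_clos:
  assumes K: "infinite K" and X: "|X| \<le>o |K|" and F: "countable \<F>"
  shows "|clos \<F> U X| \<le>o |K|"
proof -
  define Lv where "Lv = rec_nat X (\<lambda>_ L. L \<union> (\<Union>f\<in>\<F>. f ` lists L))"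
  have Lv0: "Lv 0 = X" and LvS: "Lv (Suc n) = Lv n \<union> (\<Union>f\<in>\<F>. f ` lists (Lv n))" for n
    by (auto simp: Lv_def)
  have nat: "|UNIV :: nat set| \<le>o |K|" using K infinite_iff_card_of_nat by blast
  have F: "|\<F>| \<le>o |K|" using K F by (rule card_countable)
  have cLv: "|Lv n| \<le>o |K|" for n
  proof (induction n)
    case (Suc n)
    have "|f ` lists (Lv n)| \<le>o |K|" for f
      using card_of_image card_lists[OF K Suc] by (rule ordLeq_transitive)
    then have "|\<Union>f\<in>\<F>. f ` lists (Lv n)| \<le>o |K|" using F by (intro card_of_UNION_ordLeq_infinite[OF K]) auto
    then show ?case unfolding LvS using Suc by (intro card_Un[OF K])
  qed (simp add: Lv0 X)
  have mono: "Lv m \<subseteq> Lv n" if "m \<le> n" for m n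
    using that by (induction n rule: dec_induct) (auto simp: LvS)
  have "clos \<F> U X \<subseteq> (\<Union>n. Lv n)"
  proof
    fix x assume "x \<in> clos \<F> U X"
    then show "x \<in> (\<Union>n. Lv n)"
    proof induction
      case (base x)
      then show ?case using Lv0 by blast
    next
      case (step f xs)
      have "\<exists>n. set ys \<subseteq> Lv n" if "set ys \<subseteq> (\<Union>n. Lv n)" for ys
        using that
      proof (induction ys)
        case (Cons y ys)
        then obtain n m where "set ys \<subseteq> Lv n" "y \<in> Lv m" by auto
        then have "set (y # ys) \<subseteq> Lv (max n m)" using mono[of n "max n m"] mono[of m "max n m"] by auto
        then show ?case by blast
      qed simp
      moreover have "set xs \<subseteq> (\<Union>n. Lv n)" using step by (auto simp: in_lists_conv_set)
      ultimately obtain n where "set xs \<subseteq> Lv n" by blast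
      moreover have "f \<in> \<F>" using step by simp
      ultimately have "f xs \<in> Lv (Suc n)" by (auto simp: LvS lists_eq_set)
      then show ?case by blast
    qed
  qed
  then have "|clos \<F> U X| \<le>o |\<Union>n. Lv n|" by (rule card_of_mono1)
  also have "|\<Union>n. Lv n| \<le>o |K|" using nat cLv by (intro card_of_UNION_ordLeq_infinite[OF K]) auto
  finally show ?thesis .
qed

lemma countable_clos:
  assumes "countable X" "countable \<F>" shows "countable (clos \<F> U X)"
proof -
  have "|X| \<le>o |UNIV :: nat set|" using assms(1) by (intro card_countable) auto
  then have "|clos \<F> U X| \<le>o |UNIV :: nat set|" using assms(2) by (intro card_clos) auto
  then show ?thesis unfolding countable_def using card_of_ordLeq[of "clos \<F> U X" "UNIV :: nat set"] by auto
qed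

section \<open>Closed sets of parameters\<close>

context R_model
begin

text \<open>The sets \<open>B\<close> whose identity relation is good after passing to an ultrapower. If an element
  of \<open>B\<close> is a signed sum of elements of \<open>R\<close>, then it is one of elements of \<open>R \<inter> B\<close> with the same
  signs; fixing the signs makes this a property that passes from \<open>M\<close> to the ultrapower.\<close>

definition closed_set :: "'b set \<Rightarrow> bool" where
  "closed_set B \<longleftrightarrow> B \<subseteq> carrier G \<and> \<one> \<in> B \<and> u \<in> B \<and> c0 \<in> B \<and>
     (\<forall>x\<in>B. \<forall>y\<in>B. x \<otimes> y \<in> B) \<and> (\<forall>x\<in>B. inv x \<in> B \<and> S x \<in> B \<and> S' x \<in> B) \<and>
     (\<forall>x\<in>carrier G. \<forall>n>0. x [^] (n::nat) \<in> B \<longrightarrow> x \<in> B) \<and>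
     (\<forall>\<sigma> zs. length zs = length \<sigma> \<longrightarrow> set zs \<subseteq> R \<longrightarrow> lc (zip \<sigma> zs) \<in> B \<longrightarrow>
        (\<exists>zs'. length zs' = length \<sigma> \<and> set zs' \<subseteq> R \<inter> B \<and> lc (zip \<sigma> zs) = lc (zip \<sigma> zs'))) \<and>
     (\<forall>c\<in>R. thin c \<longrightarrow> c \<in> B)"

text \<open>A thin element lies in a finite set that is described by finitely many of the countably
  many formulas \<open>Theta\<close> and their truth values.\<close>

lemma countable_thin: "countable {c \<in> R. thin c}"
proof -
  let ?D = "\<lambda>(T, P). {d \<in> R. \<forall>\<iota>\<in>T. Theta \<iota> d \<longleftrightarrow> \<iota> \<in> P}"
  let ?I = "{TP. finite (fst TP) \<and> finite (snd TP) \<and> finite (?D TP)}"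
  have "?I \<subseteq> Collect finite \<times> Collect finite" by auto
  moreover have "countable (Collect finite \<times> Collect finite :: ((nat \<times> nat \<times> lin) set \<times> (nat \<times> nat \<times> lin) set) set)"
    by (intro countable_SIGMA countable_Collect_finite)
  ultimately have "countable ?I" by (rule countable_subset)
  then have "countable (\<Union>TP\<in>?I. ?D TP)" by (rule countable_UN) (auto intro: countable_finite)
  moreover have "{c \<in> R. thin c} \<subseteq> (\<Union>TP\<in>?I. ?D TP)"
  proof
    fix c assume "c \<in> {c \<in> R. thin c}"
    then obtain T where c: "c \<in> R" "finite T" "finite {d \<in> R. \<forall>\<iota>\<in>T. Theta \<iota> d \<longleftrightarrow> Theta \<iota> c}"
      by (auto simp: thin_def)
    let ?P = "{\<iota>\<in>T. Theta \<iota> c}"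
    have "?D (T, ?P) = {d \<in> R. \<forall>\<iota>\<in>T. Theta \<iota> d \<longleftrightarrow> Theta \<iota> c}" by auto
    then have "(T, ?P) \<in> ?I" using c by simp
    moreover have "c \<in> ?D (T, ?P)" using c(1) by auto
    ultimately show "c \<in> (\<Union>TP\<in>?I. ?D TP)" by blast
  qed
  ultimately show ?thesis by (rule countable_subset[rotated])
qed

text \<open>Skolem functions for the clauses of \<open>closed_set\<close>. For an element that is a signed sum of
  elements of \<open>R\<close> with signs \<open>\<sigma>\<close>, the function with index \<open>(\<sigma>, i)\<close> picks the \<open>i\<close>-th summand of
  one such sum.\<close>

definition closing_functions :: "('b list \<Rightarrow> 'b) set" where
  "closing_functions = {\<lambda>_. \<one>, \<lambda>_. u, \<lambda>_. c0, \<lambda>xs. xs ! 0 \<otimes> xs ! 1, \<lambda>xs. inv (xs ! 0), \<lambda>xs. S (xs ! 0), \<lambda>xs. S' (xs ! 0)} \<union>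
     range (\<lambda>n xs. SOME x. x \<in> carrier G \<and> x [^] (n::nat) = xs ! 0) \<union>
     range (\<lambda>(\<sigma>, i) xs. (SOME zs. length zs = length \<sigma> \<and> set zs \<subseteq> R \<and> xs ! 0 = lc (zip \<sigma> zs)) ! i) \<union>
     (\<lambda>c _. c) ` {c \<in> R. thin c}"

lemma countable_closing_functions: "countable closing_functions"
  unfolding closing_functions_def using countable_thin by auto

lemma closed_set_clos:
  assumes "X \<subseteq> carrier G"
  shows "closed_set (clos closing_functions (carrier G) X)"
proof -
  let ?B = "clos closing_functions (carrier G) X"
  have sub: "?B \<subseteq> carrier G" using assms by (rule clos_subset)
  have st: "f xs \<in> ?B" if "f \<in> closing_functions" "set xs \<subseteq> ?B" "f xs \<in> carrier G" for f xs
    using that by (intro clos.step) (auto simp: lists_eq_set)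
  have c: "\<one> \<in> ?B" "u \<in> ?B" "c0 \<in> ?B"
    using st[of "\<lambda>_. \<one>" "[]"] st[of "\<lambda>_. u" "[]"] st[of "\<lambda>_. c0" "[]"] by (auto simp: closing_functions_def)
  have m: "x \<otimes> y \<in> ?B" if "x \<in> ?B" "y \<in> ?B" for x y
    using st[of "\<lambda>xs. xs ! 0 \<otimes> xs ! 1" "[x, y]"] that sub by (auto simp: closing_functions_def)
  have i: "inv x \<in> ?B \<and> S x \<in> ?B \<and> S' x \<in> ?B" if "x \<in> ?B" for x
    using st[of "\<lambda>xs. inv (xs ! 0)" "[x]"] st[of "\<lambda>xs. S (xs ! 0)" "[x]"] st[of "\<lambda>xs. S' (xs ! 0)" "[x]"] that sub
    by (auto simp: closing_functions_def)
  have p: "x \<in> ?B" if x: "x \<in> carrier G" "n > 0" "x [^] (n::nat) \<in> ?B" for x n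
  proof -
    let ?f = "\<lambda>n xs. SOME x. x \<in> carrier G \<and> x [^] (n::nat) = xs ! 0"
    have "?f n [x [^] n] = x" using x pow_inj by (intro some_equality) auto
    moreover have "?f n \<in> closing_functions" unfolding closing_functions_def by blast
    ultimately show ?thesis using st[of "?f n" "[x [^] n]"] x by simp
  qed
  have z: "\<exists>zs'. length zs' = length \<sigma> \<and> set zs' \<subseteq> R \<inter> ?B \<and> lc (zip \<sigma> zs) = lc (zip \<sigma> zs')"
    if zs: "length zs = length \<sigma>" "set zs \<subseteq> R" "lc (zip \<sigma> zs) \<in> ?B" for \<sigma> zs
  proof -
    let ?f = "\<lambda>xs. SOME zs. length zs = length \<sigma> \<and> set zs \<subseteq> R \<and> xs ! 0 = lc (zip \<sigma> zs)"
    let ?x = "[lc (zip \<sigma> zs)]"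
    have "\<exists>zs'. length zs' = length \<sigma> \<and> set zs' \<subseteq> R \<and> ?x ! 0 = lc (zip \<sigma> zs')" using zs by auto
    from someI_ex[OF this] have f: "length (?f ?x) = length \<sigma>" "set (?f ?x) \<subseteq> R" "lc (zip \<sigma> zs) = lc (zip \<sigma> (?f ?x))"
      by simp_all
    have "?f ?x ! i \<in> ?B" if "i < length \<sigma>" for i
    proof -
      have "?f ?x ! i \<in> R" using f that by auto
      moreover have "(\<lambda>xs. ?f xs ! i) \<in> closing_functions"
        unfolding closing_functions_def by (intro UnI1 UnI2 image_eqI[of _ _ "(\<sigma>, i)"]) auto
      ultimately show ?thesis using st[of "\<lambda>xs. ?f xs ! i" ?x] zs(3) by auto
    qed
    then have "set (?f ?x) \<subseteq> ?B" using f(1) by (auto simp: in_set_conv_nth)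
    then show ?thesis using f by blast
  qed
  have t: "c \<in> ?B" if "c \<in> R" "thin c" for c
    using st[of "\<lambda>_. c" "[]"] that by (auto simp: closing_functions_def)
  show ?thesis unfolding closed_set_def using sub c m i p z t by (intro conjI) simp_all
qed

end

context ultra_model
begin

lemma cst_in: "a \<in> univ M \<Longrightarrow> cst a \<in> univ N"
  unfolding N_def cst_def by (rule repr_in_upow) auto

lemma cst_ev: "a \<in> univ M \<Longrightarrow> \<forall>\<^sub>F k in W. cst a k = a"
  unfolding cst_def by (rule repr(2)) auto

lemma cst_eqI: "a \<in> univ M \<Longrightarrow> x \<in> univ N \<Longrightarrow> \<forall>\<^sub>F k in W. x k = a \<Longrightarrow> x = cst a"
proof -
  assume a: "a \<in> univ M" "x \<in> univ N" "\<forall>\<^sub>F k in W. x k = a"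
  have "\<forall>\<^sub>F k in W. x k = cst a k" using a(3) cst_ev[OF a(1)] by eventually_elim simp
  then show "x = cst a" using N_eq_iff[OF a(2) cst_in[OF a(1)]] by simp
qed

lemma W_ex: "\<forall>\<^sub>F k in W. P k \<Longrightarrow> \<exists>k. P k"
  using W(1) unfolding ultra_def by (metis eventually_happens')

lemma cst_inj: 
  assumes "a \<in> univ M" "b \<in> univ M" "cst a = cst b" shows "a = b"
proof -
  have "\<forall>\<^sub>F k in W. a = b" using cst_ev[OF assms(1)] cst_ev[OF assms(2)] unfolding assms(3)
    by eventually_elim simp
  then show ?thesis using W_ex by blast
qed

lemma N_tm: "wf_tm LR t \<Longrightarrow> (\<And>v. v \<in> tvars t \<Longrightarrow> e v \<in> univ N) \<Longrightarrow>
   \<forall>\<^sub>F k in W. teval N e t k = teval M (\<lambda>v. e v k) t"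
  unfolding N_def by (rule los_tm[OF M_struct])

lemma N_fint1:
  assumes "x \<in> univ N" 
  shows "\<forall>\<^sub>F k in W. fint N Minus [x] k = fint M Minus [x k]" "\<forall>\<^sub>F k in W. fint N Succ [x] k = fint M Succ [x k]"
    "\<forall>\<^sub>F k in W. fint N SuccInv [x] k = fint M SuccInv [x k]"
  using N_tm[of "minus_tm (Var 0)" "\<lambda>_. x"] N_tm[of "S_tm (Var 0)" "\<lambda>_. x"] N_tm[of "Sinv_tm (Var 0)" "\<lambda>_. x"] assms
  by simp_all

lemma N_inv: 
  assumes "x \<in> univ N" 
  shows "\<forall>\<^sub>F k in W. (inv\<^bsub>grp N\<^esub> x) k = inv\<^bsub>grp M\<^esub> (x k)"
  using N_fint1(1)[OF assms] N.minus[of x] M.minus[OF N_mem_range[OF assms, folded M.carrier_eq]] assms by simp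

lemma N_mult: "x \<in> univ N \<Longrightarrow> y \<in> univ N \<Longrightarrow> \<forall>\<^sub>F k in W. (x \<otimes>\<^bsub>grp N\<^esub> y) k = x k \<otimes>\<^bsub>grp M\<^esub> y k"
  using N_tm[of "plus_tm (Var 0) (Var 1)" "\<lambda>v. if v = 0 then x else y"] by auto

lemma N_const: "fint N Zero [] = cst (fint M Zero [])" "fint N One [] = cst (fint M One [])" "fint N Cst [] = cst (fint M Cst [])"
  by (simp_all add: N_def upow_def cst_def)

lemma N_pow: "x \<in> univ N \<Longrightarrow> \<forall>\<^sub>F k in W. (x [^]\<^bsub>grp N\<^esub> n) k = x k [^]\<^bsub>grp M\<^esub> (n::nat)"
proof -
  assume x: "x \<in> univ N"
  have "tvars (mult_tm (int n) (Var 0)) \<subseteq> {0}" using tvars_mult_tm[of "int n" "Var 0"] by simp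
  then have "\<forall>\<^sub>F k in W. teval N (\<lambda>_. x) (mult_tm (int n) (Var 0)) k = teval M (\<lambda>_. x k) (mult_tm (int n) (Var 0))"
    using x by (intro N_tm wf_mult_tm) auto
  then show ?thesis using x N_mem_range[OF x] N.teval_mult_tm[of "\<lambda>_. x" "Var 0"] 
    M.teval_mult_tm[of "\<lambda>_. x _" "Var 0"] by simp
qed

lemma N_lin:
  assumes "e ` lvars l \<subseteq> univ N"
  shows "\<forall>\<^sub>F k in W. N.lin e l k = M.lin (\<lambda>v. e v k) l"
proof -
  have "tvars (lin_tm l) = lvars l" by (simp add: tvars_lin_tm lvars_def)
  then have "\<forall>\<^sub>F k in W. teval N e (lin_tm l) k = teval M (\<lambda>v. e v k) (lin_tm l)"
    using assms by (intro N_tm wf_lin_tm) auto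
  moreover have "(\<lambda>v. e v k) ` lvars l \<subseteq> carrier (grp M)" for k using assms N_mem_range by (fastforce simp: M.carrier_eq)
  ultimately show ?thesis using assms M.teval_lin_tm N.teval_lin_tm by simp
qed

lemma N_lc_zip:
  assumes "length zs = length \<sigma>" "set zs \<subseteq> univ N"
  shows "\<forall>\<^sub>F k in W. N.lc (zip \<sigma> zs) k = M.lc (zip \<sigma> (map (\<lambda>z. z k) zs))"
  using assms
proof (induction \<sigma> zs rule: list_induct2')
  case 1
  then show ?case using cst_ev[of "fint M Zero []"] M.one_closed by (simp add: N_const)
next
  case (4 b \<sigma> z zs)
  have z: "z \<in> univ N" and l: "N.lc (zip \<sigma> zs) \<in> univ N"
  proof -
    show "z \<in> univ N" using 4 by simp
    have "snd ` set (zip \<sigma> zs) \<subseteq> carrier (grp N)" using 4(3) by (auto dest: set_zip_rightD)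
    from N.lc_closed[OF this] show "N.lc (zip \<sigma> zs) \<in> univ N" by simp
  qed
  have iz: "inv\<^bsub>grp N\<^esub> z \<in> univ N" using N.inv_closed[of z] z by simp
  have "\<forall>\<^sub>F k in W. N.lc (zip \<sigma> zs) k = M.lc (zip \<sigma> (map (\<lambda>z. z k) zs))" using 4 by simp
  then show ?case using N_mult[OF z l] N_mult[OF iz l] N_inv[OF z]
    by eventually_elim (cases b; simp)
qed auto

end

lemma (in R_model) pow_1: "x \<in> carrier G \<Longrightarrow> x [^] (1::nat) = x"
  by simp

context ultra_model
begin

lemma cst_mult: 
  assumes "a \<in> univ M" "b \<in> univ M"
  shows "cst a \<otimes>\<^bsub>grp N\<^esub> cst b = cst (a \<otimes>\<^bsub>grp M\<^esub> b)"
proof (rule cst_eqI)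
  show "a \<otimes>\<^bsub>grp M\<^esub> b \<in> univ M" using M.m_closed[of a b] assms by simp
  show "cst a \<otimes>\<^bsub>grp N\<^esub> cst b \<in> univ N" using N.m_closed[of "cst a" "cst b"] cst_in assms by simp
  show "\<forall>\<^sub>F k in W. (cst a \<otimes>\<^bsub>grp N\<^esub> cst b) k = a \<otimes>\<^bsub>grp M\<^esub> b"
    using N_mult[OF cst_in[OF assms(1)] cst_in[OF assms(2)]] cst_ev[OF assms(1)] cst_ev[OF assms(2)]
    by eventually_elim simp
qed

lemma cst_inv: 
  assumes "a \<in> univ M"
  shows "inv\<^bsub>grp N\<^esub> cst a = cst (inv\<^bsub>grp M\<^esub> a)"
proof (rule cst_eqI)
  show "inv\<^bsub>grp M\<^esub> a \<in> univ M" using M.inv_closed[of a] assms by simp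
  show "inv\<^bsub>grp N\<^esub> cst a \<in> univ N" using N.inv_closed[of "cst a"] cst_in assms by simp
  show "\<forall>\<^sub>F k in W. (inv\<^bsub>grp N\<^esub> cst a) k = inv\<^bsub>grp M\<^esub> a"
    using N_inv[OF cst_in[OF assms(1)]] cst_ev[OF assms(1)] by eventually_elim simp
qed

lemma cst_S: 
  assumes "a \<in> univ M"
  shows "fint N Succ [cst a] = cst (fint M Succ [a])" "fint N SuccInv [cst a] = cst (fint M SuccInv [a])"
proof -
  have c: "cst a \<in> carrier (grp N)" "a \<in> carrier (grp M)" using cst_in[OF assms] assms by simp_all
  show "fint N Succ [cst a] = cst (fint M Succ [a])"
  proof (rule cst_eqI)
    show "fint M Succ [a] \<in> univ M" using M.S_closed[OF c(2)] by simp
    show "fint N Succ [cst a] \<in> univ N" using N.S_closed[OF c(1)] by simp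
    show "\<forall>\<^sub>F k in W. fint N Succ [cst a] k = fint M Succ [a]"
      using N_fint1(2)[OF cst_in[OF assms(1)]] cst_ev[OF assms(1)] by eventually_elim simp
  qed
  show "fint N SuccInv [cst a] = cst (fint M SuccInv [a])"
  proof (rule cst_eqI)
    show "fint M SuccInv [a] \<in> univ M" using M.S'_closed[OF c(2)] by simp
    show "fint N SuccInv [cst a] \<in> univ N" using N.S'_closed[OF c(1)] by simp
    show "\<forall>\<^sub>F k in W. fint N SuccInv [cst a] k = fint M SuccInv [a]"
      using N_fint1(3)[OF cst_in[OF assms(1)]] cst_ev[OF assms(1)] by eventually_elim simp
  qed
qed

lemma cst_pow: 
  assumes "a \<in> univ M"
  shows "cst a [^]\<^bsub>grp N\<^esub> (n::nat) = cst (a [^]\<^bsub>grp M\<^esub> n)"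
proof (rule cst_eqI)
  show "a [^]\<^bsub>grp M\<^esub> n \<in> univ M" using M.nat_pow_closed[of a n] assms by simp
  show "cst a [^]\<^bsub>grp N\<^esub> n \<in> univ N" using N.nat_pow_closed[of "cst a" n] cst_in assms by simp
  show "\<forall>\<^sub>F k in W. (cst a [^]\<^bsub>grp N\<^esub> n) k = a [^]\<^bsub>grp M\<^esub> n"
    using N_pow[OF cst_in[OF assms(1)]] cst_ev[OF assms(1)] by eventually_elim simp
qed

lemma cst_R: "a \<in> univ M \<Longrightarrow> cst a \<in> N.R \<longleftrightarrow> a \<in> M.R"
proof -
  assume a: "a \<in> univ M"
  have "cst a \<in> N.R \<longleftrightarrow> (\<forall>\<^sub>F k in W. cst a k \<in> M.R)" by (rule N_R[OF cst_in[OF a]])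
  also have "\<dots> \<longleftrightarrow> (\<forall>\<^sub>F k in W. a \<in> M.R)"
    by (rule eventually_iff_cong) (use cst_ev[OF a] in eventually_elim, simp)
  also have "\<dots> \<longleftrightarrow> a \<in> M.R" using W_ex by (auto dest: W_ex)
  finally show ?thesis .
qed

lemma cst_lc:
  assumes "length zs = length \<sigma>" "set zs \<subseteq> univ M"
  shows "N.lc (zip \<sigma> (map cst zs)) = cst (M.lc (zip \<sigma> zs))"
  using assms
proof (induction \<sigma> zs rule: list_induct2')
  case 1
  then show ?case by (simp add: N_const)
next
  case (4 b \<sigma> z zs)
  have "snd ` set (zip \<sigma> zs) \<subseteq> carrier (grp M)" using 4(3) by (auto dest: set_zip_rightD)
  then have l: "M.lc (zip \<sigma> zs) \<in> univ M" using M.lc_closed[of "zip \<sigma> zs"] by simp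
  have z: "z \<in> univ M" "inv\<^bsub>grp M\<^esub> z \<in> univ M" using 4(3) M.inv_closed[of z] by simp_all
  show ?case
    using 4 cst_mult[OF z(1) l] cst_mult[OF z(2) l] cst_inv[OF z(1)] by (cases b) simp_all
qed auto

definition diag :: "'a set \<Rightarrow> ((nat \<Rightarrow> 'a) \<times> (nat \<Rightarrow> 'a)) set" where
  "diag B = (\<lambda>b. (cst b, cst b)) ` B"

text \<open>The finite set that witnesses thinness in the ultrapower contains the images of all
  elements of \<open>M\<close> that satisfy the same conditions. So these are finitely many too, and almost
  all values of \<open>c\<close> lie among them; an ultrafilter makes \<open>c\<close> constant.\<close>

lemma N_thin_cst:
  assumes c: "c \<in> N.R" "N.thin c"
  obtains m where "m \<in> M.R" "M.thin m" "c = cst m"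
proof -
  obtain T where T: "finite T" "finite {d \<in> N.R. \<forall>\<iota>\<in>T. N.Theta \<iota> d \<longleftrightarrow> N.Theta \<iota> c}"
    using c(2) by (auto simp: N.thin_def)
  let ?F = "{d \<in> M.R. \<forall>\<iota>\<in>T. M.Theta \<iota> d \<longleftrightarrow> N.Theta \<iota> c}"
  have FU: "?F \<subseteq> univ M" by (auto simp: Rel_R_def)
  have cU: "c \<in> univ N" using c(1) by (simp add: Rel_R_def)
  have Th: "N.Theta \<iota> (cst d) \<longleftrightarrow> M.Theta \<iota> d" if d: "d \<in> univ M" for d \<iota>
  proof -
    have "N.Theta \<iota> (cst d) \<longleftrightarrow> (\<forall>\<^sub>F k in W. M.Theta \<iota> (cst d k))" by (rule N_Theta[OF cst_in[OF d]])
    also have "\<dots> \<longleftrightarrow> (\<forall>\<^sub>F k in W. M.Theta \<iota> d)"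
      by (rule eventually_iff_cong) (use cst_ev[OF d] in eventually_elim, simp)
    also have "\<dots> \<longleftrightarrow> M.Theta \<iota> d" by (auto dest: W_ex)
    finally show ?thesis .
  qed
  have "cst ` ?F \<subseteq> {d \<in> N.R. \<forall>\<iota>\<in>T. N.Theta \<iota> d \<longleftrightarrow> N.Theta \<iota> c}"
  proof safe
    fix d assume d: "d \<in> M.R" "\<forall>\<iota>\<in>T. M.Theta \<iota> d \<longleftrightarrow> N.Theta \<iota> c"
    have dU: "d \<in> univ M" using d(1) by (simp add: Rel_R_def)
    show "cst d \<in> N.R" using d(1) cst_R[OF dU] by simp
    show "N.Theta \<iota> c" if "\<iota> \<in> T" "N.Theta \<iota> (cst d)" for \<iota> using that d(2) Th[OF dU] by blast
    show "N.Theta \<iota> (cst d)" if "\<iota> \<in> T" "N.Theta \<iota> c" for \<iota> using that d(2) Th[OF dU] by blast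
  qed
  then have "finite (cst ` ?F)" using T(2) by (rule finite_subset)
  moreover have "inj_on cst ?F" using cst_inj FU by (intro inj_onI) blast
  ultimately have finF: "finite ?F" by (rule finite_imageD)
  have "\<forall>\<^sub>F k in W. \<forall>\<iota>\<in>T. M.Theta \<iota> (c k) \<longleftrightarrow> N.Theta \<iota> c"
    unfolding eventually_ball_finite_distrib[OF T(1)]
  proof
    fix \<iota>
    show "\<forall>\<^sub>F k in W. M.Theta \<iota> (c k) \<longleftrightarrow> N.Theta \<iota> c"
    proof (cases "N.Theta \<iota> c")
      case True
      then show ?thesis using N_Theta[OF cU, of \<iota>] by simp
    next
      case False
      then show ?thesis using N_Theta[OF cU, of \<iota>] ultra_not[OF W(1)] by simp
    qed
  qed
  moreover have "\<forall>\<^sub>F k in W. c k \<in> M.R" using c(1) N_R[OF cU] by simp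
  ultimately have evF: "\<forall>\<^sub>F k in W. c k \<in> ?F" by eventually_elim blast
  have "\<exists>m\<in>?F. \<forall>\<^sub>F k in W. c k = m"
  proof (rule ccontr)
    assume n: "\<not> ?thesis"
    have "\<forall>\<^sub>F k in W. \<forall>m\<in>?F. c k \<noteq> m"
      unfolding eventually_ball_finite_distrib[OF finF]
    proof
      fix m assume "m \<in> ?F"
      then have "\<not> (\<forall>\<^sub>F k in W. c k = m)" using n by blast
      then show "\<forall>\<^sub>F k in W. c k \<noteq> m" using ultra_not[OF W(1), of "\<lambda>k. c k = m"] by simp
    qed
    with evF have "\<forall>\<^sub>F k in W. False" by eventually_elim blast
    then show False using W_ex by blast
  qed
  then obtain m where m: "m \<in> ?F" "\<forall>\<^sub>F k in W. c k = m" by blast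
  have mU: "m \<in> univ M" using m(1) FU by blast
  have cm: "c = cst m" by (rule cst_eqI[OF mU cU m(2)])
  have "{d \<in> M.R. \<forall>\<iota>\<in>T. M.Theta \<iota> d \<longleftrightarrow> M.Theta \<iota> m} = ?F" using m(1) by blast
  then have "M.thin m" unfolding M.thin_def using T(1) finF by auto
  then show ?thesis using that m(1) cm by blast
qed

text \<open>The clause on the subgroup generated by \<open>R\<close> is checked at a single place of the
  ultrapower: a constant that is a signed sum of elements of \<open>R\<close> in the ultrapower is such a sum
  in \<open>M\<close>, with the same signs, and then of elements of \<open>R \<inter> B\<close>.\<close>

lemma diag_half:
  assumes B: "M.closed_set B"
  shows "N.half (diag B)"
proof -
  have BU: "B \<subseteq> univ M" using B by (simp add: M.closed_set_def)
  have D: "(x, y) \<in> diag B \<longleftrightarrow> x = y \<and> (\<exists>b\<in>B. x = cst b)" for x y by (auto simp: diag_def)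
  have cc: "fint M Zero [] \<in> B" "fint M One [] \<in> B" "fint M Cst [] \<in> B"
    "\<And>x y. x \<in> B \<Longrightarrow> y \<in> B \<Longrightarrow> x \<otimes>\<^bsub>grp M\<^esub> y \<in> B" "\<And>x. x \<in> B \<Longrightarrow> inv\<^bsub>grp M\<^esub> x \<in> B"
    "\<And>x. x \<in> B \<Longrightarrow> fint M Succ [x] \<in> B" "\<And>x. x \<in> B \<Longrightarrow> fint M SuccInv [x] \<in> B"
    using B by (simp_all add: M.closed_set_def)
  have pureB: "\<And>x n. x \<in> univ M \<Longrightarrow> n > 0 \<Longrightarrow> x [^]\<^bsub>grp M\<^esub> (n::nat) \<in> B \<Longrightarrow> x \<in> B"
    using B by (simp add: M.closed_set_def)
  have freeB: "\<And>\<sigma> zs. length zs = length \<sigma> \<Longrightarrow> set zs \<subseteq> M.R \<Longrightarrow> M.lc (zip \<sigma> zs) \<in> B \<Longrightarrow>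
        \<exists>zs'. length zs' = length \<sigma> \<and> set zs' \<subseteq> M.R \<inter> B \<and> M.lc (zip \<sigma> zs) = M.lc (zip \<sigma> zs')"
    using B by (simp add: M.closed_set_def)
  show ?thesis
    unfolding N.half_def
  proof (intro conjI)
    show "diag B \<subseteq> carrier (grp N) \<times> carrier (grp N)" using BU cst_in by (auto simp: diag_def)
    show "(\<one>\<^bsub>grp N\<^esub>, \<one>\<^bsub>grp N\<^esub>) \<in> diag B" "(fint N One [], fint N One []) \<in> diag B" "(fint N Cst [], fint N Cst []) \<in> diag B"
      using cc(1-3) unfolding D by (auto simp: N_const)
    show "\<forall>x y x' y'. (x, y) \<in> diag B \<longrightarrow> (x', y') \<in> diag B \<longrightarrow> (x \<otimes>\<^bsub>grp N\<^esub> x', y \<otimes>\<^bsub>grp N\<^esub> y') \<in> diag B"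
    proof (intro allI impI)
      fix x y x' y' assume "(x, y) \<in> diag B" "(x', y') \<in> diag B"
      then obtain b b' where b: "b \<in> B" "b' \<in> B" "x = cst b" "y = cst b" "x' = cst b'" "y' = cst b'" unfolding D by blast
      then have "x \<otimes>\<^bsub>grp N\<^esub> x' = cst (b \<otimes>\<^bsub>grp M\<^esub> b')" "y \<otimes>\<^bsub>grp N\<^esub> y' = cst (b \<otimes>\<^bsub>grp M\<^esub> b')"
        using cst_mult[of b b'] BU by auto
      then show "(x \<otimes>\<^bsub>grp N\<^esub> x', y \<otimes>\<^bsub>grp N\<^esub> y') \<in> diag B" using cc(4)[OF b(1,2)] unfolding D by metis
    qed
    show "\<forall>x y. (x, y) \<in> diag B \<longrightarrow> (inv\<^bsub>grp N\<^esub> x, inv\<^bsub>grp N\<^esub> y) \<in> diag B \<and>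
        (fint N Succ [x], fint N Succ [y]) \<in> diag B \<and> (fint N SuccInv [x], fint N SuccInv [y]) \<in> diag B"
    proof (intro allI impI)
      fix x y assume "(x, y) \<in> diag B"
      then obtain b where b: "b \<in> B" "x = cst b" "y = cst b" unfolding D by blast
      have bU: "b \<in> univ M" using b BU by blast
      show "(inv\<^bsub>grp N\<^esub> x, inv\<^bsub>grp N\<^esub> y) \<in> diag B \<and>
        (fint N Succ [x], fint N Succ [y]) \<in> diag B \<and> (fint N SuccInv [x], fint N SuccInv [y]) \<in> diag B"
        unfolding D b(2,3) cst_inv[OF bU] cst_S[OF bU] using cc(5-7)[OF b(1)] by blast
    qed
    show "\<forall>y. (\<one>\<^bsub>grp N\<^esub>, y) \<in> diag B \<longrightarrow> y = \<one>\<^bsub>grp N\<^esub>" unfolding D by blast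
    show "\<forall>x y n. (x, y) \<in> diag B \<longrightarrow> n > 0 \<longrightarrow> N.dv n x \<longrightarrow> N.dv n y" unfolding D by blast
    show "\<forall>x y. (x, y) \<in> diag B \<longrightarrow> x \<in> N.R \<longrightarrow> y \<in> N.R" unfolding D by blast
    show "\<forall>x\<in>carrier (grp N). \<forall>y\<in>carrier (grp N). \<forall>n>0. (x [^]\<^bsub>grp N\<^esub> (n::nat), y [^]\<^bsub>grp N\<^esub> n) \<in> diag B \<longrightarrow> (x, y) \<in> diag B"
    proof (intro ballI allI impI)
      fix x y and n :: nat assume xy: "x \<in> carrier (grp N)" "y \<in> carrier (grp N)" "n > 0"
        "(x [^]\<^bsub>grp N\<^esub> n, y [^]\<^bsub>grp N\<^esub> n) \<in> diag B"
      then obtain b where b: "b \<in> B" "x [^]\<^bsub>grp N\<^esub> n = cst b" "x [^]\<^bsub>grp N\<^esub> n = y [^]\<^bsub>grp N\<^esub> n" unfolding D by metis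
      have bU: "b \<in> univ M" using b BU by blast
      have e: "x = y" by (rule N.pow_inj[OF xy(1-3) b(3)])
      have xU: "x \<in> univ N" using xy by simp
      have "\<forall>\<^sub>F k in W. x k [^]\<^bsub>grp M\<^esub> n = b" using N_pow[OF xU, of n] cst_ev[OF bU] unfolding b(2)
        by eventually_elim simp
      then obtain k where k: "x k [^]\<^bsub>grp M\<^esub> n = b" using W_ex by blast
      have kU: "x k \<in> univ M" using N_mem_range[OF xU] .
      have kB: "x k \<in> B" using pureB[OF kU xy(3)] k b(1) by simp
      have "cst (x k) [^]\<^bsub>grp N\<^esub> n = x [^]\<^bsub>grp N\<^esub> n" using cst_pow[OF kU, of n] k b(2) by simp
      then have "cst (x k) = x" using N.pow_inj[OF _ xy(1,3)] cst_in[OF kU] by simp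
      then show "(x, y) \<in> diag B" unfolding D e[symmetric] using kB by metis
    qed
    show "\<forall>x\<in>Domain (diag B) \<inter> generate (grp N) N.R. \<exists>n>0. x [^]\<^bsub>grp N\<^esub> (n::nat) \<in> generate (grp N) (Domain (diag B) \<inter> N.R)"
    proof
      fix x assume x: "x \<in> Domain (diag B) \<inter> generate (grp N) N.R"
      then obtain b where b: "b \<in> B" "x = cst b" using D by blast
      have bU: "b \<in> univ M" using b BU by blast
      obtain \<sigma> zs where zs: "length zs = length \<sigma>" "set zs \<subseteq> N.R" "x = N.lc (zip \<sigma> zs)"
        using x N.generate_R_lc by blast
      have zU: "set zs \<subseteq> univ N" using zs(2) by (auto simp: Rel_R_def)
      have "\<forall>\<^sub>F k in W. \<forall>z\<in>set zs. z k \<in> M.R"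
        using zs(2) zU N_R by (auto simp: eventually_ball_finite_distrib)
      then have "\<forall>\<^sub>F k in W. b = M.lc (zip \<sigma> (map (\<lambda>z. z k) zs)) \<and> set (map (\<lambda>z. z k) zs) \<subseteq> M.R"
        using N_lc_zip[OF zs(1) zU] cst_ev[OF bU] unfolding zs(3)[symmetric] b(2)
        by eventually_elim auto
      then obtain k where k: "b = M.lc (zip \<sigma> (map (\<lambda>z. z k) zs))" "set (map (\<lambda>z. z k) zs) \<subseteq> M.R"
        using W_ex by blast
      obtain zs' where zs': "length zs' = length \<sigma>" "set zs' \<subseteq> M.R \<inter> B" "b = M.lc (zip \<sigma> zs')"
        using freeB[of "map (\<lambda>z. z k) zs" \<sigma>] k b(1) zs(1) by auto
      have z'U: "set zs' \<subseteq> univ M" using zs'(2) BU by blast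
      have "x = N.lc (zip \<sigma> (map cst zs'))" using cst_lc[OF zs'(1) z'U] zs'(3) b(2) by simp
      moreover have "set (map cst zs') \<subseteq> Domain (diag B) \<inter> N.R"
      proof
        fix y assume "y \<in> set (map cst zs')"
        then obtain z where z: "z \<in> set zs'" "y = cst z" by auto
        then have "z \<in> M.R" "z \<in> B" "z \<in> univ M" using zs'(2) z'U by auto
        then show "y \<in> Domain (diag B) \<inter> N.R" using cst_R[of z] z(2) D by blast
      qed
      ultimately have "x \<in> generate (grp N) (Domain (diag B) \<inter> N.R)"
        using zs'(1) N.lc_zip_generate[of "map cst zs'" "Domain (diag B) \<inter> N.R" \<sigma>] by simp
      moreover have "x [^]\<^bsub>grp N\<^esub> (1::nat) = x" using cst_in[OF bU] b(2) N.pow_1[of x] by simp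
      ultimately show "\<exists>n>0. x [^]\<^bsub>grp N\<^esub> (n::nat) \<in> generate (grp N) (Domain (diag B) \<inter> N.R)"
        by (intro exI[of _ 1]) simp
    qed
  qed
qed

lemma diag_bf:
  assumes B: "M.closed_set B" "countable B"
  shows "bf (diag B)"
proof -
  have "(diag B)\<inverse> = diag B" by (auto simp: diag_def)
  moreover have "c \<in> Domain (diag B) \<and> c \<in> Range (diag B)" if c: "c \<in> N.R" "N.thin c" for c
  proof -
    obtain m where m: "m \<in> M.R" "M.thin m" "c = cst m" using N_thin_cst[OF c] .
    then have "m \<in> B" using B(1) by (simp add: M.closed_set_def)
    then have "(c, c) \<in> diag B" unfolding m(3) diag_def by blast
    then show ?thesis by blast
  qed
  ultimately show ?thesis unfolding bf_def N.good_def using diag_half[OF B(1)] B(2) by (simp add: diag_def)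
qed

end

section \<open>Codes of tuples\<close>

text \<open>A code describes how an entry of a tuple lies over a set \<open>B\<close> of parameters and the earlier
  entries. \<open>Alg m l b\<close>: \<open>m\<close> times the entry is \<open>b\<close> plus the linear combination \<open>l\<close> of earlier
  entries. \<open>NewR \<Phi>\<close>: an element of \<open>R\<close> without such an equation. \<open>Free \<Phi>\<close>: an element without
  such an equation even modulo sums of elements of \<open>R\<close>. The set \<open>\<Phi>\<close> lists the formulas \<open>Theta\<close>
  that hold; it replaces the parameters entirely, and this is where superstability comes from:
  only \<open>Alg\<close> mentions parameters, and only one of them.\<close>

datatype 'a code = Alg nat lin 'a | NewR "(nat \<times> nat \<times> lin) set" | Free "(nat \<times> nat \<times> lin) set"

context ultra_model
begin

text \<open>The pure subgroup generated by \<open>B\<close> and the orbits of the first \<open>t\<close> entries of the tuple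
  \<open>Y\<close>.\<close>

definition pspan :: "'a set \<Rightarrow> (nat \<Rightarrow> nat \<Rightarrow> 'a) \<Rightarrow> nat \<Rightarrow> (nat \<Rightarrow> 'a) set" where
  "pspan B Y t = {x \<in> univ N. \<exists>m>0. \<exists>b\<in>B. \<exists>l. lvars l \<subseteq> {..<t} \<and>
     x [^]\<^bsub>grp N\<^esub> (m::nat) = cst b \<otimes>\<^bsub>grp N\<^esub> N.lin Y l}"

fun obeys :: "'a set \<Rightarrow> (nat \<Rightarrow> nat \<Rightarrow> 'a) \<Rightarrow> nat \<Rightarrow> 'a code \<Rightarrow> bool" where
  "obeys B Y t (Alg m l b) \<longleftrightarrow> m > 0 \<and> lvars l \<subseteq> {..<t} \<and> b \<in> B \<and>
     Y t [^]\<^bsub>grp N\<^esub> m = cst b \<otimes>\<^bsub>grp N\<^esub> N.lin Y l"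
| "obeys B Y t (NewR \<Phi>) \<longleftrightarrow> Y t \<in> N.R \<and> (\<forall>\<iota>. N.Theta \<iota> (Y t) \<longleftrightarrow> \<iota> \<in> \<Phi>) \<and> Y t \<notin> pspan B Y t"
| "obeys B Y t (Free \<Phi>) \<longleftrightarrow> (\<forall>\<iota>. N.Theta \<iota> (Y t) \<longleftrightarrow> \<iota> \<in> \<Phi>) \<and>
     (\<forall>m>0. \<forall>b\<in>B. \<forall>l. \<forall>z\<in>generate (grp N) N.R. lvars l \<subseteq> {..<t} \<longrightarrow>
        Y t [^]\<^bsub>grp N\<^esub> (m::nat) \<noteq> cst b \<otimes>\<^bsub>grp N\<^esub> N.lin Y l \<otimes>\<^bsub>grp N\<^esub> z)"

lemma pspan_mono: "s \<le> t \<Longrightarrow> pspan B Y s \<subseteq> pspan B Y t"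
  unfolding pspan_def by fastforce

lemma pspan_cst: "B \<subseteq> univ M \<Longrightarrow> b \<in> B \<Longrightarrow> cst b \<in> pspan B Y 0"
proof -
  assume b: "B \<subseteq> univ M" "b \<in> B"
  then have "cst b \<in> univ N" using cst_in by blast
  moreover have "cst b [^]\<^bsub>grp N\<^esub> (1::nat) = cst b \<otimes>\<^bsub>grp N\<^esub> N.lin Y []"
    using calculation N.pow_1[of "cst b"] N.r_one[of "cst b"] by (simp add: N.lin_def)
  ultimately show ?thesis unfolding pspan_def using b(2)
    by (auto intro!: exI[of _ "1::nat"] bexI[of _ b] exI[of _ "[]"] simp: lvars_def)
qed

text \<open>The common exponent for a sum is the product of two exponents, hence the closure of \<open>B\<close>
  under multiples.\<close>

lemma pspan_ext:
  assumes B: "B \<subseteq> univ M" "\<And>b. \<And>n::nat. b \<in> B \<Longrightarrow> b [^]\<^bsub>grp M\<^esub> n \<in> B" and Y: "\<And>i. Y i \<in> univ N"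
    and f: "Domain f \<subseteq> pspan B Y t"
  shows "Domain (N.ext f (Y t) d) \<subseteq> pspan B Y (Suc t)"
proof
  fix x' assume "x' \<in> Domain (N.ext f (Y t) d)"
  then obtain n x l where x: "x' \<in> carrier (grp N)" "n > 0" "x \<in> Domain f"
    "x' [^]\<^bsub>grp N\<^esub> (n::nat) = x \<otimes>\<^bsub>grp N\<^esub> N.lin1 (Y t) l"
    unfolding N.ext_def by blast
  obtain m b l' where h: "x \<in> univ N" "m > 0" "b \<in> B" "lvars l' \<subseteq> {..<t}"
    "x [^]\<^bsub>grp N\<^esub> (m::nat) = cst b \<otimes>\<^bsub>grp N\<^esub> N.lin Y l'"
    using x(3) f unfolding pspan_def by blast
  define l1 where "l1 = map (\<lambda>(b, w, v). (b, w, t)) l"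
  have lv: "lvars l1 \<subseteq> {t}" by (auto simp: l1_def lvars_def)
  have "map (\<lambda>(b, w, v). (b, shw N w (Y t))) l = map (\<lambda>(b, w, v). (b, shw N w (Y v))) l1"
    by (auto simp: l1_def)
  then have "N.lin1 (Y t) l = N.lin Y l1" by (simp only: N.lin_def)
  let ?l = "l' @ lpow m l1"
  have c: "Y ` lvars l' \<subseteq> carrier (grp N)" "Y ` lvars l1 \<subseteq> carrier (grp N)" "Y ` lvars (lpow m l1) \<subseteq> carrier (grp N)"
    using Y by auto
  have bc: "cst b \<in> carrier (grp N)" using h(3) B(1) cst_in by auto
  have "x' [^]\<^bsub>grp N\<^esub> (n * m) = (x \<otimes>\<^bsub>grp N\<^esub> N.lin Y l1) [^]\<^bsub>grp N\<^esub> m"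
    using N.nat_pow_pow[OF x(1), of n m] x(4) \<open>N.lin1 (Y t) l = N.lin Y l1\<close> by simp
  also have "\<dots> = x [^]\<^bsub>grp N\<^esub> m \<otimes>\<^bsub>grp N\<^esub> N.lin Y l1 [^]\<^bsub>grp N\<^esub> m"
    using h(1) N.lin_closed[OF c(2)] by (intro N.nat_pow_distrib) simp_all
  also have "\<dots> = cst b \<otimes>\<^bsub>grp N\<^esub> N.lin Y l' \<otimes>\<^bsub>grp N\<^esub> N.lin Y (lpow m l1)"
    using h(5) N.lin_lpow[OF c(2), of m] by (simp only:)
  also have "\<dots> = cst b \<otimes>\<^bsub>grp N\<^esub> N.lin Y ?l"
    unfolding N.lin_append[OF c(1,3)] by (rule N.m_assoc[OF bc N.lin_closed[OF c(1)] N.lin_closed[OF c(3)]])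
  finally have "x' [^]\<^bsub>grp N\<^esub> (n * m) = cst b \<otimes>\<^bsub>grp N\<^esub> N.lin Y ?l" .
  moreover have "lvars ?l \<subseteq> {..<Suc t}" 
  proof -
    have "lvars ?l = lvars l' \<union> lvars (lpow m l1)" by (simp add: lvars_def image_Un)
    then show ?thesis unfolding lessThan_Suc using h(4) lv N.lvars_lpow[of m l1] by blast
  qed
  moreover have "n * m > 0" using x(2) h(2) by simp
  ultimately show "x' \<in> pspan B Y (Suc t)" unfolding pspan_def mem_Collect_eq
    using x(1)[unfolded grp_simps] h(3) by blast
qed

text \<open>Starting from the identity on \<open>B\<close>, the relation is extended entry by entry. An algebraic
  entry is in the domain already, by purity; the other two cases are \<open>good_ext_R\<close> and
  \<open>good_ext_free\<close>. The induction keeps the domain inside \<open>pspan\<close>, which is what the codes refer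
  to.\<close>

theorem obeys_bf:
  assumes B: "M.closed_set B" "countable B" and Y: "\<And>i. Y i \<in> univ N" "\<And>i. Y' i \<in> univ N"
    and ob: "\<And>t. t < length cs \<Longrightarrow> obeys B Y t (cs ! t)" "\<And>t. t < length cs \<Longrightarrow> obeys B Y' t (cs ! t)"
  shows "\<exists>f. bf f \<and> diag B \<subseteq> f \<and> (\<forall>i<length cs. (Y i, Y' i) \<in> f)"
proof -
  have BU: "B \<subseteq> univ M" using B by (simp add: M.closed_set_def)
  have Bpow: "b [^]\<^bsub>grp M\<^esub> n \<in> B" if "b \<in> B" for b and n :: nat
    using that B(1) by (induction n) (auto simp: M.closed_set_def)
  have "\<exists>f. bf f \<and> diag B \<subseteq> f \<and> (\<forall>i<t. (Y i, Y' i) \<in> f) \<and> Domain f \<subseteq> pspan B Y t \<and> Range f \<subseteq> pspan B Y' t"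
    if "t \<le> length cs" for t
    using that
  proof (induction t)
    case 0
    have "Domain (diag B) \<subseteq> pspan B Y 0" "Range (diag B) \<subseteq> pspan B Y' 0"
      using pspan_cst[OF BU] by (auto simp: diag_def)
    then show ?case using diag_bf[OF B] by auto
  next
    case (Suc t)
    then obtain f where f: "bf f" "diag B \<subseteq> f" "\<And>i. i < t \<Longrightarrow> (Y i, Y' i) \<in> f"
      "Domain f \<subseteq> pspan B Y t" "Range f \<subseteq> pspan B Y' t" by auto
    have g: "N.good f" using f(1) by (simp add: bf_def)
    have o: "obeys B Y t (cs ! t)" "obeys B Y' t (cs ! t)" using ob Suc.prems by auto
    have yc: "Y t \<in> carrier (grp N)" "Y' t \<in> carrier (grp N)" using Y by auto
    have fin: "\<exists>f. bf f \<and> diag B \<subseteq> f \<and> (\<forall>i<Suc t. (Y i, Y' i) \<in> f) \<and> Domain f \<subseteq> pspan B Y (Suc t) \<and> Range f \<subseteq> pspan B Y' (Suc t)"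
      if gx: "N.good (N.ext f (Y t) (Y' t))"
    proof (intro exI conjI)
      note e = bf_ext[OF f(1) gx yc]
      show "bf (N.ext f (Y t) (Y' t))" by (rule e(1))
      show "diag B \<subseteq> N.ext f (Y t) (Y' t)" using f(2) e(2) by blast
      show "\<forall>i<Suc t. (Y i, Y' i) \<in> N.ext f (Y t) (Y' t)"
        using f(3) e(2,3) by (auto simp: less_Suc_eq)
      show "Domain (N.ext f (Y t) (Y' t)) \<subseteq> pspan B Y (Suc t)"
        by (rule pspan_ext[OF BU Bpow Y(1) f(4)])
      have "Domain (N.ext (f\<inverse>) (Y' t) (Y t)) \<subseteq> pspan B Y' (Suc t)"
        using f(5) by (intro pspan_ext[OF BU Bpow Y(2)]) auto
      then show "Range (N.ext f (Y t) (Y' t)) \<subseteq> pspan B Y' (Suc t)"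
        unfolding N.ext_converse[symmetric] by auto
    qed
    show ?case
    proof (cases "cs ! t")
      case (Alg m l b)
      have m: "m > 0" "lvars l \<subseteq> {..<t}" "b \<in> B" using o(1) Alg by auto
      have "(cst b \<otimes>\<^bsub>grp N\<^esub> N.lin Y l, cst b \<otimes>\<^bsub>grp N\<^esub> N.lin Y' l) \<in> f"
        using m f(2,3) by (intro N.good_mult[OF g] N.good_dom_lin[OF g]) (auto simp: diag_def)
      then have "(Y t [^]\<^bsub>grp N\<^esub> m, Y' t [^]\<^bsub>grp N\<^esub> m) \<in> f" using o Alg by simp
      then have "(Y t, Y' t) \<in> f" by (rule N.good_pure[OF g yc m(1)])
      then have "\<forall>i<Suc t. (Y i, Y' i) \<in> f" using f(3) by (auto simp: less_Suc_eq)
      moreover have "Domain f \<subseteq> pspan B Y (Suc t)" "Range f \<subseteq> pspan B Y' (Suc t)"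
        using f(4,5) pspan_mono[of t "Suc t" B] by (meson order_trans le_SucI order_refl)+
      ultimately show ?thesis using f(1,2) by blast
    next
      case (NewR \<Phi>)
      have "Y t \<in> N.R" "Y t \<notin> Domain f" "Y' t \<in> N.R" "Y' t \<notin> Range f" "\<And>\<iota>. N.Theta \<iota> (Y t) \<longleftrightarrow> N.Theta \<iota> (Y' t)"
        using o f(4,5) unfolding NewR by auto
      then show ?thesis by (intro fin N.good_ext_R[OF g _ _ _ _ N.same_Theta[OF yc]])
    next
      case (Free \<Phi>)
      have th: "\<And>\<iota>. N.Theta \<iota> (Y t) \<longleftrightarrow> N.Theta \<iota> (Y' t)" using o unfolding Free by auto
      have "N.res (Y t) (Y' t)"
        unfolding N.res_def using th N.Theta_residue[OF yc(1)] N.Theta_residue[OF yc(2)] by blast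
      moreover have fr: "N.free_over (y t) X" if X: "X \<subseteq> pspan B y t" and y: "\<And>i. y i \<in> univ N" and oy: "obeys B y t (Free \<Phi>)" for X y
        unfolding N.free_over_def
      proof (intro allI impI ballI notI)
        fix n :: nat and x z assume n: "n > 0" "x \<in> X" "z \<in> generate (grp N) N.R" "y t [^]\<^bsub>grp N\<^esub> n = x \<otimes>\<^bsub>grp N\<^esub> z"
        obtain m b l where h: "x \<in> univ N" "m > 0" "b \<in> B" "lvars l \<subseteq> {..<t}"
          "x [^]\<^bsub>grp N\<^esub> (m::nat) = cst b \<otimes>\<^bsub>grp N\<^esub> N.lin y l"
          using n(2) X unfolding pspan_def by blast
        have sR: "subgroup (generate (grp N) N.R) (grp N)" by (rule N.generate_closed[OF N.R_carrier])
        have zc: "z \<in> carrier (grp N)" by (rule subgroup.mem_carrier[OF sR n(3)])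
        have "y t [^]\<^bsub>grp N\<^esub> (n * m) = (x \<otimes>\<^bsub>grp N\<^esub> z) [^]\<^bsub>grp N\<^esub> m"
          using N.nat_pow_pow[of "y t" n m] y n(4) by simp
        also have "\<dots> = cst b \<otimes>\<^bsub>grp N\<^esub> N.lin y l \<otimes>\<^bsub>grp N\<^esub> z [^]\<^bsub>grp N\<^esub> m"
          unfolding h(5)[symmetric] using h(1) zc by (intro N.nat_pow_distrib) simp_all
        finally have "y t [^]\<^bsub>grp N\<^esub> (n * m) = cst b \<otimes>\<^bsub>grp N\<^esub> N.lin y l \<otimes>\<^bsub>grp N\<^esub> z [^]\<^bsub>grp N\<^esub> m" .
        moreover have "z [^]\<^bsub>grp N\<^esub> m \<in> generate (grp N) N.R" by (rule N.subgroup_pow[OF sR n(3)])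
        moreover have "n * m > 0" using n h by simp
        ultimately show False using oy h(3,4) unfolding obeys.simps by blast
      qed
      have "N.free_over (Y t) (Domain f)" "N.free_over (Y' t) (Range f)"
        using fr[OF f(4) Y(1)] fr[OF f(5) Y(2)] o unfolding Free by blast+
      ultimately show ?thesis using N.good_ext_free[OF g yc(1) _ yc(2)] by (intro fin) blast
    qed
  qed
  then show ?thesis by blast
qed

end

context R_model
begin

text \<open>The entries are functions on a set of assignments, to be evaluated at \<open>e\<close>.\<close>

definition yv :: "('e \<Rightarrow> 'b) list \<Rightarrow> 'e \<Rightarrow> nat \<Rightarrow> 'b" where
  "yv ys e i = (if i < length ys then (ys ! i) e else \<one>)"

text \<open>The conditions \<open>obeys\<close> with truth in the ultrapower replaced by truth at almost every
  assignment with respect to an ultrafilter \<open>U\<close>. The list \<open>ys\<close> contains the earlier entries, \<open>y\<close>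
  is the entry described.\<close>

fun codes :: "'b set \<Rightarrow> 'e filter \<Rightarrow> ('e \<Rightarrow> 'b) list \<Rightarrow> ('e \<Rightarrow> 'b) \<Rightarrow> 'b code \<Rightarrow> bool" where
  "codes B U ys y (Alg m l b) \<longleftrightarrow> m > 0 \<and> lvars l \<subseteq> {..<length ys} \<and> b \<in> B \<and>
     (\<forall>\<^sub>F e in U. y e [^] m = b \<otimes> lin (yv ys e) l)"
| "codes B U ys y (NewR \<Phi>) \<longleftrightarrow> (\<forall>\<^sub>F e in U. y e \<in> R) \<and> (\<forall>\<iota>. \<iota> \<in> \<Phi> \<longleftrightarrow> (\<forall>\<^sub>F e in U. Theta \<iota> (y e))) \<and>
     (\<forall>m>0. \<forall>b\<in>B. \<forall>l. lvars l \<subseteq> {..<length ys} \<longrightarrow>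
        \<not> (\<forall>\<^sub>F e in U. y e [^] (m::nat) = b \<otimes> lin (yv ys e) l))"
| "codes B U ys y (Free \<Phi>) \<longleftrightarrow> (\<forall>\<iota>. \<iota> \<in> \<Phi> \<longleftrightarrow> (\<forall>\<^sub>F e in U. Theta \<iota> (y e))) \<and>
     (\<forall>m>0. \<forall>b\<in>B. \<forall>l. \<forall>\<sigma>. lvars l \<subseteq> {..<length ys} \<longrightarrow>
        \<not> (\<forall>\<^sub>F e in U. \<exists>zs. length zs = length \<sigma> \<and> set zs \<subseteq> R \<and>
             y e [^] (m::nat) = (b \<otimes> lin (yv ys e) l) \<otimes> lc (zip \<sigma> zs)))"

inductive pres :: "'b set \<Rightarrow> 'e filter \<Rightarrow> ('e \<Rightarrow> 'b) list \<Rightarrow> 'b code list \<Rightarrow> bool" for B U where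
  Nil: "pres B U [] []"
| snoc: "pres B U ys cs \<Longrightarrow> (\<And>e. y e \<in> carrier G) \<Longrightarrow> codes B U ys y c \<Longrightarrow> pres B U (ys @ [y]) (cs @ [c])"

lemma pres_nth:
  assumes "pres B U ys cs"
  shows "length ys = length cs" "t < length cs \<Longrightarrow> codes B U (take t ys) (ys ! t) (cs ! t)"
    "t < length cs \<Longrightarrow> (ys ! t) e \<in> carrier G"
  using assms
proof (induction arbitrary: t e)
  case (snoc ys cs y c)
  { case 1 then show ?case using snoc by simp }
  { case 2 then show ?case using snoc by (cases "t < length cs") (auto simp: nth_append less_Suc_eq) }
  { case 3 then show ?case using snoc by (cases "t < length cs") (auto simp: nth_append less_Suc_eq) }
qed auto

lemma pres_add_R:
  assumes "pres B U ys cs" "\<And>e. y e \<in> R"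
  shows "\<exists>c. pres B U (ys @ [y]) (cs @ [c])"
proof (cases "\<exists>m>0. \<exists>b\<in>B. \<exists>l. lvars l \<subseteq> {..<length ys} \<and> (\<forall>\<^sub>F e in U. y e [^] (m::nat) = b \<otimes> lin (yv ys e) l)")
  case True
  then obtain m b l where "m > 0" "b \<in> B" "lvars l \<subseteq> {..<length ys}" "\<forall>\<^sub>F e in U. y e [^] (m::nat) = b \<otimes> lin (yv ys e) l"
    by blast
  then have "codes B U ys y (Alg m l b)" by simp
  then show ?thesis using pres.snoc[OF assms(1)] assms(2) R_closed by blast
next
  case False
  then have "codes B U ys y (NewR {\<iota>. \<forall>\<^sub>F e in U. Theta \<iota> (y e)})"
    unfolding codes.simps mem_Collect_eq using assms(2) by (intro conjI always_eventually) blast+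
  then show ?thesis using pres.snoc[OF assms(1)] assms(2) R_closed by blast
qed

lemma pres_add_R_list:
  assumes "pres B U ys cs" "\<And>z e. z \<in> set zs \<Longrightarrow> z e \<in> R"
  shows "\<exists>cs'. pres B U (ys @ zs) cs'"
  using assms(2)
proof (induction zs rule: rev_induct)
  case Nil
  then show ?case using assms(1) by auto
next
  case (snoc z zs)
  then obtain cs' where "pres B U (ys @ zs) cs'" by auto
  from pres_add_R[OF this, of z] show ?case using snoc.prems by auto
qed

lemma lin_cong: "(\<And>v. v \<in> lvars l \<Longrightarrow> e v = e' v) \<Longrightarrow> lin e l = lin e' l"
  unfolding lin_def by (rule arg_cong[of _ _ lc], rule map_cong[OF refl]) (force simp: lvars_def)

lemma yv_closed: "(\<And>i e. i < length ys \<Longrightarrow> (ys ! i) e \<in> carrier G) \<Longrightarrow> yv ys e ` X \<subseteq> carrier G"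
  by (auto simp: yv_def)

text \<open>If \<open>y\<close> depends on earlier entries modulo sums of elements of \<open>R\<close>, then the summands can be
  chosen as functions of the assignment. Added to the list as entries of their own, they make
  \<open>y\<close> algebraic.\<close>

lemma pres_add:
  assumes p: "pres B U ys cs" and y: "\<And>e. y e \<in> carrier G" and B: "B \<subseteq> carrier G"
  shows "\<exists>zs cs'. pres B U (ys @ zs @ [y]) cs'"
proof (cases "\<exists>m>0. \<exists>b\<in>B. \<exists>l \<sigma>. lvars l \<subseteq> {..<length ys} \<and>
    (\<forall>\<^sub>F e in U. \<exists>zs. length zs = length \<sigma> \<and> set zs \<subseteq> R \<and> y e [^] (m::nat) = (b \<otimes> lin (yv ys e) l) \<otimes> lc (zip \<sigma> zs))")
  case False
  then have "codes B U ys y (Free {\<iota>. \<forall>\<^sub>F e in U. Theta \<iota> (y e)})"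
    unfolding codes.simps mem_Collect_eq by (intro conjI) blast+
  then have "pres B U (ys @ [] @ [y]) (cs @ [Free {\<iota>. \<forall>\<^sub>F e in U. Theta \<iota> (y e)}])"
    using pres.snoc[OF p y] by simp
  then show ?thesis by blast
next
  case True
  let ?P = "\<lambda>m b l \<sigma> e zs. length zs = length \<sigma> \<and> set zs \<subseteq> R \<and> y e [^] (m::nat) = (b \<otimes> lin (yv ys e) l) \<otimes> lc (zip \<sigma> zs)"
  obtain m b l \<sigma> where m: "m > 0" "b \<in> B" "lvars l \<subseteq> {..<length ys}" "\<forall>\<^sub>F e in U. \<exists>zs. ?P m b l \<sigma> e zs"
    using True by blast
  \<comment> \<open>Where there are no summands, \<open>c\<close> is used, since the entries must lie in \<open>R\<close> everywhere.\<close>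
  define zf where "zf e = (if \<exists>zs. ?P m b l \<sigma> e zs then SOME zs. ?P m b l \<sigma> e zs else replicate (length \<sigma>) c0)" for e
  have zf: "length (zf e) = length \<sigma> \<and> set (zf e) \<subseteq> R \<and> ((\<exists>zs. ?P m b l \<sigma> e zs) \<longrightarrow> ?P m b l \<sigma> e (zf e))" for e
  proof (cases "\<exists>zs. ?P m b l \<sigma> e zs")
    case True
    from someI_ex[OF True] have "?P m b l \<sigma> e (zf e)" using True by (simp add: zf_def)
    then show ?thesis by blast
  next
    case False
    then have "zf e = replicate (length \<sigma>) c0" by (simp only: zf_def if_False)
    then show ?thesis using cst_R False by auto
  qed
  define zs where "zs = map (\<lambda>i e. zf e ! i) [0..<length \<sigma>]"
  have "z e \<in> R" if "z \<in> set zs" for z e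
    using that zf[of e] by (auto simp: zs_def)
  then obtain cs' where p': "pres B U (ys @ zs) cs'" using pres_add_R_list[OF p] by blast
  let ?l = "l @ map (\<lambda>i. (\<sigma> ! i, [], length ys + i)) [0..<length \<sigma>]"
  have cl: "yv (ys @ zs) e ` X \<subseteq> carrier G" for e X
    using pres_nth(1,3)[OF p'] by (intro yv_closed) simp
  have lv: "lvars ?l \<subseteq> {..<length (ys @ zs)}"
    using m(3) by (auto simp: lvars_def zs_def)
  have lin: "lin (yv (ys @ zs) e) ?l = lin (yv ys e) l \<otimes> lc (zip \<sigma> (zf e))" for e
  proof -
    have "lin (yv (ys @ zs) e) l = lin (yv ys e) l"
      using m(3) by (intro lin_cong) (auto simp: yv_def nth_append)
    moreover have "lin (yv (ys @ zs) e) (map (\<lambda>i. (\<sigma> ! i, [], length ys + i)) [0..<length \<sigma>]) = lc (zip \<sigma> (zf e))"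
      using zf[of e] by (intro lin_zip) (auto simp: yv_def zs_def nth_append)
    ultimately show ?thesis by (subst lin_append[OF cl cl]) simp
  qed
  have "\<forall>\<^sub>F e in U. y e [^] m = b \<otimes> lin (yv (ys @ zs) e) ?l"
    using m(4)
  proof eventually_elim
    case (elim e)
    then have "?P m b l \<sigma> e (zf e)" using zf[of e] by blast
    then have eq: "y e [^] m = (b \<otimes> lin (yv ys e) l) \<otimes> lc (zip \<sigma> (zf e))" by blast
    have "lin (yv ys e) l \<in> carrier G"
      using pres_nth(1,3)[OF p] by (intro lin_closed yv_closed) simp
    moreover have "snd ` set (zip \<sigma> (zf e)) \<subseteq> set (zf e)" by (auto dest: set_zip_rightD)
    then have "lc (zip \<sigma> (zf e)) \<in> carrier G"
      using zf[of e] R_carrier by (intro lc_closed) blast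
    ultimately show ?case unfolding eq lin using m(2) B by (intro m_assoc) auto
  qed
  then have "codes B U (ys @ zs) y (Alg m ?l b)" using m lv by simp
  then have "pres B U ((ys @ zs) @ [y]) (cs' @ [Alg m ?l b])" by (intro pres.snoc[OF p' y])
  then show ?thesis by auto
qed

lemma ex_pres:
  assumes "\<And>x e. x \<in> set xs \<Longrightarrow> x e \<in> carrier G" "B \<subseteq> carrier G"
  shows "\<exists>ys cs pos. pres B U ys cs \<and> length pos = length xs \<and>
    (\<forall>j<length xs. pos ! j < length ys \<and> ys ! (pos ! j) = xs ! j)"
  using assms(1)
proof (induction xs rule: rev_induct)
  case Nil
  show ?case by (intro exI[of _ "[]"]) (simp add: pres.Nil)
next
  case (snoc x xs)
  then obtain ys cs pos where p: "pres B U ys cs" "length pos = length xs"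
    "\<And>j. j < length xs \<Longrightarrow> pos ! j < length ys \<and> ys ! (pos ! j) = xs ! j" by auto
  obtain zs cs' where p': "pres B U (ys @ zs @ [x]) cs'" using pres_add[OF p(1) _ assms(2), of x] snoc.prems by auto
  let ?pos = "pos @ [length (ys @ zs)]"
  have "?pos ! j < length (ys @ zs @ [x]) \<and> (ys @ zs @ [x]) ! (?pos ! j) = (xs @ [x]) ! j" if "j < length (xs @ [x])" for j
  proof (cases "j < length xs")
    case True
    then show ?thesis using p(2) p(3)[OF True] by (auto simp: nth_append)
  next
    case False
    then have "j = length xs" using that by simp
    then show ?thesis using p(2) by (simp add: nth_append)
  qed
  moreover have "length ?pos = length (xs @ [x])" using p(2) by simp
  ultimately show ?case using p' by blast
qed

text \<open>The single conditions that together express a code over a subset \<open>B\<close> of the parameters: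
  countably many as long as \<open>B\<close> is countable. They can then all be met along one sequence of
  assignments.\<close>

fun conds :: "'b set \<Rightarrow> ('e \<Rightarrow> 'b) list \<Rightarrow> ('e \<Rightarrow> 'b) \<Rightarrow> 'b code \<Rightarrow> ('e \<Rightarrow> bool) set" where
  "conds B ys y (Alg m l b) = {\<lambda>e. y e [^] m = b \<otimes> lin (yv ys e) l}"
| "conds B ys y (NewR \<Phi>) = {\<lambda>e. y e \<in> R} \<union> range (\<lambda>\<iota> e. Theta \<iota> (y e) \<longleftrightarrow> \<iota> \<in> \<Phi>) \<union>
     (\<lambda>(m, b, l) e. y e [^] (m::nat) \<noteq> b \<otimes> lin (yv ys e) l) ` ({0<..} \<times> B \<times> {l. lvars l \<subseteq> {..<length ys}})"
| "conds B ys y (Free \<Phi>) = range (\<lambda>\<iota> e. Theta \<iota> (y e) \<longleftrightarrow> \<iota> \<in> \<Phi>) \<union>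
     (\<lambda>(m, b, l, \<sigma>) e. \<not> (\<exists>zs. length zs = length \<sigma> \<and> set zs \<subseteq> R \<and>
         y e [^] (m::nat) = (b \<otimes> lin (yv ys e) l) \<otimes> lc (zip \<sigma> zs))) `
       ({0<..} \<times> B \<times> {l. lvars l \<subseteq> {..<length ys}} \<times> UNIV)"

lemma countable_conds: "countable B \<Longrightarrow> countable (conds B ys y c)"
  by (cases c) auto

lemma conds_eventually:
  assumes U: "ultra U" and c: "codes B U ys y c" and B: "B0 \<subseteq> B" and P: "P \<in> conds B0 ys y c"
  shows "eventually P U"
proof -
  have Th: "\<forall>\<^sub>F e in U. Theta \<iota> (y e) \<longleftrightarrow> \<iota> \<in> \<Phi>" if "\<iota> \<in> \<Phi> \<longleftrightarrow> (\<forall>\<^sub>F e in U. Theta \<iota> (y e))" for \<iota> \<Phi>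
  proof (cases "\<iota> \<in> \<Phi>")
    case True
    then show ?thesis using that by simp
  next
    case False
    then show ?thesis using that ultra_not[OF U, of "\<lambda>e. Theta \<iota> (y e)"] by simp
  qed
  show ?thesis
  proof (cases c)
    case (Alg m l b)
    then show ?thesis using P c by simp
  next
    case (NewR \<Phi>)
    have "P = (\<lambda>e. y e \<in> R) \<or> P \<in> range (\<lambda>\<iota> e. Theta \<iota> (y e) \<longleftrightarrow> \<iota> \<in> \<Phi>) \<or>
      P \<in> (\<lambda>(m, b, l) e. y e [^] (m::nat) \<noteq> b \<otimes> lin (yv ys e) l) ` ({0<..} \<times> B0 \<times> {l. lvars l \<subseteq> {..<length ys}})"
      using P unfolding NewR by simp
    then consider "P = (\<lambda>e. y e \<in> R)" | \<iota> where "P = (\<lambda>e. Theta \<iota> (y e) \<longleftrightarrow> \<iota> \<in> \<Phi>)"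
      | m b l where "P = (\<lambda>e. y e [^] (m::nat) \<noteq> b \<otimes> lin (yv ys e) l)" "m > 0" "b \<in> B0" "lvars l \<subseteq> {..<length ys}"
      by (elim disjE) (auto simp: image_iff)
    then show ?thesis
    proof cases
      case 1
      then show ?thesis using c NewR by simp
    next
      case (2 \<iota>)
      show ?thesis unfolding 2 by (rule Th) (use c in \<open>unfold NewR codes.simps, blast\<close>)
    next
      case (3 m b l)
      then have "\<not> (\<forall>\<^sub>F e in U. y e [^] m = b \<otimes> lin (yv ys e) l)" using c B unfolding NewR codes.simps by blast
      then show ?thesis unfolding 3(1) using ultra_not[OF U] by blast
    qed
  next
    case (Free \<Phi>)
    let ?E = "\<lambda>m b l \<sigma> e. \<exists>zs. length zs = length \<sigma> \<and> set zs \<subseteq> R \<and> y e [^] (m::nat) = (b \<otimes> lin (yv ys e) l) \<otimes> lc (zip \<sigma> zs)"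
    have "P \<in> range (\<lambda>\<iota> e. Theta \<iota> (y e) \<longleftrightarrow> \<iota> \<in> \<Phi>) \<or>
      P \<in> (\<lambda>(m, b, l, \<sigma>) e. \<not> ?E m b l \<sigma> e) ` ({0<..} \<times> B0 \<times> {l. lvars l \<subseteq> {..<length ys}} \<times> UNIV)"
      using P unfolding Free by simp
    then consider \<iota> where "P = (\<lambda>e. Theta \<iota> (y e) \<longleftrightarrow> \<iota> \<in> \<Phi>)"
      | m b l \<sigma> where "P = (\<lambda>e. \<not> ?E m b l \<sigma> e)" "m > 0" "b \<in> B0" "lvars l \<subseteq> {..<length ys}"
      by (elim disjE) (auto simp: image_iff)
    then show ?thesis
    proof cases
      case (1 \<iota>)
      show ?thesis unfolding 1 by (rule Th) (use c in \<open>unfold Free codes.simps, blast\<close>)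
    next
      case (2 m b l \<sigma>)
      then have "\<not> (\<forall>\<^sub>F e in U. ?E m b l \<sigma> e)" using c B unfolding Free codes.simps by blast
      then show ?thesis unfolding 2(1) using ultra_not[OF U] by blast
    qed
  qed
qed

end

context ultra_model
begin

definition limit_tuple :: "('e \<Rightarrow> 'a) list \<Rightarrow> (nat \<Rightarrow> 'e) \<Rightarrow> nat \<Rightarrow> nat \<Rightarrow> 'a" where
  "limit_tuple ys s i = repr (univ M) W (\<lambda>k. M.yv ys (s k) i)"

lemma limit_tuple:
  assumes "\<And>i e. i < length ys \<Longrightarrow> (ys ! i) e \<in> univ M"
  shows "limit_tuple ys s i \<in> univ N" "\<forall>\<^sub>F k in W. limit_tuple ys s i k = M.yv ys (s k) i"
proof -
  have r: "range (\<lambda>k. M.yv ys (s k) i) \<subseteq> univ M"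
    using assms M.one_closed by (auto simp: M.yv_def)
  show "limit_tuple ys s i \<in> univ N" unfolding limit_tuple_def N_def by (rule repr_in_upow[OF r])
  show "\<forall>\<^sub>F k in W. limit_tuple ys s i k = M.yv ys (s k) i" unfolding limit_tuple_def by (rule repr(2)[OF r])
qed

text \<open>For \<open>Free\<close>, the number and the signs of the summands from \<open>R\<close> have to be fixed before
  passing to the places of the ultrapower; hence one condition for each list of signs.\<close>

lemma conds_obeys:
  assumes p: "M.pres B U ys cs" and t: "t < length cs" and B0: "B0 \<subseteq> univ M"
    and alg: "\<And>m l b. cs ! t = Alg m l b \<Longrightarrow> b \<in> B0"
    and ev: "\<And>P. P \<in> M.conds B0 (take t ys) (ys ! t) (cs ! t) \<Longrightarrow> \<forall>\<^sub>F k in W. P (s k)"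
  shows "obeys B0 (limit_tuple ys s) t (cs ! t)"
proof -
  let ?Y = "limit_tuple ys s"
  have cl: "(ys ! i) e \<in> univ M" if "i < length ys" for i e
    using M.pres_nth(1,3)[OF p] that by simp
  note Y = limit_tuple[OF cl]
  have tl: "t < length ys" using t M.pres_nth(1)[OF p] by simp
  have Yt: "\<forall>\<^sub>F k in W. ?Y t k = (ys ! t) (s k)" using Y(2)[of s t] tl by (simp add: M.yv_def)
  have YtU: "?Y t \<in> univ N" using Y by simp
  have lc: "?Y ` lvars l \<subseteq> univ N" for l using Y(1) by auto
  have linY: "\<forall>\<^sub>F k in W. N.lin ?Y l k = M.lin (M.yv (take t ys) (s k)) l" if l: "lvars l \<subseteq> {..<t}" for l
  proof -
    have "finite (lvars l)" by (simp add: lvars_def)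
    then have "\<forall>\<^sub>F k in W. \<forall>v\<in>lvars l. ?Y v k = M.yv ys (s k) v"
      using Y(2) by (simp add: eventually_ball_finite_distrib)
    then show ?thesis using N_lin[OF lc[of l]]
    proof eventually_elim
      case (elim k)
      have "M.lin (\<lambda>v. ?Y v k) l = M.lin (M.yv (take t ys) (s k)) l"
        using elim(1) l tl by (intro M.lin_cong) (auto simp: M.yv_def)
      then show ?case using elim(2) by simp
    qed
  qed
  have linU: "N.lin ?Y l \<in> univ N" for l using N.lin_closed[of ?Y l] Y(1) by auto
  have bl: "cst b \<otimes>\<^bsub>grp N\<^esub> N.lin ?Y l \<in> univ N"
    "\<forall>\<^sub>F k in W. (cst b \<otimes>\<^bsub>grp N\<^esub> N.lin ?Y l) k = b \<otimes>\<^bsub>grp M\<^esub> M.lin (M.yv (take t ys) (s k)) l"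
    if "b \<in> univ M" "lvars l \<subseteq> {..<t}" for b l
  proof -
    show "cst b \<otimes>\<^bsub>grp N\<^esub> N.lin ?Y l \<in> univ N"
      using N.m_closed[of "cst b" "N.lin ?Y l"] cst_in[OF that(1)] linU by simp
    show "\<forall>\<^sub>F k in W. (cst b \<otimes>\<^bsub>grp N\<^esub> N.lin ?Y l) k = b \<otimes>\<^bsub>grp M\<^esub> M.lin (M.yv (take t ys) (s k)) l"
      using N_mult[OF cst_in[OF that(1)] linU[of l]] cst_ev[OF that(1)] linY[OF that(2)]
      by eventually_elim simp
  qed
  have powU: "?Y t [^]\<^bsub>grp N\<^esub> (m::nat) \<in> univ N" for m using N.nat_pow_closed[of "?Y t" m] YtU by simp
  have pw: "\<forall>\<^sub>F k in W. (?Y t [^]\<^bsub>grp N\<^esub> (m::nat)) k = (ys ! t) (s k) [^]\<^bsub>grp M\<^esub> m" for m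
    using N_pow[OF YtU, of m] Yt by eventually_elim simp
  have lt: "length (take t ys) = t" using tl by simp
  have Th: "\<forall>\<iota>. N.Theta \<iota> (?Y t) \<longleftrightarrow> \<iota> \<in> \<Phi>"
    if e: "\<And>\<iota>. \<forall>\<^sub>F k in W. M.Theta \<iota> ((ys ! t) (s k)) \<longleftrightarrow> \<iota> \<in> \<Phi>" for \<Phi>
  proof
    fix \<iota>
    have "N.Theta \<iota> (?Y t) \<longleftrightarrow> (\<forall>\<^sub>F k in W. M.Theta \<iota> (?Y t k))" by (rule N_Theta[OF YtU])
    also have "\<dots> \<longleftrightarrow> (\<forall>\<^sub>F k in W. \<iota> \<in> \<Phi>)"
      by (rule eventually_iff_cong) (use e[of \<iota>] Yt in eventually_elim, simp)
    also have "\<dots> \<longleftrightarrow> \<iota> \<in> \<Phi>" by (auto dest: W_ex)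
    finally show "N.Theta \<iota> (?Y t) \<longleftrightarrow> \<iota> \<in> \<Phi>" .
  qed
  have code: "M.codes B U (take t ys) (ys ! t) (cs ! t)" by (rule M.pres_nth(2)[OF p t])
  show ?thesis
  proof (cases "cs ! t")
    case (Alg m l b)
    have m: "m > 0" "lvars l \<subseteq> {..<t}" using code lt unfolding Alg by simp_all
    have b: "b \<in> B0" "b \<in> univ M" using alg[OF Alg] B0 by auto
    have "\<forall>\<^sub>F k in W. (ys ! t) (s k) [^]\<^bsub>grp M\<^esub> m = b \<otimes>\<^bsub>grp M\<^esub> M.lin (M.yv (take t ys) (s k)) l"
      using ev[of "\<lambda>e. (ys ! t) e [^]\<^bsub>grp M\<^esub> m = b \<otimes>\<^bsub>grp M\<^esub> M.lin (M.yv (take t ys) e) l"] unfolding Alg by simp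
    then have "\<forall>\<^sub>F k in W. (?Y t [^]\<^bsub>grp N\<^esub> m) k = (cst b \<otimes>\<^bsub>grp N\<^esub> N.lin ?Y l) k"
      using pw[of m] bl(2)[OF b(2) m(2)] by eventually_elim simp
    then have "?Y t [^]\<^bsub>grp N\<^esub> m = cst b \<otimes>\<^bsub>grp N\<^esub> N.lin ?Y l"
      using N_eq_iff[OF powU bl(1)[OF b(2) m(2)]] by blast
    then show ?thesis unfolding Alg obeys.simps using m b by blast
  next
    case (NewR \<Phi>)
    have 1: "\<forall>\<^sub>F k in W. (ys ! t) (s k) \<in> M.R" using ev[of "\<lambda>e. (ys ! t) e \<in> M.R"] unfolding NewR by simp
    have "\<forall>\<^sub>F k in W. ?Y t k \<in> M.R" using 1 Yt by eventually_elim simp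
    then have R: "?Y t \<in> N.R" using N_R[OF YtU] by blast
    have 2: "\<forall>\<^sub>F k in W. M.Theta \<iota> ((ys ! t) (s k)) \<longleftrightarrow> \<iota> \<in> \<Phi>" for \<iota>
      by (rule ev[of "\<lambda>e. M.Theta \<iota> ((ys ! t) e) \<longleftrightarrow> \<iota> \<in> \<Phi>"]) (unfold NewR M.conds.simps, blast)
    have "?Y t \<notin> pspan B0 ?Y t"
    proof
      assume "?Y t \<in> pspan B0 ?Y t"
      then obtain m b l where h: "m > 0" "b \<in> B0" "lvars l \<subseteq> {..<t}" "?Y t [^]\<^bsub>grp N\<^esub> (m::nat) = cst b \<otimes>\<^bsub>grp N\<^esub> N.lin ?Y l"
        unfolding pspan_def by blast
      have bU: "b \<in> univ M" using h B0 by blast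
      let ?P = "\<lambda>e. (ys ! t) e [^]\<^bsub>grp M\<^esub> m \<noteq> b \<otimes>\<^bsub>grp M\<^esub> M.lin (M.yv (take t ys) e) l"
      have "(m, b, l) \<in> {0<..} \<times> B0 \<times> {l. lvars l \<subseteq> {..<length (take t ys)}}" using h lt by simp
      then have "?P \<in> M.conds B0 (take t ys) (ys ! t) (cs ! t)" unfolding NewR M.conds.simps by (intro UnI2) (rule image_eqI, auto)
      then have "\<forall>\<^sub>F k in W. ?P (s k)" by (rule ev)
      then have "\<forall>\<^sub>F k in W. False" using pw[of m, unfolded h(4)] bl(2)[OF bU h(3)] by eventually_elim simp
      then show False using W_ex by blast
    qed
    then show ?thesis unfolding NewR obeys.simps using R Th[OF 2] by blast
  next
    case (Free \<Phi>)
    have 2: "\<forall>\<^sub>F k in W. M.Theta \<iota> ((ys ! t) (s k)) \<longleftrightarrow> \<iota> \<in> \<Phi>" for \<iota>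
      by (rule ev[of "\<lambda>e. M.Theta \<iota> ((ys ! t) e) \<longleftrightarrow> \<iota> \<in> \<Phi>"]) (unfold Free M.conds.simps, blast)
    have "?Y t [^]\<^bsub>grp N\<^esub> (m::nat) \<noteq> cst b \<otimes>\<^bsub>grp N\<^esub> N.lin ?Y l \<otimes>\<^bsub>grp N\<^esub> z"
      if h: "m > 0" "b \<in> B0" "z \<in> generate (grp N) N.R" "lvars l \<subseteq> {..<t}" for m b l z
    proof
      assume eq: "?Y t [^]\<^bsub>grp N\<^esub> m = cst b \<otimes>\<^bsub>grp N\<^esub> N.lin ?Y l \<otimes>\<^bsub>grp N\<^esub> z"
      have bU: "b \<in> univ M" using h B0 by blast
      obtain \<sigma> zs where zs: "length zs = length \<sigma>" "set zs \<subseteq> N.R" "z = N.lc (zip \<sigma> zs)"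
        using h(3) N.generate_R_lc by blast
      have zU: "set zs \<subseteq> univ N" using zs(2) by (auto simp: Rel_R_def)
      have zz: "z \<in> univ N"
      proof -
        have "snd ` set (zip \<sigma> zs) \<subseteq> carrier (grp N)" using zU by (auto dest: set_zip_rightD)
        from N.lc_closed[OF this] show ?thesis using zs(3) by simp
      qed
      have zR: "\<forall>\<^sub>F k in W. \<forall>z\<in>set zs. z k \<in> M.R"
        using zs(2) zU N_R by (auto simp: eventually_ball_finite_distrib)
      let ?P = "\<lambda>e. \<not> (\<exists>zs. length zs = length \<sigma> \<and> set zs \<subseteq> M.R \<and>
         (ys ! t) e [^]\<^bsub>grp M\<^esub> m = (b \<otimes>\<^bsub>grp M\<^esub> M.lin (M.yv (take t ys) e) l) \<otimes>\<^bsub>grp M\<^esub> M.lc (zip \<sigma> zs))"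
      have "(m, b, l, \<sigma>) \<in> {0<..} \<times> B0 \<times> {l. lvars l \<subseteq> {..<length (take t ys)}} \<times> UNIV" using h lt by simp
      then have "?P \<in> M.conds B0 (take t ys) (ys ! t) (cs ! t)" unfolding Free M.conds.simps by (intro UnI2) (rule image_eqI, auto)
      then have "\<forall>\<^sub>F k in W. ?P (s k)" by (rule ev)
      then have "\<forall>\<^sub>F k in W. False"
        using pw[of m, unfolded eq] bl(2)[OF bU h(4)] N_mult[OF bl(1)[OF bU h(4)] zz] N_lc_zip[OF zs(1) zU, folded zs(3)] zR
      proof eventually_elim
        case (elim k)
        have "(ys ! t) (s k) [^]\<^bsub>grp M\<^esub> m = (b \<otimes>\<^bsub>grp M\<^esub> M.lin (M.yv (take t ys) (s k)) l) \<otimes>\<^bsub>grp M\<^esub> M.lc (zip \<sigma> (map (\<lambda>z. z k) zs))"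
          using elim(2,3,4,5) by (simp only:)
        moreover have "length (map (\<lambda>z. z k) zs) = length \<sigma>" "set (map (\<lambda>z. z k) zs) \<subseteq> M.R" using zs(1) elim(6) by auto
        ultimately show ?case using elim(1) by blast
      qed
      then show False using W_ex by blast
    qed
    then show ?thesis unfolding Free obeys.simps using Th[OF 2] by blast
  qed
qed

end

section \<open>Equal codes give equal types\<close>

text \<open>Finite intersections of sets of a proper filter are nonempty.\<close>

lemma countable_sequence:
  assumes U: "U \<noteq> bot" and C: "countable \<C>" "\<And>P. P \<in> \<C> \<Longrightarrow> eventually P U"
  shows "\<exists>s :: nat \<Rightarrow> 'e. \<forall>P\<in>\<C>. \<forall>\<^sub>F k in sequentially. P (s k)"
proof (cases "\<C> = {}")
  case False
  define p where "p = from_nat_into \<C>"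
  have p: "p i \<in> \<C>" for i using False by (simp add: p_def from_nat_into)
  have Cp: "\<C> = range p" using C(1) False by (simp add: p_def)
  have "\<exists>e. \<forall>i\<in>{..k}. p i e" for k
  proof -
    have "\<forall>\<^sub>F e in U. \<forall>i\<in>{..k}. p i e" by (rule eventually_ball_finite) (use p C(2) in auto)
    then show ?thesis using eventually_happens'[OF U] by blast
  qed
  then obtain s where s: "\<And>k i. i \<le> k \<Longrightarrow> p i (s k)" by (metis atMost_iff)
  have "\<forall>\<^sub>F k in sequentially. p i (s k)" for i
    using s by (auto simp: eventually_sequentially)
  then show ?thesis using Cp by blast
qed auto

lemma wf_tm_params_mono: "wf_tm (lang_params L P) t \<Longrightarrow> P \<subseteq> P' \<Longrightarrow> wf_tm (lang_params L P') t"
proof (induction t)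
  case (Fn f ts)
  then show ?case by (cases f) (auto simp: lang_params_def list_all_iff split: if_splits)
qed simp

lemma wf_fm_params_mono: "wf_fm (lang_params L P) \<phi> \<Longrightarrow> P \<subseteq> P' \<Longrightarrow> wf_fm (lang_params L P') \<phi>"
  by (induction \<phi>) (auto simp: wf_tm_params_mono, auto simp: lang_params_def)

lemma finite_params_tm: "wf_tm (lang_params L A) t \<Longrightarrow> \<exists>P. finite P \<and> P \<subseteq> A \<and> wf_tm (lang_params L P) t"
proof (induction t)
  case (Fn f ts)
  have "\<forall>t\<in>set ts. \<exists>P. finite P \<and> P \<subseteq> A \<and> wf_tm (lang_params L P) t"
    using Fn by (auto simp: list_all_iff)
  then obtain Pf where Pf: "\<And>t. t \<in> set ts \<Longrightarrow> finite (Pf t) \<and> Pf t \<subseteq> A \<and> wf_tm (lang_params L (Pf t)) t" by metis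
  define P where "P = (\<Union>t\<in>set ts. Pf t) \<union> (case f of Inl _ \<Rightarrow> {} | Inr a \<Rightarrow> {a})"
  have "wf_tm (lang_params L P) t" if "t \<in> set ts" for t
    using Pf[OF that] that by (intro wf_tm_params_mono[of L "Pf t" t P]) (auto simp: P_def)
  moreover have "far (lang_params L P) f = Some (length ts)"
    using Fn.prems by (auto simp: lang_params_def P_def split: sum.splits if_splits)
  ultimately have "wf_tm (lang_params L P) (Fn f ts)" by (auto simp: list_all_iff)
  moreover have "finite P" "P \<subseteq> A"
    using Pf Fn.prems by (auto simp: P_def lang_params_def split: sum.splits if_splits)
  ultimately show ?case by blast
qed auto

lemma finite_params_fm: "wf_fm (lang_params L A) \<phi> \<Longrightarrow> \<exists>P. finite P \<and> P \<subseteq> A \<and> wf_fm (lang_params L P) \<phi>"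
proof (induction \<phi>)
  case (Eq s t)
  then obtain P P' where "finite P" "P \<subseteq> A" "wf_tm (lang_params L P) s" "finite P'" "P' \<subseteq> A" "wf_tm (lang_params L P') t"
    using finite_params_tm[of L A s] finite_params_tm[of L A t] by auto
  then show ?case using wf_tm_params_mono[of L P s "P \<union> P'"] wf_tm_params_mono[of L P' t "P \<union> P'"]
    by (intro exI[of _ "P \<union> P'"]) auto
next
  case (Rel p ts)
  have "\<forall>t\<in>set ts. \<exists>P. finite P \<and> P \<subseteq> A \<and> wf_tm (lang_params L P) t"
    using Rel finite_params_tm[of L A] by simp
  then obtain Pf where Pf: "\<And>t. t \<in> set ts \<Longrightarrow> finite (Pf t) \<and> Pf t \<subseteq> A \<and> wf_tm (lang_params L (Pf t)) t" by metis
  let ?P = "\<Union>t\<in>set ts. Pf t"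
  have "wf_tm (lang_params L ?P) t" if "t \<in> set ts" for t
    using Pf[OF that] that by (intro wf_tm_params_mono[of L "Pf t" t ?P]) auto
  moreover have "par (lang_params L ?P) p = Some (length ts)" using Rel by (simp add: lang_params_def)
  ultimately have "wf_fm (lang_params L ?P) (Rel p ts)" by simp
  moreover have "finite ?P" "?P \<subseteq> A" using Pf by auto
  ultimately show ?case by blast
next
  case (Imp \<phi> \<psi>)
  then obtain P P' where "finite P" "P \<subseteq> A" "wf_fm (lang_params L P) \<phi>" "finite P'" "P' \<subseteq> A" "wf_fm (lang_params L P') \<psi>"
    by auto
  then show ?case using wf_fm_params_mono[of L P \<phi> "P \<union> P'"] wf_fm_params_mono[of L P' \<psi> "P \<union> P'"]
    by (intro exI[of _ "P \<union> P'"]) auto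
qed auto

text \<open>The coordinate functions, with a default value that keeps them in the universe for every
  assignment.\<close>

definition coord :: "(fsym, psym, 'a) struct \<Rightarrow> nat \<Rightarrow> (nat \<Rightarrow> 'a) \<Rightarrow> 'a" where
  "coord M j e = (if e j \<in> univ M then e j else fint M Zero [])"

definition par_closure :: "(fsym, psym, 'a) struct \<Rightarrow> 'a set \<Rightarrow> 'a set" where
  "par_closure M A = clos (R_model.closing_functions (grp M) M) (univ M) A"

definition presents :: "(fsym, psym, 'a) struct \<Rightarrow> 'a set \<Rightarrow> nat \<Rightarrow> (nat \<Rightarrow> 'a) filter \<Rightarrow> ((nat \<Rightarrow> 'a) \<Rightarrow> 'a) list \<Rightarrow> 'a code list \<Rightarrow> nat list \<Rightarrow> bool" where
  "presents M B n U ys cs pos \<longleftrightarrow> R_model.pres (grp M) M B U ys cs \<and>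
     (\<forall>j<n. pos ! j < length cs \<and> ys ! (pos ! j) = coord M j)"

text \<open>A formula has finitely many parameters, and so do the codes. Only the countable closure
  \<open>B0\<close> of these matters, so that for each of the two ultrafilters the relevant conditions can be
  met along a sequence of assignments. The two sequences define tuples in an ultrapower over the
  natural numbers that obey the same codes, and back and forth transfers the formula from one to
  the other.\<close>

theorem same_code_same_type:
  fixes M :: "(fsym, psym, 'a) struct"
  assumes core: "is_model LR (core_axioms r E) M" and isE: "is_E r E"
    and UV: "ultra U" "ultra V" and A: "A \<subseteq> univ M"
    and rg: "\<forall>\<^sub>F e in U. range e \<subseteq> univ M" "\<forall>\<^sub>F e in V. range e \<subseteq> univ M"
    and codes: "presents M (par_closure M A) n U ys cs pos" "presents M (par_closure M A) n V ys' cs pos"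
    and \<phi>: "\<phi> \<in> fms_over LR A n" and sat: "\<forall>\<^sub>F e in U. sat (struct_params M) e \<phi>"
  shows "\<forall>\<^sub>F e in V. sat (struct_params M) e \<phi>"
proof (rule ccontr)
  assume "\<not> ?thesis"
  then have nsat: "\<forall>\<^sub>F e in V. \<not> sat (struct_params M) e \<phi>" using ultra_not[OF UV(2)] by blast
  obtain W :: "nat filter" where Wf: "W \<le> sequentially" "ultra W"
    using ex_ultra[of "sequentially :: nat filter"] by auto
  interpret ultra_model r E M W by unfold_locales (use core isE Wf in auto)
  let ?F = "M.closing_functions"
  have Bdef: "par_closure M A = clos ?F (univ M) A" by (simp add: par_closure_def)
  have p: "M.pres (par_closure M A) U ys cs" "M.pres (par_closure M A) V ys' cs"
    and pos: "\<And>j. j < n \<Longrightarrow> pos ! j < length cs \<and> ys ! (pos ! j) = coord M j \<and> ys' ! (pos ! j) = coord M j"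
    using codes by (auto simp: presents_def)
  obtain P0 where P0: "finite P0" "P0 \<subseteq> A" "wf_fm (lang_params LR P0) \<phi>"
    using finite_params_fm[of LR A \<phi>] \<phi> by (auto simp: fms_over_def)
  have fv: "fv \<phi> \<subseteq> {..<n}" using \<phi> by (simp add: fms_over_def)
  \<comment> \<open>The finitely many parameters of the formula and of the codes.\<close>
  define X0 where "X0 = P0 \<union> {b. \<exists>m l. Alg m l b \<in> set cs}"
  define B0 where "B0 = clos ?F (univ M) X0"
  have "{b. \<exists>m l. Alg m l b \<in> set cs} \<subseteq> (\<lambda>c. case c of Alg m l b \<Rightarrow> b) ` set cs"
    by (force simp: image_iff)
  then have "finite X0" unfolding X0_def using P0(1) finite_subset by blast
  have AB: "A \<subseteq> par_closure M A" unfolding Bdef by (auto intro: clos.base)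
  have BU: "par_closure M A \<subseteq> univ M" unfolding Bdef by (rule clos_subset[OF A])
  have X0B: "X0 \<subseteq> par_closure M A"
  proof
    fix x assume "x \<in> X0"
    then consider "x \<in> P0" | m l where "Alg m l x \<in> set cs"
      unfolding X0_def by blast
    then show "x \<in> par_closure M A"
    proof cases
      case 1
      then show ?thesis using P0 AB by blast
    next
      case (2 m l)
      then obtain t where "t < length cs" "cs ! t = Alg m l x" by (auto simp: in_set_conv_nth)
      then show ?thesis using M.pres_nth(2)[OF p(1), of t] by simp
    qed
  qed
  have X0U: "X0 \<subseteq> univ M" using X0B BU by blast
  have B0B: "B0 \<subseteq> par_closure M A" unfolding B0_def Bdef by (rule clos_minimal) (use X0B Bdef in simp)
  have B0U: "B0 \<subseteq> univ M" using B0B BU by blast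
  have X0B0: "X0 \<subseteq> B0" unfolding B0_def by (auto intro: clos.base)
  have B0c: "countable B0" unfolding B0_def
    using countable_finite[OF \<open>finite X0\<close>] M.countable_closing_functions by (rule countable_clos)
  have B0cl: "M.closed_set B0" unfolding B0_def using M.closed_set_clos[of X0] X0U by simp
  have seq: "\<exists>s. (\<forall>\<^sub>F k in W. range (s k) \<subseteq> univ M) \<and> (\<forall>\<^sub>F k in W. Q (s k)) \<and>
      (\<forall>t<length cs. obeys B0 (limit_tuple zs s) t (cs ! t))"
    if F: "ultra F" "\<forall>\<^sub>F e in F. range e \<subseteq> univ M" "\<forall>\<^sub>F e in F. Q e" and pF: "M.pres (par_closure M A) F zs cs"
    for F :: "(nat \<Rightarrow> 'a) filter" and zs Q
  proof -
    let ?C = "{\<lambda>e. range e \<subseteq> univ M, Q} \<union> (\<Union>t\<in>{..<length cs}. M.conds B0 (take t zs) (zs ! t) (cs ! t))"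
    have cC: "countable ?C" using M.countable_conds[OF B0c] by auto
    have evC: "eventually P F" if "P \<in> ?C" for P
    proof -
      consider "P = (\<lambda>e. range e \<subseteq> univ M)" | "P = Q" | t where "t < length cs" "P \<in> M.conds B0 (take t zs) (zs ! t) (cs ! t)"
        using \<open>P \<in> ?C\<close> by auto
      then show ?thesis
      proof cases
        case (3 t)
        then show ?thesis using M.conds_eventually[OF F(1) M.pres_nth(2)[OF pF 3(1)] B0B] by blast
      qed (use F in auto)
    qed
    have "F \<noteq> bot" using F(1) by (simp add: ultra_def)
    from countable_sequence[OF this cC evC]
    obtain s where s: "\<forall>P\<in>?C. \<forall>\<^sub>F k in sequentially. P (s k)" by (rule exE)
    have sW: "\<forall>\<^sub>F k in W. P (s k)" if "P \<in> ?C" for P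
      using bspec[OF s that] W(2) by (rule filter_leD[rotated])
    have "obeys B0 (limit_tuple zs s) t (cs ! t)" if t: "t < length cs" for t
    proof (rule conds_obeys[OF pF t B0U])
      show "b \<in> B0" if "cs ! t = Alg m l b" for m l b
      proof -
        have "Alg m l b \<in> set cs" using that t by (metis nth_mem)
        then have "b \<in> X0" unfolding X0_def by blast
        then show ?thesis using X0B0 by blast
      qed
      show "\<forall>\<^sub>F k in W. P (s k)" if "P \<in> M.conds B0 (take t zs) (zs ! t) (cs ! t)" for P
        using that t by (intro sW) blast
    qed
    moreover have "\<forall>\<^sub>F k in W. range (s k) \<subseteq> univ M" by (rule sW) blast
    moreover have "\<forall>\<^sub>F k in W. Q (s k)" by (rule sW) blast
    ultimately show ?thesis by blast
  qed
  obtain s where s: "\<forall>\<^sub>F k in W. range (s k) \<subseteq> univ M" "\<forall>\<^sub>F k in W. sat (struct_params M) (s k) \<phi>"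
    "\<And>t. t < length cs \<Longrightarrow> obeys B0 (limit_tuple ys s) t (cs ! t)"
    using seq[OF UV(1) rg(1) sat p(1)] by blast
  obtain s' where s': "\<forall>\<^sub>F k in W. range (s' k) \<subseteq> univ M" "\<forall>\<^sub>F k in W. \<not> sat (struct_params M) (s' k) \<phi>"
    "\<And>t. t < length cs \<Longrightarrow> obeys B0 (limit_tuple ys' s') t (cs ! t)"
    using seq[OF UV(2) rg(2) nsat p(2)] by blast
  have cl: "(ys ! i) e \<in> univ M" if "i < length ys" for i e using M.pres_nth(1,3)[OF p(1)] that by simp
  have cl': "(ys' ! i) e \<in> univ M" if "i < length ys'" for i e using M.pres_nth(1,3)[OF p(2)] that by simp
  obtain f where f: "bf f" "diag B0 \<subseteq> f" "\<And>i. i < length cs \<Longrightarrow> (limit_tuple ys s i, limit_tuple ys' s' i) \<in> f"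
    using obeys_bf[OF B0cl B0c, of "limit_tuple ys s" "limit_tuple ys' s'" cs] limit_tuple(1)[OF cl] limit_tuple(1)[OF cl'] s(3) s'(3)
    by blast
  let ?N = "upow W (struct_params M)" and ?z = "fint N Zero []"
  let ?e = "\<lambda>v. limit_tuple ys s (pos ! v)" and ?e' = "\<lambda>v. limit_tuple ys' s' (pos ! v)"
  have "sat ?N ?e \<phi> \<longleftrightarrow> sat ?N ?e' \<phi>"
  proof (rule bf_params[OF f(1) P0(3)])
    show "(cst a, cst a) \<in> f" if "a \<in> P0" for a
      using that X0B0 f(2) by (auto simp: X0_def diag_def)
    show "(?e v, ?e' v) \<in> f" if "v \<in> fv \<phi>" for v
      using that fv pos[of v] f(3) by blast
  qed
  moreover have str: "is_struct (lang_params LR P0) (struct_params M)"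
    using M_struct P0(2) A unfolding is_struct_def lang_params_def struct_params_def
    by (auto split: sum.splits if_splits)
  have uN: "univ ?N = univ N" by (simp add: N_def upow_def struct_params_def)
  have losN: "sat ?N (\<lambda>v. limit_tuple zs q (pos ! v)) \<phi> \<longleftrightarrow> (\<forall>\<^sub>F k in W. sat (struct_params M) (q k) \<phi>)"
    if c: "\<And>i e. i < length zs \<Longrightarrow> (zs ! i) e \<in> univ M" and rq: "\<forall>\<^sub>F k in W. range (q k) \<subseteq> univ M"
      and lz: "length zs = length cs" and pz: "\<And>j. j < n \<Longrightarrow> zs ! (pos ! j) = coord M j" for zs q
  proof -
    have "sat ?N (\<lambda>v. limit_tuple zs q (pos ! v)) \<phi> \<longleftrightarrow>
        (\<forall>\<^sub>F k in W. sat (struct_params M) (\<lambda>v. limit_tuple zs q (pos ! v) k) \<phi>)"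
      using limit_tuple(1)[OF c] unfolding uN[symmetric] by (intro los[OF W(1) str P0(3)]) blast
    also have "\<dots> \<longleftrightarrow> (\<forall>\<^sub>F k in W. sat (struct_params M) (q k) \<phi>)"
    proof (rule eventually_iff_cong)
      have "finite (fv \<phi>)" using fv finite_subset by blast
      then have "\<forall>\<^sub>F k in W. \<forall>v\<in>fv \<phi>. limit_tuple zs q (pos ! v) k = M.yv zs (q k) (pos ! v)"
        using limit_tuple(2)[OF c] by (simp add: eventually_ball_finite_distrib)
      then show "\<forall>\<^sub>F k in W. sat (struct_params M) (\<lambda>v. limit_tuple zs q (pos ! v) k) \<phi> \<longleftrightarrow> sat (struct_params M) (q k) \<phi>"
        using rq
      proof eventually_elim
        case (elim k)
        show ?case
        proof (rule sat_cong)
          fix v assume v: "v \<in> fv \<phi>"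
          then have "v < n" using fv by blast
          then have "M.yv zs (q k) (pos ! v) = coord M v (q k)" using pos[of v] pz[of v] lz by (simp add: M.yv_def)
          also have "\<dots> = q k v" using elim(2) by (auto simp: coord_def)
          finally show "limit_tuple zs q (pos ! v) k = q k v" using elim(1) v by simp
        qed
      qed
    qed
    finally show ?thesis .
  qed
  have "sat ?N ?e \<phi>" using losN[OF cl s(1)] M.pres_nth(1)[OF p(1)] pos s(2) by blast
  moreover have "\<not> sat ?N ?e' \<phi>"
    using losN[OF cl' s'(1)] M.pres_nth(1)[OF p(2)] pos s'(2) ultra_not[OF W(1)] by blast
  ultimately show False by blast
qed

section \<open>Counting types\<close>

text \<open>The sets of assignments that satisfy a formula of \<open>p\<close> have the finite intersection
  property, and completeness of \<open>p\<close> makes any ultrafilter containing them determine \<open>p\<close>.\<close>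

lemma type_ultrafilter:
  assumes p: "p \<in> types_over L M A n"
  shows "\<exists>U. ultra U \<and> (\<forall>\<^sub>F e in U. range e \<subseteq> univ M) \<and>
    (\<forall>\<phi>\<in>fms_over L A n. \<phi> \<in> p \<longleftrightarrow> (\<forall>\<^sub>F e in U. sat (struct_params M) e \<phi>))"
proof -
  let ?S = "\<lambda>\<phi>. {e. range e \<subseteq> univ M \<and> sat (struct_params M) e \<phi>}"
  let ?F = "INF \<phi>\<in>p. principal (?S \<phi>)"
  have FF: "FF \<in> fms_over L A n" by (simp add: fms_over_def)
  then have ne: "p \<noteq> {}" using p unfolding types_over_def by blast
  have "?F \<noteq> bot"
  proof
    assume "?F = bot"
    then have "eventually (\<lambda>_. False) ?F" by simp
    then obtain X where X: "X \<subseteq> p" "finite X" "eventually (\<lambda>_. False) (INF \<phi>\<in>X. principal (?S \<phi>))"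
      unfolding eventually_INF[of _ _ p] by blast
    then have e: "(\<Inter>\<phi>\<in>X. ?S \<phi>) = {}" 
      by (simp only: INF_principal_finite eventually_principal) blast
    obtain \<psi> where \<psi>: "\<psi> \<in> p" using ne by blast
    have "fin_sat M p" using p by (simp add: types_over_def)
    then obtain e where "range e \<subseteq> univ M" "\<forall>\<phi>\<in>X. sat (struct_params M) e \<phi>"
      unfolding fin_sat_def using X by blast
    then have "e \<in> (\<Inter>\<phi>\<in>X. ?S \<phi>)" by blast
    then show False using e by blast
  qed
  then obtain U where U: "U \<le> ?F" "ultra U" by (rule ex_ultra)
  have ev: "eventually (\<lambda>e. e \<in> ?S \<phi>) U" if "\<phi> \<in> p" for \<phi>
  proof (rule filter_leD[OF U(1)])
    have "eventually (\<lambda>e. e \<in> ?S \<phi>) (principal (?S \<phi>))" by (simp add: eventually_principal)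
    then show "eventually (\<lambda>e. e \<in> ?S \<phi>) ?F" by (rule eventually_INF1[OF that])
  qed
  have "\<forall>\<^sub>F e in U. range e \<subseteq> univ M"
  proof -
    obtain \<psi> where "\<psi> \<in> p" using ne by blast
    from ev[OF this] show ?thesis by eventually_elim simp
  qed
  moreover have "\<phi> \<in> p \<longleftrightarrow> (\<forall>\<^sub>F e in U. sat (struct_params M) e \<phi>)" if \<phi>: "\<phi> \<in> fms_over L A n" for \<phi>
  proof
    assume "\<phi> \<in> p"
    from ev[OF this] show "\<forall>\<^sub>F e in U. sat (struct_params M) e \<phi>" by eventually_elim simp
  next
    assume s: "\<forall>\<^sub>F e in U. sat (struct_params M) e \<phi>"
    show "\<phi> \<in> p"
    proof (rule ccontr)
      assume "\<phi> \<notin> p"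
      then have "Neg \<phi> \<in> p" using p \<phi> by (auto simp: types_over_def)
      from ev[OF this] have "\<forall>\<^sub>F e in U. \<not> sat (struct_params M) e \<phi>" by eventually_elim simp
      then show False using s ultra_not[OF U(2)] by blast
    qed
  qed
  ultimately show ?thesis using U(2) by blast
qed

definition codes_over :: "'a set \<Rightarrow> 'a code set" where
  "codes_over B = (\<lambda>(m, l, b). Alg m l b) ` (UNIV \<times> UNIV \<times> B) \<union> (range NewR \<union> range Free)"

lemma card_codes_over:
  fixes B :: "'a set" and K :: "'k set"
  assumes K: "infinite K" "|UNIV :: nat set set| \<le>o |K|" and B: "|B| \<le>o |K|"
  shows "|codes_over B| \<le>o |K|"
proof -
  have "|(UNIV :: nat set) \<times> (UNIV :: lin set) \<times> B| \<le>o |K|"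
    by (rule card_Times[OF K(1) card_countable[OF K(1)] card_Times[OF K(1) card_countable[OF K(1)] B]]) auto
  then have 1: "|(\<lambda>(m, l, b). Alg m l b) ` ((UNIV :: nat set) \<times> (UNIV :: lin set) \<times> B)| \<le>o |K|"
    using card_of_image ordLeq_transitive by blast
  have sets: "|UNIV :: (nat \<times> nat \<times> lin) set set| \<le>o |K|"
  proof -
    have "inj (\<lambda>\<Phi> :: (nat \<times> nat \<times> lin) set. to_nat ` \<Phi>)" by (intro inj_onI) (simp add: inj_image_eq_iff)
    then have "|UNIV :: (nat \<times> nat \<times> lin) set set| \<le>o |UNIV :: nat set set|"
      by (intro card_of_ordLeq[THEN iffD1]) auto
    then show ?thesis using K(2) by (rule ordLeq_transitive)
  qed
  have 2: "|range (NewR :: _ \<Rightarrow> 'a code)| \<le>o |K|" and 3: "|range (Free :: _ \<Rightarrow> 'a code)| \<le>o |K|"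
    using ordLeq_transitive[OF card_of_image sets] by blast+
  show ?thesis unfolding codes_over_def using 1 2 3 by (intro card_Un[OF K(1)])
qed

text \<open>The map that sends a type to the codes of its coordinates and their positions is
  injective, and its values are finite lists over a set of cardinality at most \<open>|K|\<close>. The
  continuum enters through the sets \<open>\<Phi>\<close> in the codes.\<close>

lemma card_types:
  fixes M :: "(fsym, psym, 'a) struct" and K :: "'k set"
  assumes core: "is_model LR (core_axioms r E) M" and isE: "is_E r E"
    and A: "A \<subseteq> univ M" "|A| \<le>o |K|" and K: "infinite K" "|UNIV :: nat set set| \<le>o |K|"
  shows "|types_over LR M A n| \<le>o |K|"
proof -
  interpret R_model "grp M" M by (rule model_R_model[OF core isE])
  let ?B = "par_closure M A"
  have BU: "?B \<subseteq> univ M" unfolding par_closure_def by (rule clos_subset[OF A(1)])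
  have cB: "|?B| \<le>o |K|" unfolding par_closure_def
    by (rule card_clos[OF K(1) A(2) countable_closing_functions])
  have cy: "coord M j e \<in> carrier (grp M)" for j e
    using one_closed by (auto simp: coord_def)
  have ex: "\<exists>c U ys. c \<in> lists (codes_over ?B) \<times> lists UNIV \<and> ultra U \<and> (\<forall>\<^sub>F e in U. range e \<subseteq> univ M) \<and>
     (\<forall>\<phi>\<in>fms_over LR A n. \<phi> \<in> p \<longleftrightarrow> (\<forall>\<^sub>F e in U. sat (struct_params M) e \<phi>)) \<and>
     presents M ?B n U ys (fst c) (snd c)" if p: "p \<in> types_over LR M A n" for p
  proof -
    obtain U where U: "ultra U" "\<forall>\<^sub>F e in U. range e \<subseteq> univ M"
      "\<forall>\<phi>\<in>fms_over LR A n. \<phi> \<in> p \<longleftrightarrow> (\<forall>\<^sub>F e in U. sat (struct_params M) e \<phi>)"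
      using type_ultrafilter[OF p] by blast
    have "\<exists>ys cs pos. pres ?B U ys cs \<and> length pos = length (map (coord M) [0..<n]) \<and>
      (\<forall>j<length (map (coord M) [0..<n]). pos ! j < length ys \<and> ys ! (pos ! j) = map (coord M) [0..<n] ! j)"
      by (rule ex_pres) (use cy BU in auto)
    then obtain ys cs pos where q0: "pres ?B U ys cs"
      "\<forall>j<length (map (coord M) [0..<n]). pos ! j < length ys \<and> ys ! (pos ! j) = map (coord M) [0..<n] ! j"
      by blast
    have q: "pres ?B U ys cs" "\<And>j. j < n \<Longrightarrow> pos ! j < length ys \<and> ys ! (pos ! j) = coord M j"
      using q0 by simp_all
    have "cs ! t \<in> codes_over ?B" if "t < length cs" for t
      using pres_nth(2)[OF q(1) that] by (cases "cs ! t") (auto simp: codes_over_def image_iff)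
    then have "set cs \<subseteq> codes_over ?B" by (auto simp: in_set_conv_nth)
    then have "(cs, pos) \<in> lists (codes_over ?B) \<times> lists UNIV" by (auto simp: lists_eq_set)
    moreover have "presents M ?B n U ys cs pos"
      using q pres_nth(1)[OF q(1)] by (auto simp: presents_def)
    ultimately show ?thesis using U by (intro exI[of _ "(cs, pos)"] exI[of _ U] exI[of _ ys]) auto
  qed
  then obtain C where C: "\<And>p. p \<in> types_over LR M A n \<Longrightarrow> \<exists>U ys. C p \<in> lists (codes_over ?B) \<times> lists UNIV \<and> ultra U \<and> (\<forall>\<^sub>F e in U. range e \<subseteq> univ M) \<and>
     (\<forall>\<phi>\<in>fms_over LR A n. \<phi> \<in> p \<longleftrightarrow> (\<forall>\<^sub>F e in U. sat (struct_params M) e \<phi>)) \<and>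
     presents M ?B n U ys (fst (C p)) (snd (C p))" by metis
  have "inj_on C (types_over LR M A n)"
  proof (rule inj_onI)
    have sub: "p \<subseteq> q" if p: "p \<in> types_over LR M A n" and q: "q \<in> types_over LR M A n" and eq: "C p = C q" for p q
    proof
      fix \<phi> assume \<phi>: "\<phi> \<in> p"
      then have \<phi>f: "\<phi> \<in> fms_over LR A n" using p by (auto simp: types_over_def)
      obtain U ys where U: "ultra U" "\<forall>\<^sub>F e in U. range e \<subseteq> univ M"
        "\<forall>\<phi>\<in>fms_over LR A n. \<phi> \<in> p \<longleftrightarrow> (\<forall>\<^sub>F e in U. sat (struct_params M) e \<phi>)"
        "presents M ?B n U ys (fst (C p)) (snd (C p))" using C[OF p] by blast
      obtain V ys' where V: "ultra V" "\<forall>\<^sub>F e in V. range e \<subseteq> univ M"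
        "\<forall>\<phi>\<in>fms_over LR A n. \<phi> \<in> q \<longleftrightarrow> (\<forall>\<^sub>F e in V. sat (struct_params M) e \<phi>)"
        "presents M ?B n V ys' (fst (C q)) (snd (C q))" using C[OF q] by blast
      have "\<forall>\<^sub>F e in U. sat (struct_params M) e \<phi>" using U(3) \<phi> \<phi>f by blast
      then have "\<forall>\<^sub>F e in V. sat (struct_params M) e \<phi>"
        by (rule same_code_same_type[OF core isE U(1) V(1) A(1) U(2) V(2) U(4) V(4)[folded eq] \<phi>f])
      then show "\<phi> \<in> q" using V(3) \<phi>f by blast
    qed
    fix p q assume "p \<in> types_over LR M A n" "q \<in> types_over LR M A n" "C p = C q"
    then show "p = q" using sub[of p q] sub[of q p] by auto
  qed
  moreover have "C ` types_over LR M A n \<subseteq> lists (codes_over ?B) \<times> lists (UNIV :: nat set)" using C by blast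
  ultimately have "|types_over LR M A n| \<le>o |lists (codes_over ?B) \<times> lists (UNIV :: nat set)|"
    by (intro card_of_ordLeq[THEN iffD1] exI[of _ C] conjI)
  also have "|lists (codes_over ?B) \<times> lists (UNIV :: nat set)| \<le>o |K|"
    by (intro card_Times[OF K(1)] card_lists[OF K(1)] card_codes_over[OF K cB] card_countable[OF K(1)]) simp
  finally show ?thesis .
qed

text \<open>The threshold for stability is the number of sets of formulas. It is at least the
  continuum, as there are infinitely many formulas.\<close>

theorem theorem2p20:
  fixes r :: "nat \<Rightarrow> nat"
    and e :: "int poly \<Rightarrow> nat"
    and E :: "int poly list \<Rightarrow> int list set"
  assumes "regular_seq r"
    and "is_e r e"
    and "is_E r E"
  shows "superstable LR (T_R r e E) TYPE('a) TYPE('k)"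
  unfolding superstable_def stable_in_def
proof (intro allI impI)
  fix K :: "'k set" and M :: "(fsym, psym, 'a) struct" and A n
  assume K: "|Pow {\<phi> :: rfm. wf_fm LR \<phi>}| \<le>o |K|" and M: "is_model LR (T_R r e E) M"
    and A: "A \<subseteq> univ M" "|A| \<le>o |K|"
  have core: "is_model LR (core_axioms r E) M"
    using M by (auto simp: is_model_def core_axioms_def T_R_def)
  \<comment> \<open>Distinct well-formed formulas, so that sets of natural numbers embed into sets of formulas.\<close>
  define h :: "nat \<Rightarrow> rfm" where "h i = Eq (Var i) (Var i)" for i
  have h: "inj h" "\<And>i. wf_fm LR (h i)" by (auto simp: h_def inj_def)
  have "inj (image h)" using h(1) by (intro inj_onI) (simp add: inj_image_eq_iff)
  moreover have "range (image h) \<subseteq> Pow {\<phi> :: rfm. wf_fm LR \<phi>}" using h(2) by auto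
  ultimately have "|UNIV :: nat set set| \<le>o |Pow {\<phi> :: rfm. wf_fm LR \<phi>}|"
    by (intro card_of_ordLeq[THEN iffD1] exI[of _ "image h"] conjI)
  then have K2: "|UNIV :: nat set set| \<le>o |K|" using K by (rule ordLeq_transitive)
  have "infinite (UNIV :: nat set set)" by (simp add: Finite_Set.finite_set)
  then have K1: "infinite K" using K2 card_of_ordLeq_infinite by blast
  show "|types_over LR M A n| \<le>o |K|"
    by (rule card_types[OF core assms(3) A K1 K2])
qed

end
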